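(* Let $G$ be a finite solvable group. Then $G$ is nilpotent if and only if $\chi(1)^2$ divides $|G : \ker\chi|$ for each $\chi \in \operatorname{Irr}_{\mathcal{P}}(G)$.
   Context: All groups are finite and all characters are complex characters. $\operatorname{Irr}(G)$ is the set of irreducible characters of $G$. For a subgroup $M\le G$, $1_M$ is the principal (trivial) character of $M$ and $(1_M)^G$ is the character of $G$ induced from it. A character $\chi \in \operatorname{Irr}(G)$ is a $\mathcal{P}$-character of $G$ if $[\chi,(1_M)^G]\neq 0$ for some maximal subgroup $M$ of $G$, where $[\cdot,\cdot]$ is the usual inner product of class functions. $\operatorname{Irr}_{\mathcal{P}}(G)$ denotes the set of all $\mathcal{P}$-characters of $G$. The kernel of a character $\chi$ is $\ker\chi=\{g\in G \mid \chi(g)=\chi(1)\}$. *)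

theory Defs
  imports
    "HOL-Algebra.Solvable_Groups"
    "HOL-Algebra.Coset"
    "Jordan_Normal_Form.VS_Connect"
begin

subsection \<open>Group-theoretic notions\<close>

definition maximal_subgroup :: "'a set \<Rightarrow> ('a, 'b) monoid_scheme \<Rightarrow> bool" where
  "maximal_subgroup M G \<longleftrightarrow>
     subgroup M G \<and> M \<noteq> carrier G \<and>
     (\<forall>H. subgroup H G \<longrightarrow> M \<subseteq> H \<longrightarrow> H = M \<or> H = carrier G)"

definition commutator_subgroup :: "('a, 'b) monoid_scheme \<Rightarrow> 'a set \<Rightarrow> 'a set \<Rightarrow> 'a set" where
  "commutator_subgroup G H K =
     generate G (\<Union>h \<in> H. \<Union>k \<in> K.
       { h \<otimes>\<^bsub>G\<^esub> k \<otimes>\<^bsub>G\<^esub> (inv\<^bsub>G\<^esub> h) \<otimes>\<^bsub>G\<^esub> (inv\<^bsub>G\<^esub> k) })"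

primrec lower_central :: "('a, 'b) monoid_scheme \<Rightarrow> nat \<Rightarrow> 'a set" where
  "lower_central G 0 = carrier G"
| "lower_central G (Suc i) = commutator_subgroup G (lower_central G i) (carrier G)"

definition nilpotent :: "('a, 'b) monoid_scheme \<Rightarrow> bool" where
  "nilpotent G \<longleftrightarrow> (\<exists>c. lower_central G c = {\<one>\<^bsub>G\<^esub>})"

subsection \<open>Complex representations and characters\<close>

abbreviation GL :: "nat \<Rightarrow> complex mat monoid" where
  "GL n \<equiv> units_of (ring_mat TYPE(complex) n ())"

abbreviation representation ::
    "('a, 'b) monoid_scheme \<Rightarrow> nat \<Rightarrow> ('a \<Rightarrow> complex mat) \<Rightarrow> bool" where
  "representation G n \<rho> \<equiv> \<rho> \<in> hom G (GL n)"

text \<open>Degree zero is excluded, as the zero module is not irreducible.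
  The constant \<^term>\<open>subspace\<close> is the carrier-based one of theory \<open>VectorSpace\<close>.\<close>

definition irreducible_representation ::
    "('a, 'b) monoid_scheme \<Rightarrow> nat \<Rightarrow> ('a \<Rightarrow> complex mat) \<Rightarrow> bool" where
  "irreducible_representation G n \<rho> \<longleftrightarrow>
     representation G n \<rho> \<and> n \<noteq> 0 \<and>
     (\<forall>W. subspace class_ring W (module_vec TYPE(complex) n) \<longrightarrow>
          (\<forall>g \<in> carrier G. \<forall>w \<in> W. \<rho> g *\<^sub>v w \<in> W) \<longrightarrow>
          W = {0\<^sub>v n} \<or> W = carrier_vec n)"

definition mat_trace :: "complex mat \<Rightarrow> complex" where
  "mat_trace A = sum_list (diag_mat A)"

text \<open>Class functions are extensional, i.e. \<open>undefined\<close> off the carrier, so that characters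
  agreeing on the group are equal.\<close>

definition character_of ::
    "('a, 'b) monoid_scheme \<Rightarrow> ('a \<Rightarrow> complex mat) \<Rightarrow> 'a \<Rightarrow> complex" where
  "character_of G \<rho> = (\<lambda>g \<in> carrier G. mat_trace (\<rho> g))"

definition Irr :: "('a, 'b) monoid_scheme \<Rightarrow> ('a \<Rightarrow> complex) set" where
  "Irr G = {character_of G \<rho> | \<rho> n. irreducible_representation G n \<rho>}"

definition principal_character :: "('a, 'b) monoid_scheme \<Rightarrow> 'a \<Rightarrow> complex" where
  "principal_character G = (\<lambda>g \<in> carrier G. 1)"

definition char_inner ::
    "('a, 'b) monoid_scheme \<Rightarrow> ('a \<Rightarrow> complex) \<Rightarrow> ('a \<Rightarrow> complex) \<Rightarrow> complex" where
  "char_inner G \<phi> \<psi> = (\<Sum>g \<in> carrier G. \<phi> g * cnj (\<psi> g)) / of_nat (Coset.order G)"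

definition induced ::
    "('a, 'b) monoid_scheme \<Rightarrow> 'a set \<Rightarrow> ('a \<Rightarrow> complex) \<Rightarrow> 'a \<Rightarrow> complex" where
  "induced G H \<phi> = (\<lambda>g \<in> carrier G.
     (\<Sum>x \<in> carrier G.
        if x \<otimes>\<^bsub>G\<^esub> g \<otimes>\<^bsub>G\<^esub> (inv\<^bsub>G\<^esub> x) \<in> H
        then \<phi> (x \<otimes>\<^bsub>G\<^esub> g \<otimes>\<^bsub>G\<^esub> (inv\<^bsub>G\<^esub> x)) else 0) / of_nat (card H))"

definition Irr_P :: "('a, 'b) monoid_scheme \<Rightarrow> ('a \<Rightarrow> complex) set" where
  "Irr_P G = {\<chi> \<in> Irr G. \<exists>M. maximal_subgroup M G \<and>
     char_inner G \<chi> (induced G M (principal_character (G\<lparr>carrier := M\<rparr>))) \<noteq> 0}"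

definition char_ker :: "('a, 'b) monoid_scheme \<Rightarrow> ('a \<Rightarrow> complex) \<Rightarrow> 'a set" where
  "char_ker G \<chi> = {g \<in> carrier G. \<chi> g = \<chi> \<one>\<^bsub>G\<^esub>}"

text \<open>The degree as a natural number; it satisfies its specification on
  \<open>Irr G\<close> by the lemma \<open>of_nat_char_degree\<close> below.\<close>

definition char_degree :: "('a, 'b) monoid_scheme \<Rightarrow> ('a \<Rightarrow> complex) \<Rightarrow> nat" where
  "char_degree G \<chi> = (THE d. \<chi> \<one>\<^bsub>G\<^esub> = of_nat d)"

lemma group_GL: "group (GL n)"
proof -
  interpret ring "ring_mat TYPE(complex) n ()" by (rule ring_mat)
  show ?thesis by (rule units_group)
qed

lemma character_of_one:
  assumes "group G" "representation G n \<rho>"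
  shows "character_of G \<rho> \<one>\<^bsub>G\<^esub> = of_nat n"
proof -
  have "\<rho> \<one>\<^bsub>G\<^esub> = 1\<^sub>m n"
    using hom_one[OF assms(2,1) group_GL] by (simp only: units_of_one) (simp add: ring_mat_def)
  moreover have "mat_trace (1\<^sub>m n :: complex mat) = of_nat n"
    by (simp add: mat_trace_def diag_mat_def interv_sum_list_conv_sum_set_nat)
  ultimately show ?thesis
    using monoid.one_closed[OF group.is_monoid[OF assms(1)]] by (simp add: character_of_def)
qed

lemma of_nat_char_degree:
  assumes "group G" "\<chi> \<in> Irr G"
  shows "of_nat (char_degree G \<chi>) = \<chi> \<one>\<^bsub>G\<^esub>"
proof -
  obtain n where "\<chi> \<one>\<^bsub>G\<^esub> = of_nat n"
    using assms(2) character_of_one[OF assms(1)]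
    by (auto simp only: Irr_def irreducible_representation_def mem_Collect_eq)
  then show ?thesis
    by (simp add: char_degree_def)
qed

end

theory Submission
  imports Defs "HOL-Number_Theory.Cong" "HOL-Algebra.Sylow" "HOL-Algebra.Multiplicative_Group"
    "HOL-Library.Function_Algebras" "Jordan_Normal_Form.Spectral_Radius"
begin

text \<open>If \<open>G\<close> is nilpotent, every maximal subgroup \<open>M\<close> is normal of prime index, so a constituent of
  \<open>(1\<^sub>M)\<^sup>G\<close> has \<open>M\<close> in its kernel and is linear.

  Conversely, factor out a normal subgroup that is maximal subject to the quotient not being nilpotent.
  The quotient is a semidirect product of a minimal normal subgroup \<open>V\<close> of prime exponent \<open>p\<close> and a
  maximal subgroup \<open>M\<close>, the normalizer of a Sylow \<open>q\<close>-subgroup \<open>Q\<close> with \<open>q \<noteq> p\<close>. Each linear character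
  \<open>\<mu>\<close> of \<open>V\<close> yields a constituent of \<open>(1\<^sub>M)\<^sup>G\<close> of degree \<open>|M : M\<^sub>\<mu>|\<close>, and the hypothesis would force
  \<open>|Q : Q\<^sub>\<mu>|\<^sup>2\<close> to divide \<open>|Q|\<close> for all \<open>\<mu>\<close>. But a \<open>q\<close>-group acting faithfully and coprimely on an
  abelian group \<open>U\<close> always has some \<open>u \<in> U\<close> with \<open>q |Q\<^sub>u|\<^sup>2 \<le> |Q|\<close> (a weak form of a theorem of
  Isaacs). This is proved by induction on \<open>U\<close>: decompose \<open>U\<close> if possible; otherwise a
  central element of order \<open>q\<close> acts without fixed points, and either a self-centralizing cyclic normal
  subgroup bounds the stabilizers, or a noncyclic normal subgroup of order \<open>q\<^sup>2\<close> makes the action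
  imprimitive.\<close>

section \<open>Actions and fixed points\<close>

text \<open>The factor q in the orbit bound is what makes the numbers clash. Write |Q| = q^a and let
  q^s be the q-part of |M_\<mu>|. Sylow conjugacy gives q^s <= |Q_\<mu>|, so 2s < a. The degree n =
  |M : M_\<mu>| is divisible by q^(a-s), hence n^2 by q^(a+1), which does not divide the group
  order. The bound |Q_\<mu>|^2 <= |Q| alone would leave n^2 and |Q| balanced. Between powers of q, a
  strict inequality already yields the factor q.

  The induction behind the bound meets subgroups that act with a kernel, even if the initial action
  is faithful. So the bound is stated relative to the kernel, and the kernel on one factor of U is
  what acts on the other factor: the two estimates multiply and kernel orders cancel.

  The index of ker \<chi> enters only through divisibility: it divides the order of the chosen
  quotient group, so it suffices that n^2 does not divide that order. Membership in
  \<open>Irr_P\<close> needs no computation of the induced character: by reciprocity it is enough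
  that the traces on M are natural numbers, positive at the identity.\<close>

lemma card_eq_mult_fibers:
  assumes "finite A" and "\<And>y. y \<in> f ` A \<Longrightarrow> card {x \<in> A. f x = y} = k"
  shows "card A = card (f ` A) * k"
proof -
  have "card A = (\<Sum>y \<in> f ` A. card {x \<in> A. f x = y})"
    using sum.image_gen[OF assms(1), of "\<lambda>_. 1::nat" f] by simp
  also have "\<dots> = (\<Sum>y \<in> f ` A. k)" using assms(2) by (intro sum.cong) auto
  finally show ?thesis by simp
qed

lemma card_le_mult_fibers:
  assumes "finite A" and "\<And>y. y \<in> f ` A \<Longrightarrow> card {x \<in> A. f x = y} \<le> k"
  shows "card A \<le> card (f ` A) * k"
proof -
  have "card A = (\<Sum>y \<in> f ` A. card {x \<in> A. f x = y})"
    using sum.image_gen[OF assms(1), of "\<lambda>_. 1::nat" f] by simp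
  also have "\<dots> \<le> (\<Sum>y \<in> f ` A. k)" using assms(2) by (intro sum_mono) auto
  finally show ?thesis by simp
qed

text \<open>One map \<phi> on the whole types serves all subgroups R and all invariant sets X, so
  that restricting an action leaves \<phi> unchanged.\<close>

definition acts :: "('a, 'b) monoid_scheme \<Rightarrow> 'a set \<Rightarrow> ('a \<Rightarrow> 'x \<Rightarrow> 'x) \<Rightarrow> 'x set \<Rightarrow> bool" where
  "acts G R \<phi> X \<longleftrightarrow> subgroup R G \<and>
     (\<forall>x \<in> X. \<phi> \<one>\<^bsub>G\<^esub> x = x \<and> (\<forall>g \<in> R. \<phi> g x \<in> X \<and> (\<forall>h \<in> R. \<phi> (g \<otimes>\<^bsub>G\<^esub> h) x = \<phi> g (\<phi> h x))))"

definition stab :: "'a set \<Rightarrow> ('a \<Rightarrow> 'x \<Rightarrow> 'x) \<Rightarrow> 'x \<Rightarrow> 'a set" where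
  "stab R \<phi> x = {g \<in> R. \<phi> g x = x}"

definition fixed_points :: "'a set \<Rightarrow> ('a \<Rightarrow> 'x \<Rightarrow> 'x) \<Rightarrow> 'x set \<Rightarrow> 'x set" where
  "fixed_points R \<phi> X = {x \<in> X. \<forall>g \<in> R. \<phi> g x = x}"

context group
begin

lemma subgroup_finite: "finite (carrier G) \<Longrightarrow> subgroup H G \<Longrightarrow> finite H"
  using finite_subset subgroup.subset by blast

lemma card_subgroup_dvd:
  assumes "finite (carrier G)" "subgroup H G" "subgroup K G" "H \<subseteq> K"
  shows "card H dvd card K"
proof -
  interpret K: group "G\<lparr>carrier := K\<rparr>" using assms(3) by (rule subgroup_imp_group)
  have "subgroup H (G\<lparr>carrier := K\<rparr>)" using assms subgroup_incl by blast
  from K.lagrange[OF this] have "card K = card H * card (rcosets\<^bsub>G\<lparr>carrier := K\<rparr>\<^esub> H)"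
    by (simp add: Coset.order_def mult.commute)
  then show ?thesis by (rule dvdI)
qed

lemma actsD:
  assumes "acts G R \<phi> X"
  shows "subgroup R G" "\<And>x. x \<in> X \<Longrightarrow> \<phi> \<one> x = x" "\<And>g x. g \<in> R \<Longrightarrow> x \<in> X \<Longrightarrow> \<phi> g x \<in> X"
    "\<And>g h x. g \<in> R \<Longrightarrow> h \<in> R \<Longrightarrow> x \<in> X \<Longrightarrow> \<phi> (g \<otimes> h) x = \<phi> g (\<phi> h x)"
  using assms unfolding acts_def by blast+

lemma acts_inv:
  assumes "acts G R \<phi> X" "g \<in> R" "x \<in> X"
  shows "\<phi> (inv g) (\<phi> g x) = x" "\<phi> g (\<phi> (inv g) x) = x"
proof -
  note a = actsD[OF assms(1)]
  have g: "inv g \<in> R" "g \<in> carrier G"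
    using assms(2) a(1) subgroup.m_inv_closed subgroup.mem_carrier by metis+
  show "\<phi> (inv g) (\<phi> g x) = x" using a(4)[OF g(1) assms(2,3)] a(2)[OF assms(3)] g by simp
  show "\<phi> g (\<phi> (inv g) x) = x" using a(4)[OF assms(2) g(1) assms(3)] a(2)[OF assms(3)] g by simp
qed

lemma acts_subgroup: "acts G R \<phi> X \<Longrightarrow> subgroup N G \<Longrightarrow> N \<subseteq> R \<Longrightarrow> acts G N \<phi> X"
  unfolding acts_def by blast

lemma subgroup_stab:
  assumes "acts G R \<phi> X" "x \<in> X" shows "subgroup (stab R \<phi> x) G"
proof -
  note a = actsD[OF assms(1)]
  show ?thesis
  proof (rule subgroupI)
    show "stab R \<phi> x \<subseteq> carrier G" using subgroup.subset[OF a(1)] by (auto simp: stab_def)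
    show "stab R \<phi> x \<noteq> {}" using subgroup.one_closed[OF a(1)] a(2)[OF assms(2)] by (auto simp: stab_def)
    fix g assume g: "g \<in> stab R \<phi> x"
    then show "inv g \<in> stab R \<phi> x"
      using acts_inv(1)[OF assms(1) _ assms(2), of g] subgroup.m_inv_closed[OF a(1)] by (auto simp: stab_def)
    fix h assume "h \<in> stab R \<phi> x"
    then show "g \<otimes> h \<in> stab R \<phi> x"
      using g a(4)[OF _ _ assms(2), of g h] subgroup.m_closed[OF a(1)] by (auto simp: stab_def)
  qed
qed

lemma orbit_stab:
  assumes "acts G R \<phi> X" "x \<in> X" "finite R"
  shows "card R = card ((\<lambda>g. \<phi> g x) ` R) * card (stab R \<phi> x)"
proof (rule card_eq_mult_fibers[OF assms(3)])
  note a = actsD[OF assms(1)]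
  fix y assume "y \<in> (\<lambda>g. \<phi> g x) ` R"
  then obtain g where g: "g \<in> R" "y = \<phi> g x" by auto
  have gc: "g \<in> carrier G" "inv g \<in> R" using subgroup.mem_carrier[OF a(1)] subgroup.m_inv_closed[OF a(1)] g by auto
  have "{h \<in> R. \<phi> h x = y} = (\<lambda>h. g \<otimes> h) ` stab R \<phi> x"
  proof safe
    fix h assume h: "h \<in> R" "y = \<phi> h x"
    have "inv g \<otimes> h \<in> stab R \<phi> x"
      using h g gc a(4)[OF gc(2) h(1) assms(2)] acts_inv(1)[OF assms(1) g(1) assms(2)] subgroup.m_closed[OF a(1)]
      by (auto simp: stab_def)
    moreover have "h = g \<otimes> (inv g \<otimes> h)"
      using h gc subgroup.mem_carrier[OF a(1)] by (simp add: m_assoc[symmetric])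
    ultimately show "h \<in> (\<lambda>h. g \<otimes> h) ` stab R \<phi> x" by blast
  next
    fix h assume h: "h \<in> stab R \<phi> x"
    then show "g \<otimes> h \<in> R" "\<phi> (g \<otimes> h) x = y"
      using g a(4)[OF g(1) _ assms(2)] subgroup.m_closed[OF a(1)] by (auto simp: stab_def)
  qed
  moreover have "inj_on (\<lambda>h. g \<otimes> h) (stab R \<phi> x)"
    using gc subgroup.mem_carrier[OF a(1)] by (auto simp: inj_on_def stab_def)
  ultimately show "card {h \<in> R. \<phi> h x = y} = card (stab R \<phi> x)"
    by (simp add: card_image)
qed

text \<open>Orbits partition X, and those that are not singletons contribute 0 modulo q. The orbit
  hypothesis stands in for R being a q-group, because \<open>exists_sylow\<close> applies the lemma
  to the whole group.\<close>

lemma card_fixed_points_mod: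
  assumes "acts G R \<phi> X" "finite X"
    and orb: "\<And>x. x \<in> X \<Longrightarrow> (\<forall>g\<in>R. \<phi> g x = x) \<or> q dvd card ((\<lambda>g. \<phi> g x) ` R)"
  shows "card (fixed_points R \<phi> X) mod q = card X mod (q::nat)"
proof -
  note a = actsD[OF assms(1)]
  define r where "r = {(x, y). x \<in> X \<and> y \<in> (\<lambda>g. \<phi> g x) ` R}"
  define orbs where "orbs = (\<lambda>x. (\<lambda>g. \<phi> g x) ` R) ` X"
  have one: "\<one> \<in> R" using subgroup.one_closed[OF a(1)] .
  have self: "x \<in> (\<lambda>g. \<phi> g x) ` R" if "x \<in> X" for x
    using a(2)[OF that] one by force
  have same: "(\<lambda>g. \<phi> g y) ` R = (\<lambda>g. \<phi> g x) ` R" if x: "x \<in> X" and y: "y \<in> (\<lambda>g. \<phi> g x) ` R" for x y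
  proof -
    obtain h where h: "h \<in> R" "y = \<phi> h x" using y by auto
    have *: "(\<lambda>g. \<phi> g (\<phi> h x)) ` R \<subseteq> (\<lambda>g. \<phi> g x) ` R" if "h \<in> R" "x \<in> X" for h x
    proof safe
      fix g assume "g \<in> R"
      then have "\<phi> g (\<phi> h x) = \<phi> (g \<otimes> h) x" "g \<otimes> h \<in> R"
        using a(4)[of g h x] that subgroup.m_closed[OF a(1)] by auto
      then show "\<phi> g (\<phi> h x) \<in> (\<lambda>g. \<phi> g x) ` R" by blast
    qed
    have "(\<lambda>g. \<phi> g (\<phi> (inv h) y)) ` R \<subseteq> (\<lambda>g. \<phi> g y) ` R"
      using * h a(3) x subgroup.m_inv_closed[OF a(1)] by blast
    then show ?thesis using *[OF h(1) x] acts_inv(1)[OF assms(1) h(1) x] h(2) by auto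
  qed
  have disj: "A \<inter> B = {}" if "A \<in> orbs" "B \<in> orbs" "A \<noteq> B" for A B
    using that same unfolding orbs_def by blast
  have un: "\<Union> orbs = X"
    using self a(3) unfolding orbs_def by blast
  have fin: "finite orbs" using assms(2) by (simp add: orbs_def)
  have finA: "finite A" if "A \<in> orbs" for A
    using that un assms(2) by (meson Sup_upper finite_subset)
  have cX: "card X = (\<Sum>A\<in>orbs. card A)"
    using card_Union_disjoint[of orbs] disj finA un by (simp add: pairwise_def disjnt_def)
  define F where "F = (\<lambda>x. {x}) ` fixed_points R \<phi> X"
  have F: "F \<subseteq> orbs"
  proof
    fix A assume "A \<in> F"
    then obtain x where x: "x \<in> X" "\<forall>g\<in>R. \<phi> g x = x" "A = {x}" by (auto simp: F_def fixed_points_def)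
    then have "A = (\<lambda>g. \<phi> g x) ` R" using one by auto
    then show "A \<in> orbs" using x(1) by (auto simp: orbs_def)
  qed
  have cF: "(\<Sum>A\<in>F. card A) = card (fixed_points R \<phi> X)"
    unfolding F_def by (subst sum.reindex) auto
  have "q dvd (\<Sum>A\<in>orbs - F. card A)"
  proof (rule dvd_sum)
    fix A assume A: "A \<in> orbs - F"
    then obtain x where x: "x \<in> X" "A = (\<lambda>g. \<phi> g x) ` R" by (auto simp: orbs_def)
    have "\<not> (\<forall>g\<in>R. \<phi> g x = x)"
    proof
      assume "\<forall>g\<in>R. \<phi> g x = x"
      then have "A = {x}" "x \<in> fixed_points R \<phi> X" using x one by (auto simp: fixed_points_def)
      then show False using A by (auto simp: F_def)
    qed
    then show "q dvd card A" using orb x by blast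
  qed
  moreover have "card X = (\<Sum>A\<in>orbs - F. card A) + card (fixed_points R \<phi> X)"
    using cX cF sum.subset_diff[OF F fin, of card] by simp
  ultimately show ?thesis by (auto simp: mod_add_left_eq[symmetric])
qed

lemma prime_power_group_orbit:
  assumes "acts G R \<phi> X" "x \<in> X" "finite R" "prime q" "card R = q ^ k"
  shows "(\<forall>g\<in>R. \<phi> g x = x) \<or> (q::nat) dvd card ((\<lambda>g. \<phi> g x) ` R)"
proof -
  have "card ((\<lambda>g. \<phi> g x) ` R) dvd q ^ k"
    using orbit_stab[OF assms(1-3)] assms(5) by (metis dvd_triv_left)
  then obtain j where j: "card ((\<lambda>g. \<phi> g x) ` R) = q ^ j"
    using divides_primepow_nat[OF assms(4)] by blast
  show ?thesis
  proof (cases j)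
    case 0
    then obtain y where y: "(\<lambda>g. \<phi> g x) ` R = {y}" using j by (auto simp: card_1_singleton_iff)
    have "x = \<phi> \<one> x" using actsD(2)[OF assms(1)] assms(2) by simp
    then have "x \<in> {y}" unfolding y[symmetric] using subgroup.one_closed[OF actsD(1)[OF assms(1)]] by blast
    then show ?thesis using y by auto
  qed (use j in auto)
qed

lemma card_fixed_points_prime_power:
  assumes "acts G R \<phi> X" "finite X" "finite R" "prime q" "card R = q ^ k"
  shows "card (fixed_points R \<phi> X) mod q = card X mod q"
  using card_fixed_points_mod[OF assms(1,2)] prime_power_group_orbit[OF assms(1) _ assms(3-5)] by blast

text \<open>The product map from A x B to S has fibres no larger than A \<inter> B. In the orbit
  estimates this compares a stabilizer with its intersection with another subgroup.\<close>

lemma card_mult_le_Int: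
  assumes "finite S" "subgroup A G" "subgroup B G" "subgroup S G" "A \<subseteq> S" "B \<subseteq> S"
  shows "card A * card B \<le> card S * card (A \<inter> B)"
proof -
  have fin: "finite A" "finite B" using assms finite_subset by auto
  let ?f = "\<lambda>(a, b). a \<otimes> b"
  note car = subgroup.mem_carrier[OF assms(2)] subgroup.mem_carrier[OF assms(3)]
  have "card (A \<times> B) \<le> card (?f ` (A \<times> B)) * card (A \<inter> B)"
  proof (rule card_le_mult_fibers)
    show "finite (A \<times> B)" using fin by simp
    fix y assume "y \<in> ?f ` (A \<times> B)"
    then obtain a b where ab: "a \<in> A" "b \<in> B" "y = a \<otimes> b" by auto
    \<comment> \<open>If a b = a' b', then the inverse of a times a' equals b times the inverse of
      b'. This element lies in both subgroups and determines a', hence b'.\<close>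
    let ?g = "\<lambda>(a', b'). inv a \<otimes> a'"
    show "card {x \<in> A \<times> B. ?f x = y} \<le> card (A \<inter> B)"
    proof (rule card_inj_on_le)
      show "inj_on ?g {x \<in> A \<times> B. ?f x = y}"
      proof (rule inj_onI)
        fix s t assume st: "s \<in> {x \<in> A \<times> B. ?f x = y}" "t \<in> {x \<in> A \<times> B. ?f x = y}" "?g s = ?g t"
        obtain a1 b1 a2 b2 where e: "s = (a1, b1)" "t = (a2, b2)" by (cases s, cases t) auto
        have c: "a \<in> carrier G" "a1 \<in> carrier G" "a2 \<in> carrier G" "b1 \<in> carrier G" "b2 \<in> carrier G"
          using st e ab(1) car by auto
        have a: "a1 = a2" using st(3) c by (simp add: e)
        have "a1 \<otimes> b1 = a1 \<otimes> b2" using st(1,2) by (simp add: e a)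
        then show "s = t" using c by (simp add: e a)
      qed
      show "?g ` {x \<in> A \<times> B. ?f x = y} \<subseteq> A \<inter> B"
      proof (intro subsetI)
        fix w assume "w \<in> ?g ` {x \<in> A \<times> B. ?f x = y}"
        then obtain a' b' where h: "a' \<in> A" "b' \<in> B" "a' \<otimes> b' = y" and w: "w = inv a \<otimes> a'" by auto
        have c: "a \<in> carrier G" "b \<in> carrier G" "a' \<in> carrier G" "b' \<in> carrier G" using h ab car by auto
        have "inv a \<otimes> a' \<in> A"
          using h ab assms(2) by (simp add: subgroup.m_closed subgroup.m_inv_closed)
        moreover have "a' = a \<otimes> b \<otimes> inv b'"
          using inv_solve_right[of a' "a \<otimes> b" b'] h(3) ab(3) c by simp
        then have "inv a \<otimes> a' = inv a \<otimes> (a \<otimes> b \<otimes> inv b')" by simp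
        then have "inv a \<otimes> a' = b \<otimes> inv b'" using c by (simp add: m_assoc[symmetric])
        then have "inv a \<otimes> a' \<in> B"
          using h ab assms(3) by (simp add: subgroup.m_closed subgroup.m_inv_closed)
        ultimately show "w \<in> A \<inter> B" by (simp add: w)
      qed
      show "finite (A \<inter> B)" using fin by simp
    qed
  qed
  also have "\<dots> \<le> card S * card (A \<inter> B)"
    using assms by (intro mult_right_mono card_mono) (auto intro: subgroup.m_closed)
  finally show ?thesis by (simp add: card_cartesian_product)
qed

section \<open>Action on cosets and conjugacy of Sylow subgroups\<close>

lemma acts_left_cosets:
  assumes "subgroup R G" "subgroup T G" "subgroup H G" "R \<subseteq> H"
  shows "acts G R (l_coset G) ((\<lambda>h. l_coset G h T) ` H)"
proof -
  note car = subgroup.mem_carrier[OF assms(3)] subgroup.subset[OF assms(2)]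
  have eq: "l_coset G g (l_coset G h T) = l_coset G (g \<otimes> h) T" if "g \<in> carrier G" "h \<in> carrier G" for g h
    using that car by (simp add: lcos_m_assoc)
  show ?thesis
    unfolding acts_def
  proof (intro conjI ballI)
    fix C assume "C \<in> (\<lambda>h. l_coset G h T) ` H"
    then obtain h where h: "h \<in> H" "C = l_coset G h T" by auto
    then show "l_coset G \<one> C = C" using car eq by simp
    fix g assume g: "g \<in> R"
    then have gH: "g \<in> H" using assms by auto
    then show "l_coset G g C \<in> (\<lambda>h. l_coset G h T) ` H" using h eq car subgroup.m_closed[OF assms(3)] by auto
    fix g' assume "g' \<in> R"
    then have "g' \<in> H" using assms by auto
    then show "l_coset G (g \<otimes> g') C = l_coset G g (l_coset G g' C)" using gH h eq car by (simp add: m_assoc)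
  qed (rule assms)
qed

lemma card_left_cosets:
  assumes "finite H" "subgroup T G" "subgroup H G" "T \<subseteq> H"
  shows "card H = card ((\<lambda>h. l_coset G h T) ` H) * card T"
proof (rule card_eq_mult_fibers[OF assms(1)])
  note car = subgroup.mem_carrier[OF assms(3)] subgroup.subset[OF assms(2)]
  fix C assume "C \<in> (\<lambda>h. l_coset G h T) ` H"
  then obtain h where h: "h \<in> H" and C: "C = l_coset G h T" by auto
  have "{x \<in> H. l_coset G x T = l_coset G h T} = (\<lambda>t. h \<otimes> t) ` T" (is "?L = ?R")
  proof (intro equalityI subsetI)
    fix x assume "x \<in> ?L" then have x: "x \<in> H" "l_coset G x T = l_coset G h T" by auto
    have "x \<in> l_coset G x T" using x car subgroup.one_closed[OF assms(2)] unfolding l_coset_def by force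
    then have "x \<in> l_coset G h T" using x h by simp
    then show "x \<in> (\<lambda>t. h \<otimes> t) ` T" by (auto simp: l_coset_def)
  next
    fix y assume "y \<in> ?R"
    then obtain t where t: "t \<in> T" and y: "y = h \<otimes> t" by auto
    have "h \<otimes> t \<in> H" using t h assms by (auto intro: subgroup.m_closed)
    moreover have "h \<otimes> t \<in> l_coset G h T" using t by (auto simp: l_coset_def)
    from l_repr_independence[OF this _ assms(2)] have "l_coset G (h \<otimes> t) T = l_coset G h T"
      using car(1)[OF h] by simp
    ultimately show "y \<in> ?L" by (simp add: y)
  qed
  moreover have "inj_on (\<lambda>t. h \<otimes> t) T"
    using car(1)[OF h] car(2) by (auto simp: inj_on_def subset_iff)
  ultimately show "card {x \<in> H. l_coset G x T = C} = card T" by (simp add: C card_image)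
qed

text \<open>A fixed coset of \<open>R\<close> acting on the cosets of \<open>T\<close>; this contains the conjugacy of Sylow subgroups.\<close>

lemma prime_power_subgroup_conj:
  assumes "finite H" "subgroup R G" "subgroup T G" "subgroup H G" "R \<subseteq> H" "T \<subseteq> H"
    and "prime q" "card R = q ^ k" "\<not> q * card T dvd card H"
  shows "\<exists>g \<in> H. \<forall>r \<in> R. inv g \<otimes> r \<otimes> g \<in> T"
proof -
  let ?X = "(\<lambda>h. l_coset G h T) ` H"
  \<comment> \<open>The number of cosets is the index of T in H; the last hypothesis says, without
    division, that it is prime to q.\<close>
  have "\<not> q dvd card ?X"
    using card_left_cosets[OF assms(1,3,4,6)] assms(9) mult_dvd_mono[OF _ dvd_refl, of q "card ?X" "card T"] by auto
  moreover have "card (fixed_points R (l_coset G) ?X) mod q = card ?X mod q"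
    using assms finite_subset by (intro card_fixed_points_prime_power[of _ _ _ q k] acts_left_cosets) auto
  ultimately have "fixed_points R (l_coset G) ?X \<noteq> {}" by (auto simp: dvd_eq_mod_eq_0)
  then obtain g where g: "g \<in> H" "\<And>r. r \<in> R \<Longrightarrow> l_coset G r (l_coset G g T) = l_coset G g T"
    by (auto simp: fixed_points_def)
  note car = subgroup.mem_carrier[OF assms(4)] subgroup.mem_carrier[OF assms(3)]
  have "inv g \<otimes> r \<otimes> g \<in> T" if r: "r \<in> R" for r
  proof -
    have rc: "r \<in> carrier G" using r assms(5) car by auto
    have "g \<in> l_coset G g T" using g car subgroup.one_closed[OF assms(3)] unfolding l_coset_def by force
    then have "r \<otimes> g \<in> l_coset G g T" using g(2)[OF r] by (force simp: l_coset_def)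
    then obtain t where t: "t \<in> T" "r \<otimes> g = g \<otimes> t" by (auto simp: l_coset_def)
    then have "inv g \<otimes> (r \<otimes> g) = t" using car(1)[OF g(1)] car(2)[OF t(1)] by (simp add: m_assoc[symmetric])
    then have "inv g \<otimes> r \<otimes> g = t" using car(1)[OF g(1)] rc by (simp add: m_assoc)
    then show ?thesis using t by simp
  qed
  then show ?thesis using g(1) by blast
qed

end

section \<open>Structure of prime power groups\<close>

context group
begin

lemma conj_mult:
  assumes "g \<in> carrier G" "x \<in> carrier G" "y \<in> carrier G"
  shows "g \<otimes> (x \<otimes> y) \<otimes> inv g = (g \<otimes> x \<otimes> inv g) \<otimes> (g \<otimes> y \<otimes> inv g)"
proof -
  have "(g \<otimes> x \<otimes> inv g) \<otimes> (g \<otimes> y \<otimes> inv g) = g \<otimes> x \<otimes> (inv g \<otimes> g) \<otimes> y \<otimes> inv g"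
    using assms by (simp only: m_assoc m_closed inv_closed)
  then show ?thesis using assms by (simp add: m_assoc)
qed

lemma conj_pow:
  assumes "g \<in> carrier G" "x \<in> carrier G"
  shows "g \<otimes> (x [^] (n::nat)) \<otimes> inv g = (g \<otimes> x \<otimes> inv g) [^] n"
  by (induction n) (use assms conj_mult in \<open>auto simp: nat_pow_Suc\<close>)

lemma conj_conj:
  assumes "g \<in> carrier G" "h \<in> carrier G" "x \<in> carrier G"
  shows "(g \<otimes> h) \<otimes> x \<otimes> inv (g \<otimes> h) = g \<otimes> (h \<otimes> x \<otimes> inv h) \<otimes> inv g"
  using assms by (simp add: inv_mult_group m_assoc)

lemma conj_fix_iff:
  assumes "g \<in> carrier G" "x \<in> carrier G"
  shows "g \<otimes> x \<otimes> inv g = x \<longleftrightarrow> g \<otimes> x = x \<otimes> g"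
  using inv_solve_right[of x "g \<otimes> x" g] assms by auto

lemma commuting_pow:
  assumes "x \<in> carrier G" "y \<in> carrier G" "x \<otimes> y = y \<otimes> x"
  shows "x [^] (n::nat) \<otimes> y = y \<otimes> x [^] n"
proof (induction n)
  case (Suc n)
  have "x [^] n \<otimes> x \<otimes> y = x [^] n \<otimes> y \<otimes> x" using assms by (simp add: m_assoc)
  also have "\<dots> = y \<otimes> (x [^] n \<otimes> x)" using assms Suc by (simp add: m_assoc)
  finally show ?case by simp
qed (use assms in simp)

lemma ord_prime_power:
  assumes "finite (carrier G)" "prime q" "card (carrier G) = q ^ k" "x \<in> carrier G"
  obtains j where "ord x = q ^ j"
proof -
  have "ord x dvd q ^ k" using ord_dvd_group_order[OF assms(4)] assms(3) by (simp add: Coset.order_def)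
  then show ?thesis using that divides_primepow_nat[OF assms(2)] by blast
qed

lemma powers_subgroup:
  assumes "finite (carrier G)" "a \<in> carrier G"
  shows "generate G {a} = {a [^] k | k. k \<in> (UNIV :: nat set)}" "subgroup (generate G {a}) G"
    "card (generate G {a}) = ord a"
proof -
  show "generate G {a} = {a [^] k | k. k \<in> (UNIV :: nat set)}"
    using generate_pow_nat[OF assms(2)] ord_ge_1[OF assms] by simp
  show "subgroup (generate G {a}) G" using assms by (intro generate_is_subgroup) auto
  show "card (generate G {a}) = ord a" using generate_pow_card[OF assms(2)] by simp
qed

lemma powers_in_subgroup:
  assumes "subgroup H G" "x \<in> H" shows "x [^] (n::nat) \<in> H"
proof -
  have "x \<in> carrier G" using assms subgroup.mem_carrier by metis
  then show ?thesis
    by (induction n) (use assms in \<open>auto simp: subgroup.one_closed subgroup.m_closed\<close>)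
qed

lemma order_prime_element:
  assumes "finite (carrier G)" "x \<in> carrier G" "prime q" "ord x = q ^ Suc j"
  shows "x [^] (q ^ j) \<noteq> \<one>" "(x [^] (q ^ j)) [^] q = \<one>"
proof -
  have "\<not> q ^ Suc j dvd q ^ j" using assms(3) by (auto dest: dvd_imp_le simp: prime_gt_0_nat prime_gt_Suc_0_nat)
  then show "x [^] (q ^ j) \<noteq> \<one>" using pow_eq_id[OF assms(2)] assms(4) by auto
  show "(x [^] (q ^ j)) [^] q = \<one>"
    using pow_eq_id[OF assms(2)] assms(2,4) by (simp add: nat_pow_pow mult.commute)
qed

lemma ord_eq_prime:
  assumes "x \<in> carrier G" "x \<noteq> \<one>" "prime q" "x [^] q = \<one>" shows "ord x = q"
  using pow_eq_id[OF assms(1), of q] ord_eq_1[OF assms(1)] assms(2-4) by (metis prime_nat_iff)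

lemma card_subgroup_pos:
  assumes "finite (carrier G)" "subgroup H G" shows "card H > 0"
  using subgroup.one_closed[OF assms(2)] subgroup_finite[OF assms] card_gt_0_iff by blast

lemma conj_conj_inv:
  assumes "g \<in> carrier G" "x \<in> carrier G"
  shows "g \<otimes> (inv g \<otimes> x \<otimes> g) \<otimes> inv g = x" "inv g \<otimes> (g \<otimes> x \<otimes> inv g) \<otimes> g = x"
  using assms by (simp_all add: m_assoc) (simp_all add: m_assoc[symmetric])

text \<open>The element and its power have the same order, so the cyclic groups that they generate
  coincide.\<close>

lemma pow_coprime_surj:
  assumes "finite (carrier G)" "x \<in> carrier G" "coprime j (ord x)"
  shows "\<exists>l. x = (x [^] j) [^] (l::nat)"
proof -
  have xj: "x [^] j \<in> carrier G" using assms by simp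
  have sub: "generate G {x [^] j} \<subseteq> generate G {x}"
    using powers_in_subgroup[OF powers_subgroup(2)[OF assms(1,2)] generate.incl[of x "{x}"]]
    by (intro generate_subgroup_incl powers_subgroup(2) assms) auto
  have "card (generate G {x [^] j}) = card (generate G {x})"
    using pow_ord_eq_ord_iff[OF assms(1,2)] assms(3) powers_subgroup(3) assms(1,2) xj by simp
  then have "generate G {x [^] j} = generate G {x}"
    using sub subgroup_finite[OF assms(1) powers_subgroup(2)[OF assms(1,2)]] by (intro card_subset_eq)
  then have "x \<in> generate G {x [^] j}" using generate.incl[of x "{x}"] by simp
  then show ?thesis using powers_subgroup(1)[OF assms(1) xj] by auto
qed

text \<open>A cyclic q-group has a unique subgroup of order q, here generated by \<open>h\<close>,
  and every nontrivial subgroup contains it. Hence every \<open>b\<close> other than the identity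
  has all of that subgroup among its powers.\<close>

lemma cyclic_prime_power_socle:
  assumes "finite (carrier G)" "a \<in> carrier G" "prime q" "ord a = q ^ m"
    and "b \<in> generate G {a}" "b \<noteq> \<one>" "w \<in> generate G {a}" "w [^] q = \<one>"
  shows "\<exists>i::nat. w = b [^] i"
proof -
  have "a \<noteq> \<one>"
  proof
    assume "a = \<one>"
    then show False using assms(5,6) powers_subgroup(1)[OF assms(1,2)] by auto
  qed
  then have "m \<noteq> 0" using assms(2,4) ord_eq_1 by (cases m) auto
  then obtain m' where m: "m = Suc m'" by (cases m) auto
  define h where "h = a [^] (q ^ m')"
  have hc: "h \<in> carrier G" using assms(2) by (simp add: h_def)
  have h: "h [^] q = \<one>" "h \<noteq> \<one>"
    using order_prime_element[OF assms(1,2,3)] assms(4) m by (auto simp: h_def)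
  have ordh: "ord h = q" by (rule ord_eq_prime[OF hc h(2) assms(3) h(1)])
  have key: "\<exists>t::nat. v = h [^] t" if v: "v \<in> generate G {a}" "v [^] q = \<one>" for v
  proof -
    obtain t :: nat where t: "v = a [^] t" using v(1) powers_subgroup(1)[OF assms(1,2)] by auto
    have "a [^] (t * q) = \<one>" using v(2) assms(2) t by (simp add: nat_pow_pow)
    then have "q ^ Suc m' dvd t * q" using pow_eq_id[OF assms(2)] assms(4) m by simp
    then have "q ^ m' dvd t" using prime_gt_0_nat[OF assms(3)] by simp
    then obtain t' where "t = q ^ m' * t'" by (elim dvdE)
    then show ?thesis using assms(2) t by (intro exI[of _ t']) (simp add: h_def nat_pow_pow)
  qed
  have bc: "b \<in> carrier G" using assms(2,5) powers_subgroup(1)[OF assms(1,2)] by auto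
  obtain s :: nat where s: "b = a [^] s" using assms(5) powers_subgroup(1)[OF assms(1,2)] by auto
  obtain j where j: "ord b = q ^ Suc j"
  proof -
    have "b [^] (q ^ m) = (a [^] (q ^ m)) [^] s" using assms(2) by (simp add: s nat_pow_pow mult.commute)
    also have "\<dots> = \<one>" using assms(2) pow_eq_id[OF assms(2), of "q ^ m"] assms(4) by simp
    finally have "ord b dvd q ^ m" using pow_eq_id[OF bc] by simp
    then obtain i where i: "ord b = q ^ i" using divides_primepow_nat[OF assms(3)] by blast
    have "i \<noteq> 0" using i assms(6) ord_eq_1[OF bc] by (cases i) auto
    then show thesis using that i by (cases i) auto
  qed
  \<comment> \<open>The last nontrivial power of \<open>b\<close> in the chain of q-th powers has
    order q. It is a power of \<open>h\<close> with exponent prime to q, so conversely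
    \<open>h\<close> is a power of it.\<close>
  have b': "b [^] (q ^ j) \<noteq> \<one>" "(b [^] (q ^ j)) [^] q = \<one>"
    using order_prime_element[OF assms(1) bc assms(3) j] by auto
  have "b [^] (q ^ j) \<in> generate G {a}" using powers_in_subgroup[OF powers_subgroup(2)[OF assms(1,2)] assms(5)] .
  then obtain s' :: nat where s': "b [^] (q ^ j) = h [^] s'" using key b'(2) by blast
  have "\<not> q dvd s'" using b'(1) s' pow_eq_id[OF hc] ordh by auto
  then have "coprime s' (ord h)" using assms(3) ordh by (simp add: coprime_commute prime_imp_coprime)
  then obtain l :: nat where l: "h = (h [^] s') [^] l" using pow_coprime_surj[OF assms(1) hc] by blast
  obtain t :: nat where t: "w = h [^] t" using key assms(7,8) by blast
  have "w = ((b [^] (q ^ j)) [^] l) [^] t" using l t s' by simp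
  also have "\<dots> = b [^] (q ^ j * l * t)" using bc by (simp add: nat_pow_pow)
  finally show ?thesis by blast
qed

text \<open>The q-group acts by conjugation on the cosets of A in C. Their number is a power of q
  greater than 1 and the coset A is fixed, so another coset is fixed too. This is a nontrivial
  central element of G/A inside C/A, obtained without forming the quotient.\<close>

lemma exists_central_mod:
  assumes "finite (carrier G)" "prime q" "card (carrier G) = q ^ k"
    and "subgroup A G" "subgroup C G" "A \<subset> C"
    and nA: "\<And>g x. g \<in> carrier G \<Longrightarrow> x \<in> A \<Longrightarrow> g \<otimes> x \<otimes> inv g \<in> A"
    and nC: "\<And>g x. g \<in> carrier G \<Longrightarrow> x \<in> C \<Longrightarrow> g \<otimes> x \<otimes> inv g \<in> C"
  obtains y where "y \<in> C - A" "\<And>g. g \<in> carrier G \<Longrightarrow> \<exists>c \<in> A. g \<otimes> y \<otimes> inv g = c \<otimes> y"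
proof -
  note carC = subgroup.mem_carrier[OF assms(5)] and carA = subgroup.mem_carrier[OF assms(4)]
  let ?X = "(\<lambda>h. l_coset G h A) ` C"
  let ?\<phi> = "\<lambda>g Y. (\<lambda>x. g \<otimes> x \<otimes> inv g) ` Y"
  have conj: "?\<phi> g (l_coset G y A) = l_coset G (g \<otimes> y \<otimes> inv g) A" if g: "g \<in> carrier G" and y: "y \<in> carrier G" for g y
  proof (intro equalityI subsetI)
    fix w assume "w \<in> ?\<phi> g (l_coset G y A)"
    then obtain c where c: "c \<in> A" "w = g \<otimes> (y \<otimes> c) \<otimes> inv g" by (auto simp: l_coset_def)
    then have "w = (g \<otimes> y \<otimes> inv g) \<otimes> (g \<otimes> c \<otimes> inv g)" using g y carA conj_mult by simp
    then show "w \<in> l_coset G (g \<otimes> y \<otimes> inv g) A" using nA[OF g c(1)] by (auto simp: l_coset_def)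
  next
    fix w assume "w \<in> l_coset G (g \<otimes> y \<otimes> inv g) A"
    then obtain c where c: "c \<in> A" "w = (g \<otimes> y \<otimes> inv g) \<otimes> c" by (auto simp: l_coset_def)
    have cc: "c \<in> carrier G" using carA c by auto
    have d: "inv g \<otimes> c \<otimes> g \<in> A" using nA[of "inv g" c] g c by simp
    have "w = g \<otimes> (y \<otimes> (inv g \<otimes> c \<otimes> g)) \<otimes> inv g"
      using c(2) cc g y by (simp add: m_assoc)
    then show "w \<in> ?\<phi> g (l_coset G y A)" using d by (auto simp: l_coset_def)
  qed
  have acts: "acts G (carrier G) ?\<phi> ?X"
    unfolding acts_def
  proof (intro conjI ballI)
    show "subgroup (carrier G) G" by (rule subgroup_self)
    fix Y assume "Y \<in> ?X"
    then obtain y where y: "y \<in> C" "Y = l_coset G y A" by auto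
    have yc: "y \<in> carrier G" using carC y by auto
    show "?\<phi> \<one> Y = Y" using conj[OF one_closed yc] y(2) yc by simp
    fix g assume g: "g \<in> carrier G"
    show "?\<phi> g Y \<in> ?X" using conj[OF g yc] nC[OF g y(1)] y(2) by auto
    fix h assume h: "h \<in> carrier G"
    have hc: "h \<otimes> y \<otimes> inv h \<in> carrier G" using h yc by simp
    show "?\<phi> (g \<otimes> h) Y = ?\<phi> g (?\<phi> h Y)"
      using conj[OF m_closed[OF g h] yc] conj[OF h yc] conj[OF g hc] conj_conj[OF g h yc] by (simp only: y(2))
  qed
  have finC: "finite C" using subgroup_finite[OF assms(1,5)] .
  have cX: "card C = card ?X * card A" using card_left_cosets[OF finC assms(4,5)] assms(6) by auto
  have "card C dvd q ^ k" using card_subgroup_dvd[OF assms(1,5) subgroup_self] assms(3) subgroup.subset[OF assms(5)] by simp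
  moreover have "card ?X dvd card C" by (simp add: cX)
  ultimately have "card ?X dvd q ^ k" by (rule dvd_trans[rotated])
  then obtain j where j: "card ?X = q ^ j" using divides_primepow_nat[OF assms(2)] by blast
  have "card A < card C" using assms(6) finC by (rule psubset_card_mono[rotated])
  then have "j \<noteq> 0" using cX j by (cases j) auto
  then have q: "q dvd card ?X" using j by simp
  have "card (fixed_points (carrier G) ?\<phi> ?X) mod q = card ?X mod q"
    using card_fixed_points_prime_power[OF acts _ assms(1-3)] finC by simp
  then have qf: "q dvd card (fixed_points (carrier G) ?\<phi> ?X)" using q by (simp add: dvd_eq_mod_eq_0)
  have Aeq: "l_coset G \<one> A = A" using subgroup.subset[OF assms(4)] by (rule lcos_mult_one)
  have "A \<in> fixed_points (carrier G) ?\<phi> ?X"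
  proof -
    have "A \<in> ?X" using Aeq subgroup.one_closed[OF assms(5)] by blast
    moreover have "?\<phi> g A = A" if "g \<in> carrier G" for g
      using conj[OF that one_closed] that by (simp add: Aeq)
    ultimately show ?thesis by (simp add: fixed_points_def)
  qed
  moreover have "fixed_points (carrier G) ?\<phi> ?X \<noteq> {A}" using qf assms(2) by (metis One_nat_def card.empty card_insert_disjoint empty_iff finite.emptyI nat_dvd_1_iff_1 not_prime_1)
  ultimately obtain Y where Y: "Y \<in> fixed_points (carrier G) ?\<phi> ?X" "Y \<noteq> A" by blast
  then obtain y where y: "y \<in> C" "Y = l_coset G y A" by (auto simp: fixed_points_def)
  have yc: "y \<in> carrier G" using carC y by auto
  show thesis
  proof
    have "y \<notin> A"
    proof
      assume "y \<in> A"
      then have "l_coset G y A = A" using l_repr_independence[of y \<one> A] Aeq assms(4) by simp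
      then show False using Y y by simp
    qed
    then show "y \<in> C - A" using y by simp
    fix g assume g: "g \<in> carrier G"
    have "l_coset G (g \<otimes> y \<otimes> inv g) A = l_coset G y A"
      using Y(1) y(2) conj[OF g yc] g by (simp add: fixed_points_def)
    moreover have "g \<otimes> y \<otimes> inv g \<in> l_coset G (g \<otimes> y \<otimes> inv g) A"
      using subgroup.one_closed[OF assms(4)] g yc unfolding l_coset_def by force
    ultimately obtain c where c: "c \<in> A" "g \<otimes> y \<otimes> inv g = y \<otimes> c" by (auto simp: l_coset_def)
    \<comment> \<open>A fixed coset yields the factor from A on the right; normality of A moves it
      to the left.\<close>
    have "y \<otimes> c = (y \<otimes> c \<otimes> inv y) \<otimes> y" using yc carA[OF c(1)] by (simp add: m_assoc)
    then show "\<exists>c \<in> A. g \<otimes> y \<otimes> inv g = c \<otimes> y" using nA[OF yc c(1)] c(2) by metis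
  qed
qed

text \<open>In case \<open>cyclic\<close>, \<open>A = \<langle>a\<rangle>\<close> is a self-centralizing cyclic normal subgroup; in case \<open>noncyclic\<close>,
  \<open>\<langle>x, z\<rangle>\<close> is a noncyclic normal subgroup of order \<open>q\<^sup>2\<close>. To see that one of them occurs, take \<open>A\<close>
  cyclic normal of largest order and extend it inside its centralizer.\<close>

lemma prime_power_group_cases:
  assumes "finite (carrier G)" "prime q" "card (carrier G) = q ^ k" "carrier G \<noteq> {\<one>}"
  obtains (cyclic) z A a where
      "z \<in> carrier G" "z \<noteq> \<one>" "z [^] q = \<one>" "\<And>g. g \<in> carrier G \<Longrightarrow> g \<otimes> z = z \<otimes> g"
      "subgroup A G" "a \<in> A" "\<And>g. g \<in> carrier G \<Longrightarrow> g \<otimes> a \<otimes> inv g \<in> A"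
      "\<And>g. g \<in> carrier G \<Longrightarrow> g \<otimes> a = a \<otimes> g \<Longrightarrow> g \<in> A"
      "a \<noteq> \<one>" "\<And>b. b \<in> A \<Longrightarrow> b \<noteq> \<one> \<Longrightarrow> \<exists>i::nat. z = b [^] i"
    | (noncyclic) z x where
      "z \<in> carrier G" "z \<noteq> \<one>" "z [^] q = \<one>" "\<And>g. g \<in> carrier G \<Longrightarrow> g \<otimes> z = z \<otimes> g"
      "x \<in> carrier G" "x [^] q = \<one>" "\<And>i::nat. x \<noteq> z [^] i"
      "\<And>g. g \<in> carrier G \<Longrightarrow> \<exists>i::nat. g \<otimes> x \<otimes> inv g = z [^] i \<otimes> x"
proof -
  \<comment> \<open>\<open>P a\<close> says that the cyclic group generated by \<open>a\<close> is
    normal; testing the generator is enough.\<close>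
  define P where "P = (\<lambda>a. a \<in> carrier G \<and> (\<forall>g \<in> carrier G. g \<otimes> a \<otimes> inv g \<in> generate G {a}))"
  have one_normal: "g \<otimes> x \<otimes> inv g \<in> {\<one>}" if "g \<in> carrier G" "x \<in> {\<one>}" for g x using that by simp
  have triv: "subgroup {\<one>} G" by (rule triv_subgroup)
  \<comment> \<open>A nontrivial central element satisfies \<open>P\<close>, so the maximal choice
    of \<open>a\<close> below is not the identity.\<close>
  obtain y0 where y0: "y0 \<in> carrier G - {\<one>}" "\<And>g. g \<in> carrier G \<Longrightarrow> \<exists>c \<in> {\<one>}. g \<otimes> y0 \<otimes> inv g = c \<otimes> y0"
    by (rule exists_central_mod[OF assms(1-3) triv subgroup_self]) (use assms(4) in auto)
  have "P y0" using y0 generate.incl[of y0 "{y0}"] by (auto simp: P_def)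
  then obtain a where a: "P a" "\<And>b. P b \<Longrightarrow> ord b \<le> ord a"
    using ex_has_greatest_nat[of P y0 ord "Suc (card (carrier G))"]
      ord_le_group_order[OF assms(1)] unfolding P_def Coset.order_def by (metis le_imp_less_Suc)
  have ac: "a \<in> carrier G" using a(1) by (simp add: P_def)
  let ?A = "generate G {a}"
  note A = powers_subgroup[OF assms(1) ac]
  have aA: "a \<in> ?A" by (rule generate.incl) simp
  note carA = subgroup.mem_carrier[OF A(2)]
  obtain m where m: "ord a = q ^ m" using ord_prime_power[OF assms(1-3) ac] .
  have "ord y0 \<noteq> 1" using y0(1) ord_eq_1 by auto
  moreover have "ord y0 \<ge> 1" using y0(1) ord_ge_1[OF assms(1)] by auto
  ultimately have "ord a > 1" using a(2)[OF \<open>P y0\<close>] by simp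
  then have a1: "a \<noteq> \<one>" using ord_eq_1[OF ac] by auto
  have nA: "g \<otimes> x \<otimes> inv g \<in> ?A" if g: "g \<in> carrier G" and x: "x \<in> ?A" for g x
  proof -
    obtain i :: nat where i: "x = a [^] i" using x A(1) by auto
    have "g \<otimes> a \<otimes> inv g \<in> ?A" using a(1) g by (simp add: P_def)
    then show ?thesis using conj_pow[OF g ac] powers_in_subgroup[OF A(2)] i by simp
  qed
  have commA: "x \<otimes> y = y \<otimes> x" if "x \<in> ?A" "y \<in> carrier G" "a \<otimes> y = y \<otimes> a" for x y
    using that A(1) commuting_pow[OF ac] by auto
  have "{\<one>} \<subset> ?A" using aA a1 subgroup.one_closed[OF A(2)] by auto
  then obtain y where y: "y \<in> ?A - {\<one>}" "\<And>g. g \<in> carrier G \<Longrightarrow> \<exists>c \<in> {\<one>}. g \<otimes> y \<otimes> inv g = c \<otimes> y"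
    using exists_central_mod[OF assms(1-3) triv A(2) _ one_normal nA] by blast
  have yc: "y \<in> carrier G" using y carA by auto
  obtain j0 where j0: "ord y = q ^ j0" using ord_prime_power[OF assms(1-3) yc] .
  have "j0 \<noteq> 0" using y(1) ord_eq_1[OF yc] j0 by (cases j0) auto
  then obtain j where j: "ord y = q ^ Suc j" using j0 by (cases j0) auto
  \<comment> \<open>\<open>y\<close> is central and lies in the cyclic group \<open>?A\<close>, so
    its power of order q is central as well and generates the subgroup of order q of
    \<open>?A\<close>.\<close>
  define z where "z = y [^] (q ^ j)"
  have z: "z \<in> carrier G" "z \<noteq> \<one>" "z [^] q = \<one>"
    using order_prime_element[OF assms(1) yc assms(2) j] yc by (auto simp: z_def)
  have zA: "z \<in> ?A" using powers_in_subgroup[OF A(2)] y(1) by (auto simp: z_def)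
  have zcent: "g \<otimes> z = z \<otimes> g" if g: "g \<in> carrier G" for g
  proof -
    have "g \<otimes> y \<otimes> inv g = y" using y(2)[OF g] yc by auto
    then have "g \<otimes> z \<otimes> inv g = z" using conj_pow[OF g yc] by (simp add: z_def)
    then show ?thesis using g z(1) by (metis inv_solve_right m_closed)
  qed
  note socle = cyclic_prime_power_socle[OF assms(1) ac assms(2) m]
  define C where "C = {g \<in> carrier G. g \<otimes> a = a \<otimes> g}"
  show thesis
  proof (cases "C \<subseteq> ?A")
    case True
    show ?thesis
    proof (rule cyclic[OF z zcent A(2) aA nA[OF _ aA] _ a1])
      show "g \<in> ?A" if "g \<in> carrier G" "g \<otimes> a = a \<otimes> g" for g
        using True that by (auto simp: C_def)
      show "\<exists>i::nat. z = b [^] i" if "b \<in> ?A" "b \<noteq> \<one>" for b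
        using socle that zA z(3) by blast
    qed
  next
    case False
    have AC: "?A \<subseteq> C" using commA[OF _ ac] carA by (auto simp: C_def)
    have C: "subgroup C G"
    proof (rule subgroupI)
      show "C \<subseteq> carrier G" "C \<noteq> {}" using AC aA by (auto simp: C_def)
      fix g assume g: "g \<in> C"
      then have gc: "g \<in> carrier G" "g \<otimes> a = a \<otimes> g" by (auto simp: C_def)
      have "inv g \<otimes> a = inv g \<otimes> (a \<otimes> g) \<otimes> inv g" using gc(1) ac by (simp add: m_assoc)
      also have "\<dots> = a \<otimes> inv g" unfolding gc(2)[symmetric] using gc(1) ac by (simp add: m_assoc[symmetric])
      finally show "inv g \<in> C" using gc by (simp add: C_def)
      fix h assume h: "h \<in> C"
      then have hc: "h \<in> carrier G" "h \<otimes> a = a \<otimes> h" by (auto simp: C_def)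
      have "g \<otimes> h \<otimes> a = g \<otimes> a \<otimes> h" using gc(1) hc ac by (simp add: m_assoc)
      also have "\<dots> = a \<otimes> (g \<otimes> h)" unfolding gc(2) using gc(1) hc(1) ac by (simp add: m_assoc)
      finally show "g \<otimes> h \<in> C" using gc hc by (simp add: C_def)
    qed
    have nC: "g \<otimes> x \<otimes> inv g \<in> C" if g: "g \<in> carrier G" and x: "x \<in> C" for g x
    proof -
      have xc: "x \<in> carrier G" "a \<otimes> x = x \<otimes> a" using x by (auto simp: C_def)
      have b: "inv g \<otimes> a \<otimes> g \<in> ?A" using nA[of "inv g" a] g aA by simp
      have bx: "(inv g \<otimes> a \<otimes> g) \<otimes> x = x \<otimes> (inv g \<otimes> a \<otimes> g)" by (rule commA[OF b xc])
      have "g \<otimes> x \<otimes> inv g \<otimes> a = g \<otimes> (x \<otimes> (inv g \<otimes> a \<otimes> g)) \<otimes> inv g"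
        using g xc ac by (simp add: m_assoc)
      also have "\<dots> = a \<otimes> (g \<otimes> x \<otimes> inv g)"
        unfolding bx[symmetric] using g xc(1) ac by (simp add: m_assoc[symmetric])
      finally show ?thesis using g xc(1) by (simp add: C_def)
    qed
    obtain y where y: "y \<in> C - ?A" "\<And>g. g \<in> carrier G \<Longrightarrow> \<exists>c \<in> ?A. g \<otimes> y \<otimes> inv g = c \<otimes> y"
      using exists_central_mod[OF assms(1-3) A(2) C _ nA nC] AC False by blast
    have yc: "y \<in> carrier G" "a \<otimes> y = y \<otimes> a" using y(1) by (auto simp: C_def)
    \<comment> \<open>The least exponent is positive because \<open>y\<close> is outside
      \<open>?A\<close>. One step before it, the power \<open>y'\<close> is still outside
      \<open>?A\<close> while its q-th power is inside.\<close>
    define Q where "Q = (\<lambda>n. y [^] (q ^ n) \<in> ?A)"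
    have "\<exists>n. Q n"
    proof -
      obtain i where "ord y = q ^ i" using ord_prime_power[OF assms(1-3) yc(1)] .
      then have "y [^] (q ^ i) = \<one>" using pow_eq_id[OF yc(1)] by simp
      then show ?thesis using subgroup.one_closed[OF A(2)] by (intro exI[of _ i]) (simp add: Q_def)
    qed
    then have QL: "Q (LEAST n. Q n)" by (rule LeastI_ex)
    have "\<not> Q 0" using y(1) yc by (simp add: Q_def nat_pow_eone)
    then obtain n where n: "(LEAST n. Q n) = Suc n" using QL by (cases "LEAST n. Q n") auto
    have nQ: "\<not> Q n" using n not_less_Least[of n Q] by simp
    define y' where "y' = y [^] (q ^ n)"
    have y'A: "y' \<notin> ?A" using nQ by (simp add: Q_def y'_def)
    have y'c: "y' \<in> carrier G" using yc by (simp add: y'_def)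
    have y'comm: "x \<otimes> y' = y' \<otimes> x" if "x \<in> ?A" for x
    proof -
      have "a \<otimes> y' = y' \<otimes> a"
        unfolding y'_def using commuting_pow[OF yc(1) ac yc(2)[symmetric]] by simp
      then show ?thesis using commA[OF that y'c] by simp
    qed
    have "y' [^] q \<in> ?A" using QL n yc(1) by (simp add: Q_def y'_def nat_pow_pow mult.commute)
    then obtain t :: nat where t: "y' [^] q = a [^] t" using A(1) by auto
    have y'conj: "\<exists>c \<in> ?A. g \<otimes> y' \<otimes> inv g = c \<otimes> y'" if g: "g \<in> carrier G" for g
    proof -
      obtain c where c: "c \<in> ?A" "g \<otimes> y \<otimes> inv g = c \<otimes> y" using y(2)[OF g] by blast
      have cc: "c \<in> carrier G" using c(1) carA by blast
      have "g \<otimes> y' \<otimes> inv g = (c \<otimes> y) [^] (q ^ n)"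
        using conj_pow[OF g yc(1)] c(2) by (simp add: y'_def)
      also have "\<dots> = c [^] (q ^ n) \<otimes> y'"
        unfolding y'_def by (rule pow_mult_distrib[OF commA[OF c(1) yc] cc yc(1)])
      finally show ?thesis using powers_in_subgroup[OF A(2) c(1)] by blast
    qed
    \<comment> \<open>Otherwise the q-th power of \<open>y'\<close> generates \<open>?A\<close>.
      Then \<open>y'\<close> generates a strictly larger cyclic subgroup, normal by
      \<open>y'conj\<close>, against the choice of \<open>a\<close>.\<close>
    have "q dvd t"
    proof (rule ccontr)
      assume "\<not> q dvd t"
      then have "coprime t (ord a)" unfolding m using assms(2) by (simp add: coprime_commute prime_imp_coprime)
      then obtain l :: nat where l: "a = (a [^] t) [^] l" using pow_coprime_surj[OF assms(1) ac] by blast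
      let ?Y = "generate G {y'}"
      note Y = powers_subgroup[OF assms(1) y'c]
      have y'Y: "y' \<in> ?Y" by (rule generate.incl) simp
      have "(a [^] t) [^] l \<in> ?Y"
        unfolding t[symmetric] by (intro powers_in_subgroup[OF Y(2)] y'Y)
      then have "a \<in> ?Y" by (simp only: l[symmetric])
      then have sub: "?A \<subseteq> ?Y" by (intro generate_subgroup_incl Y(2)) auto
      have "P y'"
        unfolding P_def using y'c y'conj sub y'Y subgroup.m_closed[OF Y(2)] by fastforce
      then have "ord y' \<le> ord a" by (rule a(2))
      moreover have "card ?A < card ?Y"
        using sub y'Y y'A subgroup_finite[OF assms(1) Y(2)] by (intro psubset_card_mono) auto
      ultimately show False using A(3) Y(3) by simp
    qed
    then obtain t' where t': "t = q * t'" by (elim dvdE)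
    \<comment> \<open>The power of \<open>a\<close> with exponent \<open>t'\<close> is a q-th root
      of the q-th power of \<open>y'\<close> and commutes with \<open>y'\<close>. Dividing
      \<open>y'\<close> by it leaves an element of order q that is still outside
      \<open>?A\<close>.\<close>
    define d where "d = inv (a [^] t')"
    have dA: "d \<in> ?A" unfolding d_def by (intro subgroup.m_inv_closed[OF A(2)] powers_in_subgroup[OF A(2)] aA)
    have dc: "d \<in> carrier G" using dA carA by blast
    define x where "x = d \<otimes> y'"
    have xc: "x \<in> carrier G" using dc y'c by (simp add: x_def)
    have "d [^] q = inv (a [^] t)" using ac by (simp add: d_def t' nat_pow_inv[symmetric] nat_pow_pow mult.commute)
    moreover have "x [^] q = d [^] q \<otimes> y' [^] q"
      unfolding x_def by (rule pow_mult_distrib[OF y'comm[OF dA] dc y'c])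
    ultimately have xq: "x [^] q = \<one>" using ac t by simp
    have xA: "x \<notin> ?A"
    proof
      assume x: "x \<in> ?A"
      have "y' = inv d \<otimes> x" using dc y'c by (simp add: x_def m_assoc[symmetric])
      then show False using x dA y'A subgroup.m_closed[OF A(2)] subgroup.m_inv_closed[OF A(2)] by simp
    qed
    show ?thesis
    proof (rule noncyclic[OF z zcent xc xq])
      show "x \<noteq> z [^] i" for i :: nat using xA powers_in_subgroup[OF A(2) zA] by metis
      fix g assume g: "g \<in> carrier G"
      obtain c where c: "c \<in> ?A" "g \<otimes> y' \<otimes> inv g = c \<otimes> y'" using y'conj[OF g] by blast
      \<comment> \<open>\<open>e\<close> is the factor by which conjugation by \<open>g\<close>
        changes \<open>x\<close>. It lies in \<open>?A\<close> and commutes with \<open>x\<close>,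
        so its q-th power is trivial and it is a power of \<open>z\<close>.\<close>
      define e where "e = (g \<otimes> d \<otimes> inv g) \<otimes> c \<otimes> inv d"
      have eA: "e \<in> ?A" unfolding e_def
        using nA[OF g dA] c(1) dA subgroup.m_closed[OF A(2)] subgroup.m_inv_closed[OF A(2)] by metis
      have ec: "e \<in> carrier G" "c \<in> carrier G" using eA c(1) carA by auto
      have "inv d \<otimes> (d \<otimes> y') = y'" using dc y'c by (simp add: m_assoc[symmetric])
      then have "e \<otimes> x = (g \<otimes> d \<otimes> inv g) \<otimes> (c \<otimes> y')"
        using g dc ec(2) y'c by (simp add: x_def e_def m_assoc)
      then have gx: "g \<otimes> x \<otimes> inv g = e \<otimes> x"
        using conj_mult[OF g dc y'c] c(2) by (simp add: x_def)
      have xcomm: "e \<otimes> x = x \<otimes> e"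
      proof -
        have "a \<otimes> x = x \<otimes> a"
          using y'comm[OF aA] commA[OF dA ac] ac dc y'c unfolding x_def by (metis m_assoc)
        then show ?thesis using commA[OF eA xc] by simp
      qed
      have "(e \<otimes> x) [^] q = \<one>" using conj_pow[OF g xc, of q] gx xq g by simp
      then have "e [^] q = \<one>" using pow_mult_distrib[OF xcomm ec(1) xc, of q] xq ec by simp
      then obtain i :: nat where "e = z [^] i" using socle[OF zA z(2) eA] by blast
      then show "\<exists>i::nat. g \<otimes> x \<otimes> inv g = z [^] i \<otimes> x" using gx by blast
    qed
  qed
qed

end

section \<open>Coprime actions on abelian groups of prime exponent\<close>

text \<open>An abelian group of exponent dividing p, cut out of a commutative monoid: complex-valued
  functions under pointwise multiplication are the intended instance and do not form a group type.
  Inverses are available as powers with exponent p - 1.\<close>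

definition exp_group :: "nat \<Rightarrow> 'w::comm_monoid_mult set \<Rightarrow> bool" where
  "exp_group p U \<longleftrightarrow> finite U \<and> 1 \<in> U \<and> (\<forall>x \<in> U. \<forall>y \<in> U. x * y \<in> U) \<and> (\<forall>x \<in> U. x ^ p = 1)"

definition kern :: "'a set \<Rightarrow> ('a \<Rightarrow> 'x \<Rightarrow> 'x) \<Rightarrow> 'x set \<Rightarrow> 'a set" where
  "kern R \<phi> U = {g \<in> R. \<forall>u \<in> U. \<phi> g u = u}"

text \<open>The estimate q |S|^2 <= |R| for a stabilizer S in the faithful quotient of R, cleared of
  denominators by the square of the kernel order. If the kernel is all of R, the estimate would read
  q <= 1, hence the exemption.\<close>

definition large_orbit :: "nat \<Rightarrow> 'a set \<Rightarrow> ('a \<Rightarrow> 'x \<Rightarrow> 'x) \<Rightarrow> 'x set \<Rightarrow> bool" where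
  "large_orbit q R \<phi> U \<longleftrightarrow> (\<exists>u \<in> U. kern R \<phi> U = R \<or> q * (card (stab R \<phi> u))\<^sup>2 \<le> card R * card (kern R \<phi> U))"

lemma exp_groupD:
  assumes "exp_group p U"
  shows "finite U" "1 \<in> U" "\<And>x y. x \<in> U \<Longrightarrow> y \<in> U \<Longrightarrow> x * y \<in> U" "\<And>x. x \<in> U \<Longrightarrow> x ^ p = 1"
  using assms by (auto simp: exp_group_def)

lemma exp_group_pow: "exp_group p U \<Longrightarrow> x \<in> U \<Longrightarrow> x ^ n \<in> U"
  by (induction n) (auto simp: exp_group_def)

lemma exp_group_inverse:
  assumes "exp_group p U" "x \<in> U" "p > 0"
  shows "x * x ^ (p - 1) = 1"
  using exp_groupD(4)[OF assms(1,2)] power_Suc[of x "p - 1"] assms(3) by simp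

lemma exp_group_cancel:
  assumes "exp_group p U" "x \<in> U" "p > 0" "x * y = x * z"
  shows "y = z"
proof -
  have "x ^ (p - 1) * (x * y) = x ^ (p - 1) * (x * z)" using assms(4) by simp
  then have "x * x ^ (p - 1) * y = x * x ^ (p - 1) * z" by (simp only: ac_simps)
  then show ?thesis using exp_group_inverse[OF assms(1-3)] by simp
qed

text \<open>Taking powers with an exponent prime to p is invertible. This serves the projection onto
  fixed points as well as the cancellation of q-th powers.\<close>

lemma exp_group_coprime_root:
  assumes "exp_group p U" "x \<in> U" "n * m mod p = Suc 0"
  shows "(x ^ n) ^ m = x"
proof -
  have "(x ^ n) ^ m = x ^ (n * m)" by (rule power_mult[symmetric])
  also have "n * m = p * (n * m div p) + Suc 0" using mult_div_mod_eq[of p "n * m"] assms(3) by simp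
  also have "x ^ \<dots> = (x ^ p) ^ (n * m div p) * x" by (simp only: power_add power_mult power_one_right One_nat_def[symmetric])
  also have "\<dots> = x" by (simp only: exp_groupD(4)[OF assms(1,2)] power_one mult_1)
  finally show ?thesis .
qed

lemma exp_group_prod:
  assumes "exp_group p U" "\<And>i. i \<in> I \<Longrightarrow> f i \<in> U"
  shows "prod f I \<in> U"
  using assms(2) by (induction I rule: infinite_finite_induct) (auto intro: exp_groupD[OF assms(1)])

section \<open>The norm map and the decomposition of a coprime action\<close>

locale aut_action = group G for G (structure) +
  fixes \<phi> :: "'a \<Rightarrow> 'w::comm_monoid_mult \<Rightarrow> 'w" and U :: "'w set" and p :: nat
  assumes fin: "finite (carrier G)"
    and acts: "acts G (carrier G) \<phi> U"
    and hom: "\<And>g x y. g \<in> carrier G \<Longrightarrow> x \<in> U \<Longrightarrow> y \<in> U \<Longrightarrow> \<phi> g (x * y) = \<phi> g x * \<phi> g y"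
    and U: "exp_group p U"
    and p: "prime p"
begin

lemma p_pos: "p > 0" using p prime_gt_0_nat by blast

lemmas U_D = exp_groupD[OF U]
lemmas act_D = actsD[OF acts]

lemma act_one: assumes "g \<in> carrier G" shows "\<phi> g 1 = 1"
proof -
  have "\<phi> g 1 * \<phi> g 1 = \<phi> g 1 * 1" using hom[OF assms U_D(2) U_D(2)] by simp
  then show ?thesis using exp_group_cancel[OF U act_D(3)[OF assms U_D(2)] p_pos] by blast
qed

lemma act_prod:
  assumes "g \<in> carrier G" "\<And>i. i \<in> I \<Longrightarrow> f i \<in> U"
  shows "\<phi> g (prod f I) = (\<Prod>i \<in> I. \<phi> g (f i))"
  using assms(2)
proof (induction I rule: infinite_finite_induct)
  case (insert i I)
  then show ?case using hom[OF assms(1), of "f i" "prod f I"] exp_group_prod[OF U, of I f] by auto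
qed (use act_one assms in auto)

text \<open>If D is a subgroup of order prime to p, this is the complement [U, D] of the fixed
  points. Being defined without choices, it is invariant under everything that normalizes D.\<close>

definition norm_ker :: "'a set \<Rightarrow> 'w set" where
  "norm_ker D = {u \<in> U. (\<Prod>d \<in> D. \<phi> d u) = 1}"

abbreviation "fixed D \<equiv> fixed_points D \<phi> U"

lemma exp_group_fixed:
  assumes "D \<subseteq> carrier G" shows "exp_group p (fixed D)"
  using assms U_D hom act_one by (auto simp: exp_group_def fixed_points_def subset_iff)

lemma norm_hom:
  assumes "D \<subseteq> carrier G" "x \<in> U" "y \<in> U"
  shows "(\<Prod>d \<in> D. \<phi> d (x * y)) = (\<Prod>d \<in> D. \<phi> d x) * (\<Prod>d \<in> D. \<phi> d y)"
proof -
  have "(\<Prod>d \<in> D. \<phi> d (x * y)) = (\<Prod>d \<in> D. \<phi> d x * \<phi> d y)"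
    by (rule prod.cong) (use assms hom in auto)
  then show ?thesis by (simp add: prod.distrib)
qed

lemma exp_group_norm_ker:
  assumes "D \<subseteq> carrier G" shows "exp_group p (norm_ker D)"
proof -
  have "(\<Prod>d \<in> D. \<phi> d 1) = 1" using act_one assms by (intro prod.neutral) auto
  then show ?thesis using U_D norm_hom[OF assms] by (auto simp: exp_group_def norm_ker_def)
qed

lemma norm_fixed:
  assumes "subgroup D G" "u \<in> U" shows "(\<Prod>d \<in> D. \<phi> d u) \<in> fixed D"
proof -
  note sub = subgroup.mem_carrier[OF assms(1)]
  have cl: "(\<Prod>d \<in> D. \<phi> d u) \<in> U" using sub assms(2) act_D(3) by (intro exp_group_prod[OF U]) auto
  have "\<phi> g (\<Prod>d \<in> D. \<phi> d u) = (\<Prod>d \<in> D. \<phi> d u)" if g: "g \<in> D" for g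
  proof -
    have "\<phi> g (\<Prod>d \<in> D. \<phi> d u) = (\<Prod>d \<in> D. \<phi> g (\<phi> d u))"
      using sub assms(2) g act_D(3) by (intro act_prod) auto
    also have "\<dots> = (\<Prod>d \<in> D. \<phi> (g \<otimes> d) u)"
      using sub assms(2) g act_D(4) by (intro prod.cong) auto
    also have "\<dots> = (\<Prod>d \<in> D. \<phi> d u)"
    proof (rule prod.reindex_bij_witness[of _ "\<lambda>d. inv g \<otimes> d" "\<lambda>d. g \<otimes> d"])
      fix d assume d: "d \<in> D"
      show "inv g \<otimes> (g \<otimes> d) = d" "g \<otimes> (inv g \<otimes> d) = d"
        using sub[OF g] sub[OF d] by (simp_all add: m_assoc[symmetric])
      show "g \<otimes> d \<in> D" "inv g \<otimes> d \<in> D"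
        using g d assms(1) by (auto intro: subgroup.m_closed subgroup.m_inv_closed)
    qed simp
    finally show ?thesis .
  qed
  then show ?thesis using cl by (simp add: fixed_points_def)
qed

lemma norm_of_fixed:
  assumes "u \<in> fixed D" shows "(\<Prod>d \<in> D. \<phi> d u) = u ^ card D"
  using assms by (simp add: fixed_points_def)

lemma inverse_mod:
  assumes "coprime n p" obtains m where "n * m mod p = Suc 0"
proof -
  obtain m where "[n * m = Suc 0] (mod p)" using cong_solve_coprime_nat[OF assms] by auto
  then have "n * m mod p = Suc 0 mod p" by (simp add: cong_def)
  also have "\<dots> = Suc 0" using prime_gt_1_nat[OF p] by simp
  finally show thesis by (rule that)
qed

text \<open>On fixed points the norm is the power map with exponent |D|, which is injective since
  |D| is prime to p.\<close>

lemma fixed_Int_norm_ker: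
  assumes "coprime (card D) p" "u \<in> fixed D" "u \<in> norm_ker D" shows "u = 1"
proof -
  obtain m where m: "card D * m mod p = Suc 0" by (rule inverse_mod[OF assms(1)])
  have "u ^ card D = 1" using assms(3) norm_of_fixed[OF assms(2)] by (simp add: norm_ker_def)
  moreover have "u \<in> U" using assms(3) by (simp add: norm_ker_def)
  ultimately show ?thesis using exp_group_coprime_root[OF U _ m, of u] by simp
qed

text \<open>With m an inverse of |D| modulo p, the m-th power of the norm is the projection onto the
  fixed points. The rest of u then has trivial norm.\<close>

lemma fixed_norm_ker_decomp:
  assumes "subgroup D G" "coprime (card D) p" "u \<in> U"
  obtains v w where "v \<in> fixed D" "w \<in> norm_ker D" "u = v * w"
proof -
  obtain m where m: "card D * m mod p = Suc 0" by (rule inverse_mod[OF assms(2)])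
  have sub: "D \<subseteq> carrier G" using subgroup.subset[OF assms(1)] .
  define N where "N = (\<Prod>d \<in> D. \<phi> d u)"
  have N: "N \<in> fixed D" unfolding N_def by (rule norm_fixed[OF assms(1,3)])
  define v where "v = N ^ m"
  have v: "v \<in> fixed D" unfolding v_def by (rule exp_group_pow[OF exp_group_fixed[OF sub] N])
  have vU: "v \<in> U" and NU: "N \<in> U" using v N by (auto simp: fixed_points_def)
  have v': "v ^ (p - 1) \<in> fixed D" "v ^ (p - 1) \<in> U"
    using exp_group_pow[OF exp_group_fixed[OF sub] v] exp_group_pow[OF U vU] by auto
  have "(N ^ m) ^ card D = N"
    using exp_group_coprime_root[OF U NU m] by (simp add: power_mult[symmetric] mult.commute)
  then have "(v ^ card D) ^ (p - 1) = N ^ (p - 1)" by (simp add: v_def)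
  then have "(v ^ (p - 1)) ^ card D = N ^ (p - 1)"
    by (simp add: power_mult[symmetric] mult.commute)
  then have "(\<Prod>d \<in> D. \<phi> d (u * v ^ (p - 1))) = N * N ^ (p - 1)"
    using norm_hom[OF sub assms(3) v'(2)] norm_of_fixed[OF v'(1)] by (simp add: N_def)
  also have "\<dots> = 1" by (rule exp_group_inverse[OF U NU p_pos])
  finally have "u * v ^ (p - 1) \<in> norm_ker D" using U_D(3)[OF assms(3) v'(2)] by (simp add: norm_ker_def)
  moreover have "u = v * (u * v ^ (p - 1))"
    using exp_group_inverse[OF U vU p_pos] by (simp add: mult.left_commute[of v u])
  ultimately show thesis using that v by blast
qed

lemma fixed_invariant:
  assumes "subgroup N G" "D \<subseteq> carrier G" "\<And>g d. g \<in> N \<Longrightarrow> d \<in> D \<Longrightarrow> g \<otimes> d \<otimes> inv g \<in> D"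
    and "g \<in> N" "u \<in> fixed D"
  shows "\<phi> g u \<in> fixed D"
proof -
  have g: "g \<in> carrier G" "inv g \<in> N" using assms(1,4) by (auto simp: subgroup.mem_carrier subgroup.m_inv_closed)
  have u: "u \<in> U" "\<And>d. d \<in> D \<Longrightarrow> \<phi> d u = u" using assms(5) by (auto simp: fixed_points_def)
  have "\<phi> d (\<phi> g u) = \<phi> g u" if d: "d \<in> D" for d
  proof -
    have dc: "d \<in> carrier G" using d assms(2) by auto
    have e: "inv g \<otimes> d \<otimes> g \<in> D" using assms(3)[OF g(2) d] g by simp
    have "\<phi> d (\<phi> g u) = \<phi> (d \<otimes> g) u" using act_D(4)[OF dc g(1) u(1)] by simp
    also have "d \<otimes> g = g \<otimes> (inv g \<otimes> d \<otimes> g)" using g dc by (simp add: m_assoc[symmetric])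
    also have "\<phi> \<dots> u = \<phi> g u" using act_D(4)[OF g(1) _ u(1)] u(2)[OF e] g dc by simp
    finally show ?thesis .
  qed
  then show ?thesis using act_D(3)[OF g(1) u(1)] by (simp add: fixed_points_def)
qed

lemma norm_ker_invariant:
  assumes "subgroup N G" "D \<subseteq> carrier G" "\<And>g d. g \<in> N \<Longrightarrow> d \<in> D \<Longrightarrow> g \<otimes> d \<otimes> inv g \<in> D"
    and "g \<in> N" "u \<in> norm_ker D"
  shows "\<phi> g u \<in> norm_ker D"
proof -
  have g: "g \<in> carrier G" "inv g \<in> N" using assms(1,4) by (auto simp: subgroup.mem_carrier subgroup.m_inv_closed)
  have u: "u \<in> U" "(\<Prod>d \<in> D. \<phi> d u) = 1" using assms(5) by (auto simp: norm_ker_def)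
  have "(\<Prod>d \<in> D. \<phi> d (\<phi> g u)) = (\<Prod>d \<in> D. \<phi> g (\<phi> d u))"
  proof (rule prod.reindex_bij_witness[of _ "\<lambda>d. g \<otimes> d \<otimes> inv g" "\<lambda>d. inv g \<otimes> d \<otimes> g"])
    fix d assume d: "d \<in> D"
    have dc: "d \<in> carrier G" using d assms(2) by auto
    show "g \<otimes> (inv g \<otimes> d \<otimes> g) \<otimes> inv g = d" "inv g \<otimes> (g \<otimes> d \<otimes> inv g) \<otimes> g = d"
      using g dc by (simp_all add: m_assoc) (simp_all add: m_assoc[symmetric])
    show "inv g \<otimes> d \<otimes> g \<in> D" "g \<otimes> d \<otimes> inv g \<in> D"
      using assms(3)[OF g(2) d] assms(3)[OF assms(4) d] g by simp_all
    have "\<phi> g (\<phi> (inv g \<otimes> d \<otimes> g) u) = \<phi> (g \<otimes> (inv g \<otimes> d \<otimes> g)) u"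
      using act_D(4)[OF g(1) _ u(1)] g dc by simp
    also have "g \<otimes> (inv g \<otimes> d \<otimes> g) = d \<otimes> g" using g dc by (simp add: m_assoc[symmetric])
    finally show "\<phi> g (\<phi> (inv g \<otimes> d \<otimes> g) u) = \<phi> d (\<phi> g u)" using act_D(4)[OF dc g(1) u(1)] by simp
  qed
  also have "\<dots> = \<phi> g (\<Prod>d \<in> D. \<phi> d u)"
    using act_D(3) u(1) assms(2) by (intro act_prod[OF g(1), symmetric]) auto
  finally show ?thesis using u act_one[OF g(1)] act_D(3)[OF g(1) u(1)] by (simp add: norm_ker_def)
qed

text \<open>The bound for a decomposition \<open>U = U\<^sub>1 \<times> U\<^sub>2\<close>: stabilize in \<open>U\<^sub>1\<close> first, then let the kernel on
  \<open>U\<^sub>1\<close> act on \<open>U\<^sub>2\<close>.\<close>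

lemma stab_mult_le:
  assumes N: "subgroup N G" and D: "subgroup D G" "coprime (card D) p"
    and inv: "\<And>g d. g \<in> N \<Longrightarrow> d \<in> D \<Longrightarrow> g \<otimes> d \<otimes> inv g \<in> D"
    and v: "v \<in> fixed D" and w: "w \<in> norm_ker D"
  shows "card (stab N \<phi> (v * w)) * card (kern N \<phi> (fixed D))
    \<le> card (stab N \<phi> v) * card (stab (kern N \<phi> (fixed D)) \<phi> w)"
    and "stab N \<phi> (v * w) \<subseteq> stab N \<phi> v"
proof -
  have Dc: "D \<subseteq> carrier G" using subgroup.subset[OF D(1)] .
  have vU: "v \<in> U" and wU: "w \<in> U" using v w by (auto simp: fixed_points_def norm_ker_def)
  have eq: "\<phi> g v = v \<and> \<phi> g w = w" if g: "g \<in> N" "\<phi> g (v * w) = v * w" for g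
  proof -
    have gc: "g \<in> carrier G" using g N subgroup.mem_carrier by metis
    have gv: "\<phi> g v \<in> fixed D" "\<phi> g v \<in> U" and gw: "\<phi> g w \<in> norm_ker D" "\<phi> g w \<in> U"
      using fixed_invariant[OF N Dc inv g(1) v] norm_ker_invariant[OF N Dc inv g(1) w]
      by (auto simp: fixed_points_def norm_ker_def)
    have e: "\<phi> g v * \<phi> g w = v * w" using hom[OF gc vU wU] g(2) by simp
    \<comment> \<open>These inverses of \<open>v\<close> and \<open>\<phi> g w\<close> rearrange the
      equation \<open>e\<close> so that one side lies in \<open>fixed D\<close> and the other in
      \<open>norm_ker D\<close>; both sides are therefore 1.\<close>
    define v' where "v' = v ^ (p - 1)"
    define w' where "w' = \<phi> g w ^ (p - 1)"
    have v': "v' \<in> fixed D" "v * v' = 1" "w' \<in> norm_ker D" "\<phi> g w * w' = 1"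
      unfolding v'_def w'_def
      using exp_group_pow[OF exp_group_fixed[OF Dc] v] exp_group_pow[OF exp_group_norm_ker[OF Dc] gw(1)]
        exp_group_inverse[OF U vU p_pos] exp_group_inverse[OF U gw(2) p_pos] by auto
    have "\<phi> g v * v' = \<phi> g v * v' * (\<phi> g w * w')" using v' by simp
    also have "\<dots> = (v * w) * (v' * w')" unfolding e[symmetric] by (simp add: ac_simps)
    also have "\<dots> = (v * v') * (w * w')" by (simp add: ac_simps)
    also have "\<dots> = w * w'" using v' by simp
    finally have e2: "\<phi> g v * v' = w * w'" .
    have "\<phi> g v * v' \<in> fixed D" using exp_groupD(3)[OF exp_group_fixed[OF Dc] gv(1) v'(1)] .
    moreover have "w * w' \<in> norm_ker D" using exp_groupD(3)[OF exp_group_norm_ker[OF Dc] w v'(3)] .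
    ultimately have "\<phi> g v * v' = 1" using fixed_Int_norm_ker[OF D(2)] e2 by simp
    then have "v' * \<phi> g v = v' * v" using v' by (simp add: mult.commute)
    then have "\<phi> g v = v"
      using exp_group_cancel[OF exp_group_fixed[OF Dc] v'(1) p_pos] by simp
    moreover have "\<phi> g w = w" using e calculation exp_group_cancel[OF U vU p_pos] by simp
    ultimately show ?thesis ..
  qed
  then show "stab N \<phi> (v * w) \<subseteq> stab N \<phi> v" by (auto simp: stab_def)
  let ?K = "kern N \<phi> (fixed D)"
  have aN: "acts G N \<phi> U" using acts_subgroup[OF acts N] subgroup.subset[OF N] by blast
  have K: "subgroup ?K G"
  proof -
    have "acts G N \<phi> (fixed D)"
      using aN fixed_invariant[OF N Dc inv] by (auto simp: acts_def fixed_points_def)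
    then have "subgroup (\<Inter>u \<in> fixed D. stab N \<phi> u) G"
      using v by (intro subgroups_Inter) (auto intro: subgroup_stab)
    moreover have "?K = (\<Inter>u \<in> fixed D. stab N \<phi> u)" using v by (auto simp: kern_def stab_def)
    ultimately show ?thesis by simp
  qed
  have fN: "finite (stab N \<phi> v)"
    using subgroup_finite[OF fin N] by (simp add: stab_def)
  \<comment> \<open>The stabilizer of \<open>v * w\<close> and the kernel both lie in the stabilizer
    of \<open>v\<close>, so the product bound can be taken inside that smaller group.\<close>
  have "card (stab N \<phi> (v * w)) * card ?K \<le> card (stab N \<phi> v) * card (stab N \<phi> (v * w) \<inter> ?K)"
    using eq v by (intro card_mult_le_Int fN K subgroup_stab[OF aN] U_D(3) vU wU) (auto simp: stab_def kern_def)
  also have "stab N \<phi> (v * w) \<inter> ?K \<subseteq> stab ?K \<phi> w"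
    using eq by (auto simp: stab_def kern_def)
  then have "card (stab N \<phi> (v * w) \<inter> ?K) \<le> card (stab ?K \<phi> w)"
    using subgroup_finite[OF fin K] by (intro card_mono) (auto simp: stab_def)
  finally show "card (stab N \<phi> (v * w)) * card ?K \<le> card (stab N \<phi> v) * card (stab ?K \<phi> w)"
    by (meson mult_le_mono2 le_trans)
qed

end

section \<open>Large orbits\<close>

text \<open>The induction step for the orbit bound. \<open>IH\<close> ranges over all subgroups,
  including those that act with a kernel on the smaller group; only the action of G on U is
  faithful.\<close>

locale q_action = aut_action +
  fixes q k :: nat
  assumes q: "prime q" "q \<noteq> p" and card_G: "card (carrier G) = q ^ k"
    and faithful: "kern (carrier G) \<phi> U = {\<one>}"
    and IH: "\<And>N V. subgroup N G \<Longrightarrow> exp_group p V \<Longrightarrow> acts G N \<phi> V \<Longrightarrow> V \<subset> U \<Longrightarrow> large_orbit q N \<phi> V"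
begin

lemma q_gt: "q > 1" using q prime_gt_1_nat by blast

lemma coprime_q_p: "coprime q p" using q p primes_coprime by blast

lemma large_orbitI:
  assumes "u \<in> U" "q * (card (stab (carrier G) \<phi> u))\<^sup>2 \<le> card (carrier G)"
  shows "large_orbit q (carrier G) \<phi> U"
  unfolding large_orbit_def using assms by (auto simp: faithful)

lemma card_subgroup_power:
  assumes "subgroup N G" obtains i where "card N = q ^ i" "i \<le> k"
proof -
  have "card N dvd q ^ k"
    using card_subgroup_dvd[OF fin assms subgroup_self] subgroup.subset[OF assms] card_G by simp
  then show thesis using that divides_primepow_nat[OF q(1)] by blast
qed

lemma card_psubgroup_le:
  assumes "subgroup N G" "N \<noteq> carrier G" shows "q * card N \<le> card (carrier G)"
proof -
  obtain i where i: "card N = q ^ i" "i \<le> k" by (rule card_subgroup_power[OF assms(1)])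
  have "card N < card (carrier G)"
    using assms subgroup.subset[OF assms(1)] fin by (intro psubset_card_mono) auto
  then have "i < k" using i card_G q_gt by (simp add: power_strict_increasing_iff)
  then have "q ^ Suc i \<le> q ^ k" using q_gt by (intro power_increasing) auto
  then show ?thesis using i card_G by simp
qed

lemma acts_fixed:
  assumes "subgroup N G" "D \<subseteq> carrier G" "\<And>g d. g \<in> N \<Longrightarrow> d \<in> D \<Longrightarrow> g \<otimes> d \<otimes> inv g \<in> D"
  shows "acts G N \<phi> (fixed D)"
  using acts_subgroup[OF acts assms(1) subgroup.subset[OF assms(1)]] fixed_invariant[OF assms]
  by (auto simp: acts_def fixed_points_def)

lemma acts_norm_ker:
  assumes "subgroup N G" "D \<subseteq> carrier G" "\<And>g d. g \<in> N \<Longrightarrow> d \<in> D \<Longrightarrow> g \<otimes> d \<otimes> inv g \<in> D"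
  shows "acts G N \<phi> (norm_ker D)"
  using acts_subgroup[OF acts assms(1) subgroup.subset[OF assms(1)]] norm_ker_invariant[OF assms]
  by (auto simp: acts_def norm_ker_def)

lemma kern_subgroup:
  assumes "acts G N \<phi> V" "V \<noteq> {}" shows "subgroup (kern N \<phi> V) G"
proof -
  have "subgroup (\<Inter>u \<in> V. stab N \<phi> u) G"
    using assms by (intro subgroups_Inter) (auto intro: subgroup_stab)
  moreover have "kern N \<phi> V = (\<Inter>u \<in> V. stab N \<phi> u)" using assms(2) by (auto simp: kern_def stab_def)
  ultimately show ?thesis by simp
qed

text \<open>Two nested applications of the induction hypothesis along \<open>U = fixed D \<times> norm_ker D\<close>.\<close>

lemma nested_orbits:
  assumes N: "subgroup N G" and D: "subgroup D G" "coprime (card D) p"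
    and inv: "\<And>g d. g \<in> N \<Longrightarrow> d \<in> D \<Longrightarrow> g \<otimes> d \<otimes> inv g \<in> D"
    and proper: "fixed D \<noteq> {1}" "fixed D \<noteq> U"
  obtains v w where "v \<in> fixed D" "v * w \<in> U"
    "kern N \<phi> (fixed D) = N \<or> q * (card (stab N \<phi> v))\<^sup>2 \<le> card N * card (kern N \<phi> (fixed D))"
    "kern N \<phi> (fixed D) = {\<one>} \<or>
      q * (card (stab N \<phi> (v * w)))\<^sup>2 * card (kern N \<phi> (fixed D)) \<le> (card (stab N \<phi> v))\<^sup>2"
proof -
  let ?K = "kern N \<phi> (fixed D)"
  have Dc: "D \<subseteq> carrier G" using subgroup.subset[OF D(1)] .
  have fV: "fixed D \<subset> U" using proper(2) by (auto simp: fixed_points_def)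
  obtain v where v: "v \<in> fixed D" "?K = N \<or> q * (card (stab N \<phi> v))\<^sup>2 \<le> card N * card ?K"
    using IH[OF N exp_group_fixed[OF Dc] acts_fixed[OF N Dc inv] fV] by (auto simp: large_orbit_def)
  have K: "subgroup ?K G" using kern_subgroup[OF acts_fixed[OF N Dc inv]] v(1) by blast
  have KN: "?K \<subseteq> N" by (auto simp: kern_def)
  \<comment> \<open>A nontrivial fixed point is not in \<open>norm_ker D\<close>, so this factor is
    proper as well and the induction hypothesis applies to it.\<close>
  obtain u0 where u0: "u0 \<in> fixed D" "u0 \<noteq> 1" using proper(1) exp_groupD(2)[OF exp_group_fixed[OF Dc]] by blast
  then have "u0 \<in> U" "u0 \<notin> norm_ker D" using fixed_Int_norm_ker[OF D(2)] by (auto simp: fixed_points_def)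
  then have nV: "norm_ker D \<subset> U" by (auto simp: norm_ker_def)
  have "large_orbit q ?K \<phi> (norm_ker D)"
    using KN inv by (intro IH[OF K exp_group_norm_ker[OF Dc] acts_norm_ker[OF K Dc] nV]) auto
  then obtain w where w: "w \<in> norm_ker D" "kern ?K \<phi> (norm_ker D) = ?K \<or>
      q * (card (stab ?K \<phi> w))\<^sup>2 \<le> card ?K * card (kern ?K \<phi> (norm_ker D))"
    by (auto simp: large_orbit_def)
  \<comment> \<open>An element trivial on both factors is trivial on their product U, hence is the
    identity by faithfulness.\<close>
  have kk: "kern ?K \<phi> (norm_ker D) = {\<one>}"
  proof (rule antisym)
    show "kern ?K \<phi> (norm_ker D) \<subseteq> {\<one>}"
    proof
      fix g assume g: "g \<in> kern ?K \<phi> (norm_ker D)"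
      then have gN: "g \<in> carrier G" using subgroup.mem_carrier[OF N] by (auto simp: kern_def)
      have "\<phi> g u = u" if u: "u \<in> U" for u
      proof -
        obtain a b where ab: "a \<in> fixed D" "b \<in> norm_ker D" "u = a * b"
          by (rule fixed_norm_ker_decomp[OF D u])
        moreover have "a \<in> U" "b \<in> U" using ab by (auto simp: fixed_points_def norm_ker_def)
        ultimately show ?thesis using g hom[OF gN] by (simp add: kern_def)
      qed
      then show "g \<in> {\<one>}" using gN faithful by (auto simp: kern_def)
    qed
    show "{\<one>} \<subseteq> kern ?K \<phi> (norm_ker D)"
      using subgroup.one_closed[OF K] act_D(2) by (auto simp: kern_def norm_ker_def)
  qed
  have vU: "v \<in> U" and wU: "w \<in> U" using v w by (auto simp: fixed_points_def norm_ker_def)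
  let ?A = "card (stab N \<phi> (v * w))" let ?B = "card (stab N \<phi> v)" let ?C = "card (stab ?K \<phi> w)"
  show thesis
  proof (rule that[OF v(1) U_D(3)[OF vU wU] v(2)])
    show "?K = {\<one>} \<or> q * ?A\<^sup>2 * card ?K \<le> ?B\<^sup>2"
    proof (cases "?K = {\<one>}")
      case False
      then have C: "q * ?C\<^sup>2 \<le> card ?K" using w(2) kk by auto
      \<comment> \<open>Square this product estimate, insert the bound \<open>C\<close> for the
        second factor, and cancel one factor \<open>card ?K\<close>.\<close>
      have AB: "?A * card ?K \<le> ?B * ?C" by (rule stab_mult_le(1)[OF N D inv v(1) w(1)])
      have "q * (?A * card ?K)\<^sup>2 \<le> q * (?B * ?C)\<^sup>2" by (intro mult_left_mono power_mono AB) auto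
      also have "\<dots> = ?B\<^sup>2 * (q * ?C\<^sup>2)" by (simp add: power_mult_distrib)
      also have "\<dots> \<le> ?B\<^sup>2 * card ?K" using C by (rule mult_left_mono) simp
      finally have "card ?K * (q * ?A\<^sup>2 * card ?K) \<le> card ?K * ?B\<^sup>2"
        by (simp add: power_mult_distrib power2_eq_square mult_ac)
      moreover have "card ?K > 0" by (rule card_subgroup_pos[OF fin K])
      ultimately show ?thesis by simp
    qed simp
  qed
qed

text \<open>A normal D with proper, nontrivial fixed points splits U into two G-invariant factors,
  and the estimates of \<open>nested_orbits\<close> for N = G combine. If the kernel on the first
  factor is trivial, the point in that factor already works.\<close>

lemma large_orbit_decomposable:
  assumes D: "subgroup D G" "coprime (card D) p"
    and inv: "\<And>g d. g \<in> carrier G \<Longrightarrow> d \<in> D \<Longrightarrow> g \<otimes> d \<otimes> inv g \<in> D"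
    and proper: "fixed D \<noteq> {1}" "fixed D \<noteq> U"
  shows "large_orbit q (carrier G) \<phi> U"
proof (cases "carrier G = {\<one>}")
  case True
  then show ?thesis using faithful U_D(2) by (auto simp: large_orbit_def)
next
  case False
  let ?K = "kern (carrier G) \<phi> (fixed D)"
  obtain v w where vw: "v \<in> fixed D" "v * w \<in> U"
    "?K = carrier G \<or> q * (card (stab (carrier G) \<phi> v))\<^sup>2 \<le> card (carrier G) * card ?K"
    "?K = {\<one>} \<or> q * (card (stab (carrier G) \<phi> (v * w)))\<^sup>2 * card ?K \<le> (card (stab (carrier G) \<phi> v))\<^sup>2"
    by (rule nested_orbits[OF subgroup_self D inv proper])
  let ?A = "card (stab (carrier G) \<phi> (v * w))" let ?B = "card (stab (carrier G) \<phi> v)"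
  have vU: "v \<in> U" using vw by (auto simp: fixed_points_def)
  have K: "subgroup ?K G"
    using kern_subgroup[OF acts_fixed[OF subgroup_self _ inv]] vw(1) subgroup.subset[OF D(1)] by blast
  have K0: "card ?K > 0" by (rule card_subgroup_pos[OF fin K])
  show ?thesis
  proof (cases "?K = {\<one>}")
    case True
    then show ?thesis using vw(3) False by (intro large_orbitI[OF vU]) auto
  next
    case K1: False
    then have AB: "q * ?A\<^sup>2 * card ?K \<le> ?B\<^sup>2" using vw(4) by blast
    \<comment> \<open>\<open>AB\<close> already supplies the factor q, so the first factor is needed
      only without it. This weaker bound holds also when the kernel is all of G.\<close>
    have "?B\<^sup>2 \<le> card (carrier G) * card ?K"
    proof (cases "?K = carrier G")
      case True
      have "?B \<le> card (carrier G)" using fin by (intro card_mono) (auto simp: stab_def)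
      then have "?B\<^sup>2 \<le> (card (carrier G))\<^sup>2" by (rule power_mono) simp
      then show ?thesis using True by (simp add: power2_eq_square)
    next
      case False
      then have "q * ?B\<^sup>2 \<le> card (carrier G) * card ?K" using vw(3) by blast
      moreover have "1 * ?B\<^sup>2 \<le> q * ?B\<^sup>2" using q_gt by (intro mult_right_mono) auto
      ultimately show ?thesis by linarith
    qed
    with AB have "q * ?A\<^sup>2 * card ?K \<le> card (carrier G) * card ?K" by linarith
    then have "q * ?A\<^sup>2 \<le> card (carrier G)" using K0 by simp
    then show ?thesis by (rule large_orbitI[OF vw(2)])
  qed
qed

section \<open>Central elements of order q and the two cases for the acting group\<close>

lemma fixed_powers:
  assumes "y \<in> carrier G" "u \<in> U" "\<phi> y u = u" shows "\<phi> (y [^] (n::nat)) u = u"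
proof (induction n)
  case (Suc n)
  then show ?case using act_D(4)[of "y [^] n" y u] assms by simp
qed (use assms act_D in simp)

lemma fixed_generate:
  assumes "y \<in> carrier G" shows "fixed (generate G {y}) = {u \<in> U. \<phi> y u = u}"
proof (intro equalityI subsetI)
  fix u assume "u \<in> fixed (generate G {y})"
  then show "u \<in> {u \<in> U. \<phi> y u = u}"
    using generate.incl[of y "{y}" G] by (simp add: fixed_points_def)
next
  fix u assume "u \<in> {u \<in> U. \<phi> y u = u}"
  then show "u \<in> fixed (generate G {y})"
    using fixed_powers[OF assms] powers_subgroup(1)[OF fin assms] by (auto simp: fixed_points_def)
qed

lemma card_generate_q:
  assumes "y \<in> carrier G" "y \<noteq> \<one>" "y [^] q = \<one>" shows "card (generate G {y}) = q"
proof -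
  have "ord y = q" by (rule ord_eq_prime[OF assms(1,2) q(1) assms(3)])
  then show ?thesis using powers_subgroup(3)[OF fin assms(1)] by simp
qed

lemma fixed_generate_proper:
  assumes "y \<in> carrier G" "y \<noteq> \<one>" shows "fixed (generate G {y}) \<noteq> U"
proof
  assume "fixed (generate G {y}) = U"
  then have "y \<in> kern (carrier G) \<phi> U"
    using fixed_generate[OF assms(1)] assms(1) by (auto simp: kern_def)
  then show False using faithful assms(2) by simp
qed

text \<open>The group generated by y is normal, and faithfulness prevents it from fixing all of U,
  so it splits U. Afterwards central elements of order q may be taken to act without nontrivial
  fixed points.\<close>

lemma large_orbit_central:
  assumes "y \<in> carrier G" "y \<noteq> \<one>" "y [^] q = \<one>" "\<And>g. g \<in> carrier G \<Longrightarrow> g \<otimes> y = y \<otimes> g"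
    and "u \<in> U" "u \<noteq> 1" "\<phi> y u = u"
  shows "large_orbit q (carrier G) \<phi> U"
proof (rule large_orbit_decomposable[OF powers_subgroup(2)[OF fin assms(1)]])
  show "coprime (card (generate G {y})) p" using card_generate_q[OF assms(1-3)] coprime_q_p by simp
  show "fixed (generate G {y}) \<noteq> {1}" using assms(5-7) fixed_generate[OF assms(1)] by blast
  show "fixed (generate G {y}) \<noteq> U" by (rule fixed_generate_proper[OF assms(1,2)])
  fix g d assume g: "g \<in> carrier G" and d: "d \<in> generate G {y}"
  obtain i :: nat where i: "d = y [^] i" using d powers_subgroup(1)[OF fin assms(1)] by auto
  have "g \<otimes> d = d \<otimes> g" using commuting_pow[OF assms(1) g] assms(4)[OF g] i by simp
  then have "g \<otimes> d \<otimes> inv g = d" using g assms(1) i by (simp add: m_assoc)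
  then show "g \<otimes> d \<otimes> inv g \<in> generate G {y}" using d by simp
qed

text \<open>Applying w shifts every exponent by one, and the relation on the q-th power of w closes
  the cycle.\<close>

lemma cyclic_norm:
  assumes "w \<in> carrier G" "w [^] q = \<one>" "u \<in> U"
  shows "(\<Prod>i<q. \<phi> (w [^] i) u) \<in> U" "\<phi> w (\<Prod>i<q. \<phi> (w [^] i) u) = (\<Prod>i<q. \<phi> (w [^] i) u)"
proof -
  have cl: "\<phi> (w [^] i) u \<in> U" for i :: nat using act_D(3) assms(1,3) by simp
  show "(\<Prod>i<q. \<phi> (w [^] i) u) \<in> U" by (rule exp_group_prod[OF U cl])
  have "\<phi> w (\<Prod>i<q. \<phi> (w [^] i) u) = (\<Prod>i<q. \<phi> w (\<phi> (w [^] i) u))"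
    by (rule act_prod[OF assms(1) cl])
  also have "\<dots> = (\<Prod>i<q. \<phi> (w [^] Suc i) u)"
  proof (rule prod.cong[OF refl])
    fix i
    have "w \<otimes> w [^] i = w [^] Suc i" using assms(1) nat_pow_Suc2 by simp
    then show "\<phi> w (\<phi> (w [^] i) u) = \<phi> (w [^] Suc i) u"
      using act_D(4)[of w "w [^] i" u] assms(1,3) by simp
  qed
  finally have e: "\<phi> w (\<Prod>i<q. \<phi> (w [^] i) u) = (\<Prod>i<q. \<phi> (w [^] Suc i) u)" .
  have "u * (\<Prod>i<q. \<phi> (w [^] Suc i) u) = (\<Prod>i<Suc q. \<phi> (w [^] i) u)"
    unfolding prod.lessThan_Suc_shift using act_D(2)[OF assms(3)] by simp
  also have "\<dots> = u * (\<Prod>i<q. \<phi> (w [^] i) u)"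
    using assms(2) act_D(2)[OF assms(3)] by (simp add: mult.commute)
  finally show "\<phi> w (\<Prod>i<q. \<phi> (w [^] i) u) = (\<Prod>i<q. \<phi> (w [^] i) u)"
    using exp_group_cancel[OF U assms(3) p_pos] e by simp
qed

text \<open>Multiply the norms of \<open>u\<close> over the subgroups \<open>\<langle>x z\<^sup>j\<rangle>\<close>: all factors except the \<open>q\<close> copies of
  \<open>u\<close> itself regroup into norms for powers of \<open>z\<close>, which are trivial.\<close>

lemma exists_fixed_point_twist:
  assumes z: "z \<in> carrier G" "z [^] q = \<one>" and x: "x \<in> carrier G" "x [^] q = \<one>" and zx: "z \<otimes> x = x \<otimes> z"
    and fpf: "\<And>u i. u \<in> U \<Longrightarrow> z [^] (i::nat) \<noteq> \<one> \<Longrightarrow> \<phi> (z [^] i) u = u \<Longrightarrow> u = 1"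
    and z1: "z \<noteq> \<one>" and u: "u \<in> U" "u \<noteq> 1"
  shows "\<exists>j::nat. \<exists>v \<in> U. v \<noteq> 1 \<and> \<phi> (z [^] j \<otimes> x) v = v"
proof (rule ccontr)
  assume H: "\<not> ?thesis"
  have zq: "ord z = q" using card_generate_q[OF z(1) z1 z(2)] powers_subgroup(3)[OF fin z(1)] by simp
  have zi: "z [^] i \<in> carrier G" "(z [^] i) [^] q = \<one>" for i :: nat
    using z by (simp_all add: nat_pow_pow mult.commute[of i]) (simp add: nat_pow_pow[symmetric])
  have comm: "z [^] j \<otimes> x = x \<otimes> z [^] j" for j :: nat by (rule commuting_pow[OF z(1) x(1) zx])
  have yq: "(z [^] j \<otimes> x) [^] q = \<one>" for j :: nat
    using pow_mult_distrib[OF comm zi(1) x(1)] zi(2) x(2) by simp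
  \<comment> \<open>The norm for \<open>z [^] j \<otimes> x\<close> is a fixed point of that
    element, so it is 1 by the assumption to be refuted.\<close>
  have norm1: "(\<Prod>i<q. \<phi> ((z [^] j \<otimes> x) [^] i) u) = 1" for j :: nat
    using cyclic_norm[OF _ yq u(1)] H z x by (metis m_closed nat_pow_closed)
  \<comment> \<open>Evaluate one double product in two ways: for fixed j the product over i is
    trivial by \<open>norm1\<close>, and for fixed i > 0 the product over j is trivial by
    \<open>fpf\<close>. Only i = 0 survives, giving the q-th power of u.\<close>
  have "1 = (\<Prod>j<q. \<Prod>i<q. \<phi> ((z [^] j \<otimes> x) [^] i) u)" using norm1 by simp
  also have "\<dots> = (\<Prod>i<q. \<Prod>j<q. \<phi> ((z [^] j \<otimes> x) [^] i) u)" by (rule prod.swap)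
  also have "\<dots> = (\<Prod>i<q. if i = 0 then u ^ q else 1)"
  proof (rule prod.cong[OF refl])
    fix i assume i: "i \<in> {..<q}"
    show "(\<Prod>j<q. \<phi> ((z [^] j \<otimes> x) [^] i) u) = (if i = 0 then u ^ q else 1)"
    proof (cases "i = 0")
      case True
      then show ?thesis using act_D(2)[OF u(1)] by simp
    next
      case False
      then have "\<not> q dvd i" using i by (auto dest: dvd_imp_le)
      then have nz: "z [^] i \<noteq> \<one>" using pow_eq_id[OF z(1)] zq by simp
      have xi: "x [^] i \<in> carrier G" using x by simp
      have "\<phi> ((z [^] j \<otimes> x) [^] i) u = \<phi> (x [^] i) (\<phi> ((z [^] i) [^] j) u)" for j :: nat
      proof -
        have "(z [^] j \<otimes> x) [^] i = x [^] i \<otimes> (z [^] j) [^] i"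
          unfolding comm by (rule pow_mult_distrib[OF comm[symmetric] x(1) zi(1)])
        also have "(z [^] j) [^] i = (z [^] i) [^] j" using z by (simp add: nat_pow_pow mult.commute)
        finally show ?thesis using act_D(4)[OF xi _ u(1)] zi(1) by simp
      qed
      then have "(\<Prod>j<q. \<phi> ((z [^] j \<otimes> x) [^] i) u) = (\<Prod>j<q. \<phi> (x [^] i) (\<phi> ((z [^] i) [^] j) u))" by simp
      also have "\<dots> = \<phi> (x [^] i) (\<Prod>j<q. \<phi> ((z [^] i) [^] j) u)"
        using act_D(3) u(1) zi by (intro act_prod[OF xi, symmetric]) simp
      also have "(\<Prod>j<q. \<phi> ((z [^] i) [^] j) u) = 1"
        using cyclic_norm[OF zi(1) zi(2) u(1)] fpf[OF _ nz] by blast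
      finally show ?thesis using act_one[OF xi] False by simp
    qed
  qed
  also have "\<dots> = u ^ q" using q_gt by (simp add: prod.delta)
  finally have uq: "u ^ q = 1" ..
  obtain m where m: "q * m mod p = Suc 0" by (rule inverse_mod[OF coprime_q_p])
  have "u = 1" using exp_group_coprime_root[OF U u(1) m] uq by simp
  then show False using u(2) by simp
qed

lemma exists_nontrivial:
  assumes "z \<in> carrier G" "z \<noteq> \<one>" obtains u where "u \<in> U" "u \<noteq> 1"
proof -
  have "U \<noteq> {1}"
  proof
    assume "U = {1}"
    then have "kern (carrier G) \<phi> U = carrier G" using act_one by (auto simp: kern_def)
    then show False using faithful assms by auto
  qed
  then show thesis using that U_D(2) by blast
qed

text \<open>If z moves every u other than 1, the stabilizer S of such a u meets A trivially, because
  each nontrivial element of A has z among its powers. Hence |S| |A| <= |G|. Moreover S acts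
  faithfully on A by conjugation, which gives |S| < |A| and so |S|^2 < |G|.\<close>

lemma large_orbit_cyclic:
  assumes cyclic: "z \<in> carrier G" "z \<noteq> \<one>" "z [^] q = \<one>" "\<And>g. g \<in> carrier G \<Longrightarrow> g \<otimes> z = z \<otimes> g"
      "subgroup A G" "a \<in> A" "\<And>g. g \<in> carrier G \<Longrightarrow> g \<otimes> a \<otimes> inv g \<in> A"
      "\<And>g. g \<in> carrier G \<Longrightarrow> g \<otimes> a = a \<otimes> g \<Longrightarrow> g \<in> A"
      "a \<noteq> \<one>" "\<And>b. b \<in> A \<Longrightarrow> b \<noteq> \<one> \<Longrightarrow> \<exists>i::nat. z = b [^] i"
  shows "large_orbit q (carrier G) \<phi> U"
proof -
  obtain u0 where u0: "u0 \<in> U" "u0 \<noteq> 1" by (rule exists_nontrivial[OF cyclic(1,2)])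
  show ?thesis
  proof (cases "\<exists>u\<in>U. u \<noteq> 1 \<and> \<phi> z u = u")
    case True
    then show ?thesis using large_orbit_central[OF cyclic(1-4)] by blast
  next
    case fpf: False
    let ?S = "stab (carrier G) \<phi> u0"
    have S: "subgroup ?S G" by (rule subgroup_stab[OF acts u0(1)])
    have SA: "?S \<inter> A = {\<one>}"
    proof (intro equalityI subsetI)
      fix b assume b: "b \<in> ?S \<inter> A"
      then have bc: "b \<in> carrier G" "\<phi> b u0 = u0" by (auto simp: stab_def)
      show "b \<in> {\<one>}"
      proof (rule ccontr)
        assume "b \<notin> {\<one>}"
        then obtain i :: nat where "z = b [^] i" using cyclic(10) b by auto
        then have "\<phi> z u0 = u0" using fixed_powers[OF bc(1) u0(1) bc(2)] by simp
        then show False using fpf u0 by blast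
      qed
    qed (use S cyclic(5) in \<open>auto simp: subgroup.one_closed\<close>)
    have "card ?S * card A \<le> card (carrier G) * card (?S \<inter> A)"
      by (intro card_mult_le_Int fin S cyclic(5) subgroup_self subgroup.subset)
    then have le: "card ?S * card A \<le> card (carrier G)" by (simp add: SA)
    note Ac = subgroup.mem_carrier[OF cyclic(5)]
    have finA: "finite A" by (rule subgroup_finite[OF fin cyclic(5)])
    \<comment> \<open>Two elements of the stabilizer with the same conjugate of \<open>a\<close>
      differ by an element centralizing \<open>a\<close>; such an element lies in A and in the
      stabilizer, hence is the identity.\<close>
    have inj: "inj_on (\<lambda>c. c \<otimes> a \<otimes> inv c) ?S"
    proof (rule inj_onI)
      fix c d assume cd: "c \<in> ?S" "d \<in> ?S" and e: "c \<otimes> a \<otimes> inv c = d \<otimes> a \<otimes> inv d"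
      have c: "c \<in> carrier G" "d \<in> carrier G" "a \<in> carrier G" using cd Ac[OF cyclic(6)] by (auto simp: stab_def)
      have "(inv d \<otimes> c) \<otimes> a = inv d \<otimes> (c \<otimes> a \<otimes> inv c) \<otimes> c" using c by (simp add: m_assoc)
      also have "\<dots> = a \<otimes> (inv d \<otimes> c)" unfolding e using c by (simp add: m_assoc[symmetric])
      finally have "inv d \<otimes> c \<in> A" using cyclic(8)[of "inv d \<otimes> c"] c by simp
      moreover have "inv d \<otimes> c \<in> ?S"
        using cd by (intro subgroup.m_closed[OF S] subgroup.m_inv_closed[OF S])
      ultimately have "inv d \<otimes> c = \<one>" using SA by blast
      then have "d \<otimes> (inv d \<otimes> c) = d" using c by simp
      then show "c = d" using c by (simp add: m_assoc[symmetric])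
    qed
    have "(\<lambda>c. c \<otimes> a \<otimes> inv c) ` ?S \<subseteq> A - {\<one>}"
    proof
      fix w assume "w \<in> (\<lambda>c. c \<otimes> a \<otimes> inv c) ` ?S"
      then obtain c where c: "c \<in> carrier G" "w = c \<otimes> a \<otimes> inv c" by (auto simp: stab_def)
      have "w \<noteq> \<one>"
      proof
        assume "w = \<one>"
        then have "inv c \<otimes> (c \<otimes> a \<otimes> inv c) \<otimes> c = \<one>" using c by simp
        moreover have "inv c \<otimes> (c \<otimes> a \<otimes> inv c) \<otimes> c = a"
          by (rule conj_conj_inv(2)[OF c(1) Ac[OF cyclic(6)]])
        ultimately show False using cyclic(9) by simp
      qed
      then show "w \<in> A - {\<one>}" using cyclic(7)[OF c(1)] c(2) by simp
    qed
    then have "card ?S \<le> card (A - {\<one>})" by (rule card_inj_on_le[OF inj]) (use finA in simp)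
    then have lt: "card ?S < card A"
      using finA subgroup.one_closed[OF cyclic(5)] by (metis card_Diff1_less le_less_trans)
    obtain i where i: "card ?S = q ^ i" by (rule card_subgroup_power[OF S])
    have "card ?S > 0" using i q_gt by simp
    then have "card ?S * card ?S < card ?S * card A" using lt by (simp only: mult_less_cancel1)
    then have "card ?S * card ?S < card (carrier G)" using le by linarith
    \<comment> \<open>A strict inequality between powers of q is one between exponents, and this is
      where the factor q comes from.\<close>
    then have "q ^ (i + i) < q ^ k" using card_G i by (simp add: power_add)
    then have "Suc (i + i) \<le> k" using q_gt by (simp add: power_strict_increasing_iff)
    then have "q ^ Suc (i + i) \<le> q ^ k" using q_gt by (intro power_increasing) auto
    then have "q * (card ?S)\<^sup>2 \<le> card (carrier G)"
      using i card_G by (simp add: power2_eq_square power_add)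
    then show ?thesis by (rule large_orbitI[OF u0(1)])
  qed
qed

text \<open>When z has no nontrivial fixed point, some y outside the powers of z does have one. The
  conjugates of y are products of y with powers of z, and two different ones share no nontrivial
  fixed point. The bound is first proved for the centralizer N of y, which respects the
  decomposition of U under y, and then carried over to G.\<close>

lemma large_orbit_noncyclic:
  assumes noncyclic: "z \<in> carrier G" "z \<noteq> \<one>" "z [^] q = \<one>" "\<And>g. g \<in> carrier G \<Longrightarrow> g \<otimes> z = z \<otimes> g"
      "x \<in> carrier G" "x [^] q = \<one>" "\<And>i::nat. x \<noteq> z [^] i"
      "\<And>g. g \<in> carrier G \<Longrightarrow> \<exists>i::nat. g \<otimes> x \<otimes> inv g = z [^] i \<otimes> x"
  shows "large_orbit q (carrier G) \<phi> U"
proof -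
  obtain u0 where u0: "u0 \<in> U" "u0 \<noteq> 1" by (rule exists_nontrivial[OF noncyclic(1,2)])
  note z = noncyclic(1-4)
  show ?thesis
  proof (cases "\<exists>u\<in>U. u \<noteq> 1 \<and> \<phi> z u = u")
    case True
    then show ?thesis using large_orbit_central[OF z] by blast
  next
    case fz: False
    have zq: "ord z = q ^ 1"
      using card_generate_q[OF z(1-3)] powers_subgroup(3)[OF fin z(1)] by simp
    have zi: "z [^] i \<in> generate G {z}" for i :: nat
      using powers_subgroup(1)[OF fin z(1)] by auto
    \<comment> \<open>Each nontrivial power of \<open>z\<close> has \<open>z\<close> among its own
      powers, so it fixes no more points than \<open>z\<close> does.\<close>
    have fpf: "u = 1" if u: "u \<in> U" "z [^] i \<noteq> \<one>" "\<phi> (z [^] i) u = u" for u and i :: nat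
    proof -
      have "\<exists>l::nat. z = (z [^] i) [^] l"
        by (rule cyclic_prime_power_socle[OF fin z(1) q(1) zq zi u(2) _ z(3)]) (simp add: generate.incl)
      then obtain l :: nat where l: "z = (z [^] i) [^] l" by blast
      have "\<phi> ((z [^] i) [^] l) u = u" by (rule fixed_powers[OF _ u(1,3)]) (use z(1) in simp)
      then have "\<phi> z u = u" by (simp only: l[symmetric])
      then show ?thesis using fz u(1) by blast
    qed
    have zx: "z \<otimes> x = x \<otimes> z" using z(4)[OF noncyclic(5)] by simp
    have "\<exists>j::nat. \<exists>v\<in>U. v \<noteq> 1 \<and> \<phi> (z [^] j \<otimes> x) v = v"
      by (rule exists_fixed_point_twist[OF z(1,3) noncyclic(5,6) zx fpf z(2) u0])
    then obtain j :: nat and v0 where v0: "v0 \<in> U" "v0 \<noteq> 1" "\<phi> (z [^] j \<otimes> x) v0 = v0"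
      by blast
    define y where "y = z [^] j \<otimes> x"
    have yc: "y \<in> carrier G" using z noncyclic by (simp add: y_def)
    have yq: "y [^] q = \<one>"
    proof -
      have "z [^] j \<otimes> x = x \<otimes> z [^] j" by (rule commuting_pow[OF z(1) noncyclic(5) zx])
      then have "y [^] q = (z [^] j) [^] q \<otimes> x [^] q"
        unfolding y_def using z(1) noncyclic(5) by (intro pow_mult_distrib) auto
      also have "(z [^] j) [^] q = (z [^] q) [^] j" using z(1) by (simp add: nat_pow_pow mult.commute)
      finally show ?thesis using z(3) noncyclic(6) by simp
    qed
    have yz: "y \<noteq> z [^] i" for i :: nat
    proof
      assume e: "y = z [^] i"
      have "x = inv (z [^] j) \<otimes> y" using z(1) noncyclic(5) by (simp add: y_def m_assoc[symmetric])
      moreover have "inv (z [^] j) \<otimes> y \<in> generate G {z}"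
        unfolding e by (intro subgroup.m_closed subgroup.m_inv_closed powers_subgroup(2) fin z(1) zi)
      ultimately have "x \<in> generate G {z}" by (simp only:)
      then show False using noncyclic(7) powers_subgroup(1)[OF fin z(1)] by auto
    qed
    have y1: "y \<noteq> \<one>" using yz[of 0] by simp
    have yconj: "\<exists>i::nat. g \<otimes> y \<otimes> inv g = z [^] i \<otimes> y" if g: "g \<in> carrier G" for g
    proof -
      obtain i :: nat where i: "g \<otimes> x \<otimes> inv g = z [^] i \<otimes> x" using noncyclic(8)[OF g] by blast
      have "g \<otimes> z [^] j \<otimes> inv g = z [^] j"
        using commuting_pow[OF z(1) g z(4)[OF g, symmetric], of j] conj_fix_iff[OF g, of "z [^] j"] z(1) by simp
      then have "g \<otimes> y \<otimes> inv g = z [^] j \<otimes> (z [^] i \<otimes> x)"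
        using conj_mult[OF g _ noncyclic(5), of "z [^] j"] z(1) i by (simp add: y_def)
      also have "\<dots> = z [^] i \<otimes> y"
        using z(1) noncyclic(5) nat_pow_comm[of z j i] by (simp add: y_def m_assoc[symmetric])
      finally show ?thesis by blast
    qed
    \<comment> \<open>The centralizer of \<open>y\<close>, written as a stabilizer so that orbit
      counting applies to the conjugacy class.\<close>
    let ?N = "stab (carrier G) (\<lambda>g h. g \<otimes> h \<otimes> inv g) y"
    have conj_acts: "acts G (carrier G) (\<lambda>g h. g \<otimes> h \<otimes> inv g) (carrier G)"
      using subgroup_self conj_conj by (auto simp: acts_def)
    have N: "subgroup ?N G" by (rule subgroup_stab[OF conj_acts yc])
    have Nc: "g \<in> carrier G" "g \<otimes> y \<otimes> inv g = y" if "g \<in> ?N" for g using that by (auto simp: stab_def)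
    show ?thesis
    proof (cases "?N = carrier G")
      case True
      have "g \<otimes> y = y \<otimes> g" if "g \<in> carrier G" for g
        using Nc(2)[of g] True that conj_fix_iff[OF that yc] by blast
      then show ?thesis using large_orbit_central[OF yc y1 yq] v0 by (simp add: y_def)
    next
      case False
      have qN: "q * card ?N \<le> card (carrier G)" by (rule card_psubgroup_le[OF N False])
      let ?D = "generate G {y}"
      have D: "subgroup ?D G" by (rule powers_subgroup(2)[OF fin yc])
      have Dp: "coprime (card ?D) p" using card_generate_q[OF yc y1 yq] coprime_q_p by simp
      have ND: "g \<otimes> d \<otimes> inv g \<in> ?D" if g: "g \<in> ?N" and d: "d \<in> ?D" for g d
      proof -
        obtain i :: nat where i: "d = y [^] i" using d powers_subgroup(1)[OF fin yc] by auto
        show ?thesis using conj_pow[OF Nc(1)[OF g] yc] Nc(2)[OF g] d i by simp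
      qed
      have fD: "fixed ?D = {u \<in> U. \<phi> y u = u}" by (rule fixed_generate[OF yc])
      have v0D: "v0 \<in> fixed ?D" using fD v0 by (simp add: y_def)
      let ?K = "kern ?N \<phi> (fixed ?D)"
      obtain v w where vw: "v \<in> fixed ?D" "v * w \<in> U"
        "?K = ?N \<or> q * (card (stab ?N \<phi> v))\<^sup>2 \<le> card ?N * card ?K"
        "?K = {\<one>} \<or> q * (card (stab ?N \<phi> (v * w)))\<^sup>2 * card ?K \<le> (card (stab ?N \<phi> v))\<^sup>2"
        by (rule nested_orbits[OF N D Dp ND _ fixed_generate_proper[OF yc y1]]) (use v0D v0(2) in auto)
      have zN: "z \<in> ?N" using conj_fix_iff[OF z(1) yc] z(1) z(4)[OF yc] by (simp add: stab_def)
      \<comment> \<open>\<open>z\<close> lies in \<open>?N\<close> but moves \<open>v0\<close>, so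
        the kernel is not all of \<open>?N\<close> and the first estimate holds with its factor
        q.\<close>
      have "z \<notin> ?K" using v0D v0 fz by (auto simp: kern_def)
      then have B: "q * (card (stab ?N \<phi> v))\<^sup>2 \<le> card ?N * card ?K" using vw(3) zN by blast
      have vU: "v \<in> U" and yv: "\<phi> y v = v" using vw(1) fD by auto
      show ?thesis
      proof (cases "?K = {\<one>}")
        case True
        then have B1: "q * (card (stab ?N \<phi> v))\<^sup>2 \<le> card ?N" using B by simp
        have N0: "card ?N > 0" by (rule card_subgroup_pos[OF fin N])
        \<comment> \<open>The identity of U is fixed by all of \<open>?N\<close>, which is
          incompatible with \<open>B1\<close>.\<close>
        have v1: "v \<noteq> 1"
        proof
          assume v: "v = 1"
          have "\<phi> g v = v" if "g \<in> ?N" for g unfolding v by (rule act_one[OF Nc(1)[OF that]])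
          then have "stab ?N \<phi> v = ?N" unfolding stab_def[of ?N \<phi> v] by blast
          then have "q * card ?N * card ?N \<le> 1 * card ?N" using B1 by (simp add: power2_eq_square)
          then have "q * card ?N \<le> 1" using N0 by (simp only: mult_le_cancel2)
          then show False using q_gt N0 by (cases "card ?N") auto
        qed
        \<comment> \<open>If g fixes v, then the conjugate of y by g fixes v along with y. They
          differ by a power of z, which is then trivial, so g centralizes y.\<close>
        have "stab (carrier G) \<phi> v \<subseteq> stab ?N \<phi> v"
        proof
          fix g assume "g \<in> stab (carrier G) \<phi> v"
          then have g: "g \<in> carrier G" "\<phi> g v = v" by (auto simp: stab_def)
          obtain i :: nat where i: "g \<otimes> y \<otimes> inv g = z [^] i \<otimes> y" using yconj[OF g(1)] by blast
          have gi: "\<phi> (inv g) v = v" using acts_inv(1)[OF acts g(1) vU] g(2) by simp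
          have "\<phi> (g \<otimes> y \<otimes> inv g) v = v"
            using act_D(4)[OF _ _ vU] g gi yv yc by simp
          then have "\<phi> (z [^] i) v = v"
            using i act_D(4)[OF _ yc vU, of "z [^] i"] yv z(1) by simp
          then have "z [^] i = \<one>" using fpf[OF vU] v1 by blast
          then show "g \<in> stab ?N \<phi> v" using i g yc by (simp add: stab_def)
        qed
        then have "card (stab (carrier G) \<phi> v) \<le> card (stab ?N \<phi> v)"
          by (rule card_mono[rotated]) (rule rev_finite_subset[OF fin], auto simp: stab_def)
        then have "q * (card (stab (carrier G) \<phi> v))\<^sup>2 \<le> q * (card (stab ?N \<phi> v))\<^sup>2"
          by (intro mult_left_mono power_mono) auto
        also have "\<dots> \<le> card ?N" by (rule B1)
        also have "\<dots> \<le> card (carrier G)" using fin by (intro card_mono) (auto simp: stab_def)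
        finally show ?thesis by (rule large_orbitI[OF vU])
      next
        case K1: False
        let ?A = "card (stab ?N \<phi> (v * w))" and ?E = "card (stab (carrier G) \<phi> (v * w))"
        have K0: "card ?K > 0"
        proof -
          have "finite ?K" using fin by (rule rev_finite_subset) (auto simp: kern_def stab_def)
          moreover have "\<one> \<in> ?K" using subgroup.one_closed[OF N] act_D(2) by (auto simp: kern_def fixed_points_def)
          ultimately show ?thesis using card_gt_0_iff by blast
        qed
        \<comment> \<open>Both stages gain a factor q inside \<open>?N\<close>. Passing to G costs
          at most q in the stabilizer, so at most its square in the estimate, and the remaining
          factor q comes from \<open>qN\<close>.\<close>
        have "q * (q * ?A\<^sup>2 * card ?K) \<le> q * (card (stab ?N \<phi> v))\<^sup>2" using vw(4) K1 by simp
        also have "\<dots> \<le> card ?N * card ?K" by (rule B)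
        finally have "(q * q * ?A\<^sup>2) * card ?K \<le> card ?N * card ?K" by (simp add: mult_ac)
        then have qqA: "q * q * ?A\<^sup>2 \<le> card ?N" using K0 by simp
        \<comment> \<open>The conjugacy class of \<open>y\<close> lies in a translate of the group
          of order q generated by \<open>z\<close>, so the index of \<open>?N\<close> is at most
          q.\<close>
        have "card (carrier G) = card ((\<lambda>g. g \<otimes> y \<otimes> inv g) ` carrier G) * card ?N"
          by (rule orbit_stab[OF conj_acts yc fin])
        also have "card ((\<lambda>g. g \<otimes> y \<otimes> inv g) ` carrier G) \<le> card ((\<lambda>w. w \<otimes> y) ` generate G {z})"
          using yconj zi subgroup_finite[OF fin powers_subgroup(2)[OF fin z(1)]]
          by (intro card_mono image_subsetI) auto
        also have "card ((\<lambda>w. w \<otimes> y) ` generate G {z}) \<le> card (generate G {z})"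
          using subgroup_finite[OF fin powers_subgroup(2)[OF fin z(1)]] by (rule card_image_le)
        also have "\<dots> = q" by (rule card_generate_q[OF z(1-3)])
        finally have Gq: "card (carrier G) \<le> q * card ?N" by simp
        have "?E * card ?N \<le> card (carrier G) * card (stab (carrier G) \<phi> (v * w) \<inter> ?N)"
          by (intro card_mult_le_Int fin subgroup_stab[OF acts vw(2)] N subgroup_self) (auto simp: stab_def)
        also have "stab (carrier G) \<phi> (v * w) \<inter> ?N = stab ?N \<phi> (v * w)" by (auto simp: stab_def)
        also have "card (carrier G) * ?A \<le> (q * card ?N) * ?A" using Gq by (rule mult_right_mono) simp
        finally have "?E * card ?N \<le> (q * ?A) * card ?N" by (simp add: mult_ac)
        moreover have "card ?N > 0" by (rule card_subgroup_pos[OF fin N])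
        ultimately have "?E \<le> q * ?A" by simp
        then have "q * ?E\<^sup>2 \<le> q * (q * ?A)\<^sup>2" by (intro mult_left_mono power_mono) auto
        also have "\<dots> = q * (q * q * ?A\<^sup>2)" by (simp add: power2_eq_square mult_ac)
        also have "\<dots> \<le> q * card ?N" using qqA by (rule mult_left_mono) simp
        also have "\<dots> \<le> card (carrier G)" by (rule qN)
        finally show ?thesis by (rule large_orbitI[OF vw(2)])
      qed
    qed
  qed
qed

lemma large_orbit_step: "large_orbit q (carrier G) \<phi> U"
proof (cases "carrier G = {\<one>}")
  case True
  then show ?thesis using faithful U_D(2) by (auto simp: large_orbit_def)
next
  case False
  show ?thesis
    by (rule prime_power_group_cases[OF fin q(1) card_G False])
      (fact large_orbit_cyclic, fact large_orbit_noncyclic)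
qed

end

section \<open>Reduction to faithful actions\<close>

definition perm_group :: "('w \<Rightarrow> 'w) monoid" where
  "perm_group = \<lparr>carrier = {f. bij f}, monoid.mult = (\<circ>), one = id\<rparr>"

lemma perm_group_simps:
  "carrier perm_group = {f. bij f}" "f \<otimes>\<^bsub>perm_group\<^esub> g = f \<circ> g" "\<one>\<^bsub>perm_group\<^esub> = id"
  by (simp_all add: perm_group_def)

lemma group_perm_group: "group (perm_group :: ('w \<Rightarrow> 'w) monoid)"
proof (rule groupI)
  fix f :: "'w \<Rightarrow> 'w" assume "f \<in> carrier perm_group"
  then have "the_inv f \<circ> f = id" "bij (the_inv f)"
    by (auto simp: perm_group_simps fun_eq_iff bij_is_inj the_inv_f_f bij_betw_the_inv_into)
  then show "\<exists>g\<in>carrier perm_group. g \<otimes>\<^bsub>perm_group\<^esub> f = \<one>\<^bsub>perm_group\<^esub>"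
    by (auto simp: perm_group_simps)
qed (auto simp: perm_group_simps bij_comp comp_assoc)

context aut_action
begin

text \<open>Factoring out the kernel would change the type of the group elements, which an induction
  cannot do. Permutations of the ambient type serve at every stage; the identity off U makes the map
  bijective on the whole type.\<close>

definition image_perm :: "'a \<Rightarrow> 'w \<Rightarrow> 'w" where
  "image_perm g = (\<lambda>u. if u \<in> U then \<phi> g u else u)"

lemma image_perm_mult:
  "g \<in> carrier G \<Longrightarrow> h \<in> carrier G \<Longrightarrow> image_perm (g \<otimes> h) = image_perm g \<circ> image_perm h"
  using act_D(3,4) by (auto simp: image_perm_def fun_eq_iff)

lemma image_perm_one: "image_perm \<one> = id"
  using act_D(2) by (auto simp: image_perm_def fun_eq_iff)

lemma bij_image_perm: assumes "g \<in> carrier G" shows "bij (image_perm g)"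
proof (rule o_bij)
  show "image_perm (inv g) \<circ> image_perm g = id" "image_perm g \<circ> image_perm (inv g) = id"
    using image_perm_mult[of "inv g" g] image_perm_mult[of g "inv g"] assms by (simp_all add: image_perm_one)
qed

lemma image_perm_hom: "group_hom G perm_group image_perm"
proof (intro group_hom.intro group_hom_axioms.intro homI)
  show "group G" by (rule group_axioms)
  show "group (perm_group :: ('w \<Rightarrow> 'w) monoid)" by (rule group_perm_group)
qed (simp_all add: perm_group_simps bij_image_perm image_perm_mult)

lemma subgroup_image_perm: "subgroup (image_perm ` carrier G) perm_group"
  using group_hom.img_is_subgroup[OF image_perm_hom] .

text \<open>The fibres in S are cosets of the kernel. The lemma is applied to the whole group and to
  stabilizers.\<close>

lemma card_image_perm:
  assumes "S \<subseteq> carrier G" "\<And>g h. g \<in> S \<Longrightarrow> h \<in> kern (carrier G) \<phi> U \<Longrightarrow> g \<otimes> h \<in> S"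
  shows "card S = card (image_perm ` S) * card (kern (carrier G) \<phi> U)"
proof (rule card_eq_mult_fibers)
  show "finite S" using assms(1) fin finite_subset by blast
  fix y assume "y \<in> image_perm ` S"
  then obtain g where g: "g \<in> S" "y = image_perm g" by blast
  have gc: "g \<in> carrier G" using g assms(1) by blast
  have "{h \<in> S. image_perm h = y} = (\<lambda>h. g \<otimes> h) ` kern (carrier G) \<phi> U"
  proof (intro equalityI subsetI)
    fix h assume "h \<in> {h \<in> S. image_perm h = y}"
    then have h: "h \<in> carrier G" "image_perm h = image_perm g" using assms(1) g by auto
    have "image_perm (inv g \<otimes> h) = image_perm (inv g \<otimes> g)"
      using image_perm_mult[of "inv g" h] image_perm_mult[of "inv g" g] h gc by simp
    then have "image_perm (inv g \<otimes> h) = id" using gc image_perm_one by simp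
    then have "\<phi> (inv g \<otimes> h) u = u" if "u \<in> U" for u
      using that by (auto simp: image_perm_def fun_eq_iff split: if_splits)
    then have "inv g \<otimes> h \<in> kern (carrier G) \<phi> U" using gc h by (simp add: kern_def)
    moreover have "h = g \<otimes> (inv g \<otimes> h)" using gc h by (simp add: m_assoc[symmetric])
    ultimately show "h \<in> (\<lambda>h. g \<otimes> h) ` kern (carrier G) \<phi> U" by (rule rev_image_eqI)
  next
    fix w assume "w \<in> (\<lambda>h. g \<otimes> h) ` kern (carrier G) \<phi> U"
    then obtain h where h: "h \<in> kern (carrier G) \<phi> U" "w = g \<otimes> h" by blast
    then have hc: "h \<in> carrier G" by (simp add: kern_def)
    have "image_perm h = id" using h(1) by (auto simp: image_perm_def kern_def fun_eq_iff)
    then have "image_perm w = image_perm g" using image_perm_mult[OF gc hc] h(2) by simp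
    then show "w \<in> {h \<in> S. image_perm h = y}" using assms(2)[OF g(1) h(1)] h(2) g(2) by simp
  qed
  moreover have "inj_on (\<lambda>h. g \<otimes> h) (kern (carrier G) \<phi> U)"
    using gc by (auto simp: inj_on_def kern_def)
  ultimately show "card {h \<in> S. image_perm h = y} = card (kern (carrier G) \<phi> U)"
    by (simp add: card_image)
qed

lemma kern_image_perm: "kern (image_perm ` carrier G) (\<lambda>f. f) U = {id}"
proof (intro equalityI subsetI)
  fix f assume "f \<in> kern (image_perm ` carrier G) (\<lambda>f. f) U"
  then obtain g where g: "f = image_perm g" "\<forall>u\<in>U. f u = u" by (auto simp: kern_def)
  then have "f u = u" for u by (cases "u \<in> U") (auto simp: image_perm_def)
  then show "f \<in> {id}" by (simp add: fun_eq_iff)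
next
  fix f :: "'w \<Rightarrow> 'w" assume "f \<in> {id}"
  then show "f \<in> kern (image_perm ` carrier G) (\<lambda>f. f) U"
    using image_perm_one by (auto simp: kern_def image_iff intro!: bexI[of _ \<one>])
qed

text \<open>The orders of the group and of the stabilizer both grow by the kernel order. After
  squaring, the left side gains one factor more than |G| absorbs, and this is the kernel factor in
  \<open>large_orbit\<close>.\<close>

lemma large_orbit_transfer:
  assumes "large_orbit q (image_perm ` carrier G) (\<lambda>f. f) U"
  shows "large_orbit q (carrier G) \<phi> U"
proof -
  let ?R = "image_perm ` carrier G" and ?K = "kern (carrier G) \<phi> U"
  obtain u where u: "u \<in> U" "?R = {id} \<or> q * (card (stab ?R (\<lambda>f. f) u))\<^sup>2 \<le> card ?R"
    using assms by (auto simp: large_orbit_def kern_image_perm)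
  have G: "card (carrier G) = card ?R * card ?K"
    by (rule card_image_perm) (auto simp: kern_def)
  have S: "card (stab (carrier G) \<phi> u) = card (image_perm ` stab (carrier G) \<phi> u) * card ?K"
    using act_D(4) u(1) by (intro card_image_perm) (auto simp: stab_def kern_def)
  have S': "image_perm ` stab (carrier G) \<phi> u = stab ?R (\<lambda>f. f) u"
    using u(1) by (auto simp: stab_def image_perm_def)
  show ?thesis
  proof (cases "?R = {id}")
    case True
    have "\<phi> g u = u" if g: "g \<in> carrier G" and u: "u \<in> U" for g u
    proof -
      have "image_perm g = id" using True g by blast
      then have "image_perm g u = u" by simp
      then show ?thesis using u by (simp add: image_perm_def)
    qed
    then have "?K = carrier G" unfolding kern_def by blast
    then show ?thesis using u(1) by (auto simp: large_orbit_def)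
  next
    case False
    then have "q * (card (stab ?R (\<lambda>f. f) u))\<^sup>2 \<le> card ?R" using u(2) by blast
    then have "q * (card (stab ?R (\<lambda>f. f) u))\<^sup>2 * (card ?K)\<^sup>2 \<le> card ?R * (card ?K)\<^sup>2" by (rule mult_right_mono) simp
    then have "q * (card (stab (carrier G) \<phi> u))\<^sup>2 \<le> card (carrier G) * card ?K"
      by (simp add: S S' G power2_eq_square mult_ac)
    then show ?thesis using u(1) by (auto simp: large_orbit_def)
  qed
qed

end

lemma acts_carrier_update: "acts (G\<lparr>carrier := C\<rparr>) R \<phi> X \<longleftrightarrow> subgroup R (G\<lparr>carrier := C\<rparr>) \<and>
    (\<forall>x \<in> X. \<phi> \<one>\<^bsub>G\<^esub> x = x \<and> (\<forall>g \<in> R. \<phi> g x \<in> X \<and> (\<forall>h \<in> R. \<phi> (g \<otimes>\<^bsub>G\<^esub> h) x = \<phi> g (\<phi> h x))))"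
  by (simp add: acts_def)

lemma (in aut_action) aut_action_restrict:
  assumes "subgroup N G" "exp_group p V" "acts G N \<phi> V" "V \<subseteq> U"
  shows "aut_action (G\<lparr>carrier := N\<rparr>) \<phi> V p"
proof -
  interpret N: group "G\<lparr>carrier := N\<rparr>" using assms(1) by (rule subgroup_imp_group)
  show ?thesis
  proof
    show "finite (carrier (G\<lparr>carrier := N\<rparr>))" using subgroup_finite[OF fin assms(1)] by simp
    show "acts (G\<lparr>carrier := N\<rparr>) (carrier (G\<lparr>carrier := N\<rparr>)) \<phi> V"
      unfolding acts_carrier_update
    proof (intro conjI ballI)
      show "subgroup (carrier (G\<lparr>carrier := N\<rparr>)) (G\<lparr>carrier := N\<rparr>)" by (rule N.subgroup_self)
    qed (simp_all add: actsD(2-4)[OF assms(3)])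
    fix g x y assume g: "g \<in> carrier (G\<lparr>carrier := N\<rparr>)" and xy: "x \<in> V" "y \<in> V"
    have "g \<in> carrier G" using g subgroup.mem_carrier[OF assms(1)] by simp
    then show "\<phi> g (x * y) = \<phi> g x * \<phi> g y" using hom xy assms(4) by blast
  qed (simp_all add: assms p)
qed

lemma (in aut_action) image_perm_action:
  "aut_action (perm_group\<lparr>carrier := image_perm ` carrier G\<rparr>) (\<lambda>f. f) U p"
proof -
  let ?R = "image_perm ` carrier G"
  interpret P: group "perm_group :: ('w \<Rightarrow> 'w) monoid" by (rule group_perm_group)
  interpret R: group "perm_group\<lparr>carrier := ?R\<rparr>" using subgroup_image_perm by (rule P.subgroup_imp_group)
  show ?thesis
  proof
    show "acts (perm_group\<lparr>carrier := ?R\<rparr>) (carrier (perm_group\<lparr>carrier := ?R\<rparr>)) (\<lambda>f. f) U"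
      unfolding acts_carrier_update
    proof (intro conjI ballI)
      show "subgroup (carrier (perm_group\<lparr>carrier := ?R\<rparr>)) (perm_group\<lparr>carrier := ?R\<rparr>)" by (rule R.subgroup_self)
      fix f x assume "x \<in> U" "f \<in> carrier (perm_group\<lparr>carrier := ?R\<rparr>)"
      then show "f x \<in> U" using act_D(3) by (auto simp: image_perm_def)
    qed (simp_all add: perm_group_simps)
    fix f x y assume f: "f \<in> carrier (perm_group\<lparr>carrier := ?R\<rparr>)" and xy: "x \<in> U" "y \<in> U"
    obtain g where "g \<in> carrier G" "f = image_perm g" using f by auto
    then show "f (x * y) = f x * f y" using xy hom U_D(3) by (simp add: image_perm_def)
  qed (simp_all add: fin U p)
qed

text \<open>Induction on |U| over all faithful permutation groups at once. The subgroups occurring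
  in \<open>q_action\<close> need not be faithful on V; their images on V are, and the bound
  transfers back.\<close>

lemma large_orbit_perm:
  fixes U :: "'w::comm_monoid_mult set"
  assumes "aut_action (perm_group\<lparr>carrier := R\<rparr>) (\<lambda>f. f) U p" "subgroup R perm_group"
    and "prime q" "q \<noteq> p" "card R = q ^ k" "kern R (\<lambda>f. f) U = {id}"
  shows "large_orbit q R (\<lambda>f. f) U"
  using assms(1,2,5,6)
proof (induction "card U" arbitrary: U R k rule: less_induct)
  case (less U R k)
  interpret R: aut_action "perm_group\<lparr>carrier := R\<rparr>" "\<lambda>f. f" U p by (rule less.prems(1))
  interpret P: group "perm_group :: ('w \<Rightarrow> 'w) monoid" by (rule group_perm_group)
  interpret q_action "perm_group\<lparr>carrier := R\<rparr>" "\<lambda>f. f" U p q k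
  proof
    show "prime q" "q \<noteq> p" by (rule assms)+
    show "card (carrier (perm_group\<lparr>carrier := R\<rparr>)) = q ^ k" using less.prems(3) by simp
    show "kern (carrier (perm_group\<lparr>carrier := R\<rparr>)) (\<lambda>f. f) U = {\<one>\<^bsub>perm_group\<lparr>carrier := R\<rparr>\<^esub>}"
      using less.prems(4) by (simp add: perm_group_simps)
    fix N and V :: "'w set"
    assume NV: "subgroup N (perm_group\<lparr>carrier := R\<rparr>)" "exp_group p V"
      "acts (perm_group\<lparr>carrier := R\<rparr>) N (\<lambda>f. f) V" "V \<subset> U"
    have NP: "subgroup N perm_group" using P.incl_subgroup[OF less.prems(2) NV(1)] .
    interpret N: aut_action "perm_group\<lparr>carrier := N\<rparr>" "\<lambda>f. f" V p
      using R.aut_action_restrict[OF NV(1-3)] NV(4) by simp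
    let ?R' = "N.image_perm ` carrier (perm_group\<lparr>carrier := N\<rparr>)"
    have "card N dvd q ^ k" 
      using R.card_subgroup_dvd[OF R.fin NV(1) R.subgroup_self] subgroup.subset[OF NV(1)] less.prems(3) by simp
    moreover have "card ?R' dvd card N"
      using N.card_image_perm[of N] by (auto simp: kern_def intro!: dvdI dest: subgroup.m_closed[OF NP])
    ultimately have "card ?R' dvd q ^ k" by (rule dvd_trans[rotated])
    then obtain k' where k': "card ?R' = q ^ k'" using divides_primepow_nat[OF assms(3)] by blast
    have "large_orbit q ?R' (\<lambda>f. f) V"
    proof (rule less.hyps)
      show "card V < card U" using NV(4) R.U_D(1) by (rule psubset_card_mono[rotated])
    qed (rule N.image_perm_action N.subgroup_image_perm k' N.kern_image_perm)+
    from N.large_orbit_transfer[OF this] show "large_orbit q N (\<lambda>f. f) V" by simp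
  qed
  show ?case using large_orbit_step by simp
qed

theorem (in aut_action) large_orbit:
  assumes "prime q" "q \<noteq> p" "card (carrier G) = q ^ k"
  shows "large_orbit q (carrier G) \<phi> U"
proof (rule large_orbit_transfer)
  have "card (image_perm ` carrier G) dvd q ^ k"
    using card_image_perm[of "carrier G"] assms(3) by (auto simp: kern_def)
  then obtain k' where k': "card (image_perm ` carrier G) = q ^ k'" using divides_primepow_nat[OF assms(1)] by blast
  show "large_orbit q (image_perm ` carrier G) (\<lambda>f. f) U"
    by (rule large_orbit_perm[OF image_perm_action subgroup_image_perm assms(1,2) k' kern_image_perm])
qed

section \<open>Representations and traces\<close>

lemma mat_trace_sum: "mat_trace A = (\<Sum>i<dim_row A. A $$ (i, i))"
  by (simp add: mat_trace_def diag_mat_def interv_sum_list_conv_sum_set_nat atLeast0LessThan)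

lemma mat_trace_comm:
  assumes "A \<in> carrier_mat n n" "B \<in> carrier_mat n n"
  shows "mat_trace (A * B) = mat_trace (B * A)"
proof -
  have "mat_trace (A * B) = (\<Sum>i<n. \<Sum>j<n. A $$ (i, j) * B $$ (j, i))"
    using assms by (auto simp: mat_trace_sum scalar_prod_def atLeast0LessThan intro!: sum.cong)
  also have "\<dots> = (\<Sum>j<n. \<Sum>i<n. A $$ (i, j) * B $$ (j, i))" by (rule sum.swap)
  also have "\<dots> = mat_trace (B * A)"
    using assms by (auto simp: mat_trace_sum scalar_prod_def atLeast0LessThan mult.commute intro!: sum.cong)
  finally show ?thesis .
qed

lemma mult_mat_zero_vec: "A \<in> carrier_mat m n \<Longrightarrow> A *\<^sub>v 0\<^sub>v n = 0\<^sub>v m"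
  by (auto intro!: eq_vecI)

lemma mult_mat_unit_vec:
  fixes A :: "complex mat"
  assumes "A \<in> carrier_mat m n" "i < m" "j < n"
  shows "(A *\<^sub>v unit_vec n j) $ i = A $$ (i, j)"
  using assms by (simp add: scalar_prod_right_unit)

lemma carrier_GL: "carrier (GL n) = {A \<in> carrier_mat n n. \<exists>B \<in> carrier_mat n n. B * A = 1\<^sub>m n \<and> A * B = 1\<^sub>m n}"
  by (auto simp: units_of_def Units_def ring_mat_def)

lemma mult_GL: "A \<otimes>\<^bsub>GL n\<^esub> B = A * B"
  by (simp add: units_of_def ring_mat_def)

lemma (in group) representationD:
  assumes "representation G n \<rho>"
  shows "\<And>g. g \<in> carrier G \<Longrightarrow> \<rho> g \<in> carrier_mat n n"
    "\<And>g h. g \<in> carrier G \<Longrightarrow> h \<in> carrier G \<Longrightarrow> \<rho> (g \<otimes> h) = \<rho> g * \<rho> h"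
    "\<rho> \<one> = 1\<^sub>m n"
proof -
  show "\<And>g. g \<in> carrier G \<Longrightarrow> \<rho> g \<in> carrier_mat n n"
    using hom_in_carrier[OF assms] unfolding carrier_GL by blast
  show "\<And>g h. g \<in> carrier G \<Longrightarrow> h \<in> carrier G \<Longrightarrow> \<rho> (g \<otimes> h) = \<rho> g * \<rho> h"
    using hom_mult[OF assms] unfolding mult_GL by blast
  show "\<rho> \<one> = 1\<^sub>m n"
    using hom_one[OF assms is_group group_GL] by (simp only: units_of_one) (simp add: ring_mat_def)
qed

lemma (in group) representationI:
  assumes "\<And>g. g \<in> carrier G \<Longrightarrow> \<rho> g \<in> carrier_mat n n"
    "\<And>g h. g \<in> carrier G \<Longrightarrow> h \<in> carrier G \<Longrightarrow> \<rho> (g \<otimes> h) = \<rho> g * \<rho> h"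
    "\<rho> \<one> = 1\<^sub>m n"
  shows "representation G n \<rho>"
proof (rule homI)
  fix g assume g: "g \<in> carrier G"
  have "\<rho> (inv g) * \<rho> g = 1\<^sub>m n" "\<rho> g * \<rho> (inv g) = 1\<^sub>m n"
    using assms(2)[of "inv g" g] assms(2)[of g "inv g"] assms(3) g by simp_all
  then show "\<rho> g \<in> carrier (GL n)"
    unfolding carrier_GL using assms(1)[OF g] assms(1)[OF inv_closed[OF g]] by blast
qed (simp add: mult_GL assms(2))

lemma subspace_vec_iff:
  "VectorSpace.subspace class_ring W (module_vec TYPE(complex) n) \<longleftrightarrow>
    W \<subseteq> carrier_vec n \<and> 0\<^sub>v n \<in> W \<and> (\<forall>v\<in>W. \<forall>w\<in>W. v + w \<in> W) \<and> (\<forall>c. \<forall>v\<in>W. c \<cdot>\<^sub>v v \<in> W)"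
proof -
  have "vectorspace class_ring (module_vec TYPE(complex) n)" by (rule vec_vs)
  moreover have "Module.module class_ring (module_vec TYPE(complex) n)" by (rule vec_module)
  ultimately show ?thesis
    by (auto simp: VectorSpace.subspace_def submodule_def module_vec_simps)
qed

lemma irreducible_representationD:
  assumes "irreducible_representation G n \<rho>" "W \<subseteq> carrier_vec n" "0\<^sub>v n \<in> W"
    "\<And>v w. v \<in> W \<Longrightarrow> w \<in> W \<Longrightarrow> v + w \<in> W" "\<And>c v. v \<in> W \<Longrightarrow> c \<cdot>\<^sub>v v \<in> W"
    "\<And>g w. g \<in> carrier G \<Longrightarrow> w \<in> W \<Longrightarrow> \<rho> g *\<^sub>v w \<in> W"
  shows "W = {0\<^sub>v n} \<or> W = carrier_vec n"
proof -
  have "VectorSpace.subspace class_ring W (module_vec TYPE(complex) n)"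
    unfolding subspace_vec_iff using assms(2-5) by simp
  then show ?thesis using assms(1,6) unfolding irreducible_representation_def by simp
qed

section \<open>Frobenius reciprocity and Schur's lemma\<close>

context group
begin

lemma trace_conj:
  assumes "representation G n \<rho>" "g \<in> carrier G" "x \<in> carrier G"
  shows "mat_trace (\<rho> (x \<otimes> g \<otimes> inv x)) = mat_trace (\<rho> g)"
proof -
  note r = representationD[OF assms(1)]
  have "mat_trace (\<rho> (x \<otimes> g \<otimes> inv x)) = mat_trace (\<rho> (x \<otimes> g) * \<rho> (inv x))" using r(2) assms by simp
  also have "\<dots> = mat_trace (\<rho> (inv x) * \<rho> (x \<otimes> g))" using r(1) assms by (intro mat_trace_comm) auto
  also have "\<rho> (inv x) * \<rho> (x \<otimes> g) = \<rho> (inv x \<otimes> (x \<otimes> g))" using r(2) assms by simp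
  also have "inv x \<otimes> (x \<otimes> g) = g" using assms by (simp add: m_assoc[symmetric])
  finally show ?thesis .
qed

text \<open>Frobenius reciprocity for the principal character: after exchanging the sums over g and
  x, substitute m for the conjugate of g by x. Each x contributes the same sum over M.\<close>

lemma char_inner_induced_principal:
  assumes "finite (carrier G)" "subgroup M G"
    and cf: "\<And>g x. g \<in> carrier G \<Longrightarrow> x \<in> carrier G \<Longrightarrow> \<chi> (x \<otimes> g \<otimes> inv x) = \<chi> g"
  shows "char_inner G \<chi> (induced G M (principal_character (G\<lparr>carrier := M\<rparr>))) = (\<Sum>m \<in> M. \<chi> m) / of_nat (card M)"
proof -
  note Mc = subgroup.subset[OF assms(2)]
  let ?I = "induced G M (principal_character (G\<lparr>carrier := M\<rparr>))"
  have I: "?I g = (\<Sum>x \<in> carrier G. if x \<otimes> g \<otimes> inv x \<in> M then 1 else 0) / of_nat (card M)" if "g \<in> carrier G" for g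
    using that by (auto simp: induced_def principal_character_def intro!: sum.cong arg_cong[where f = "\<lambda>x. x / _"])
  have "(\<Sum>g \<in> carrier G. \<chi> g * cnj (?I g)) =
      (\<Sum>g \<in> carrier G. \<Sum>x \<in> carrier G. if x \<otimes> g \<otimes> inv x \<in> M then \<chi> g / of_nat (card M) else 0)"
  proof (rule sum.cong[OF refl])
    fix g assume g: "g \<in> carrier G"
    have "\<chi> g * cnj (?I g) = \<chi> g / of_nat (card M) * (\<Sum>x \<in> carrier G. if x \<otimes> g \<otimes> inv x \<in> M then 1 else 0)"
      unfolding I[OF g] by (simp add: if_distrib cong: if_cong)
    also have "\<dots> = (\<Sum>x \<in> carrier G. if x \<otimes> g \<otimes> inv x \<in> M then \<chi> g / of_nat (card M) else 0)"
      unfolding sum_distrib_left by (intro sum.cong) auto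
    finally show "\<chi> g * cnj (?I g) = \<dots>" .
  qed
  also have "\<dots> = (\<Sum>x \<in> carrier G. \<Sum>g \<in> carrier G. if x \<otimes> g \<otimes> inv x \<in> M then \<chi> g / of_nat (card M) else 0)"
    by (rule sum.swap)
  also have "\<dots> = (\<Sum>x \<in> carrier G. (\<Sum>m \<in> M. \<chi> m / of_nat (card M)))"
  proof (rule sum.cong[OF refl])
    fix x assume x: "x \<in> carrier G"
    have "(\<Sum>g \<in> carrier G. if x \<otimes> g \<otimes> inv x \<in> M then \<chi> g / of_nat (card M) else 0)
        = (\<Sum>g \<in> {g \<in> carrier G. x \<otimes> g \<otimes> inv x \<in> M}. \<chi> g / of_nat (card M))"
      using assms(1) by (simp add: sum.inter_filter)
    also have "\<dots> = (\<Sum>m \<in> M. \<chi> m / of_nat (card M))"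
    proof (rule sum.reindex_bij_witness[of _ "\<lambda>m. inv x \<otimes> m \<otimes> x" "\<lambda>g. x \<otimes> g \<otimes> inv x"])
      fix g assume g: "g \<in> {g \<in> carrier G. x \<otimes> g \<otimes> inv x \<in> M}"
      then show "inv x \<otimes> (x \<otimes> g \<otimes> inv x) \<otimes> x = g"
        using x by (simp add: m_assoc) (simp add: m_assoc[symmetric])
      show "\<chi> (x \<otimes> g \<otimes> inv x) / of_nat (card M) = \<chi> g / of_nat (card M)" using cf g x by simp
      show "x \<otimes> g \<otimes> inv x \<in> M" using g by simp
    next
      fix m assume m: "m \<in> M"
      then have mc: "m \<in> carrier G" using Mc by auto
      show e: "x \<otimes> (inv x \<otimes> m \<otimes> x) \<otimes> inv x = m"
        by (rule conj_conj_inv(1)[OF x mc])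
      show "inv x \<otimes> m \<otimes> x \<in> {g \<in> carrier G. x \<otimes> g \<otimes> inv x \<in> M}" using e m mc x by simp
    qed
    finally show "(\<Sum>g \<in> carrier G. if x \<otimes> g \<otimes> inv x \<in> M then \<chi> g / of_nat (card M) else 0) = \<dots>" .
  qed
  also have "\<dots> = of_nat (card (carrier G)) * ((\<Sum>m \<in> M. \<chi> m) / of_nat (card M))"
    by (simp add: sum_divide_distrib)
  finally have "char_inner G \<chi> ?I =
      of_nat (card (carrier G)) * ((\<Sum>m \<in> M. \<chi> m) / of_nat (card M)) / of_nat (card (carrier G))"
    by (simp add: char_inner_def Coset.order_def)
  moreover have "card (carrier G) > 0" using assms(1) one_closed card_gt_0_iff by blast
  ultimately show ?thesis by simp
qed

text \<open>Fixed vectors of \<open>M\<close> are obtained by averaging; they form a subrepresentation as \<open>M\<close> is normal.\<close>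

lemma normal_trivial_of_trace_sum:
  assumes irr: "irreducible_representation G n \<rho>" and fin: "finite (carrier G)"
    and M: "subgroup M G" "\<And>g m. g \<in> carrier G \<Longrightarrow> m \<in> M \<Longrightarrow> g \<otimes> m \<otimes> inv g \<in> M"
    and sum: "(\<Sum>m \<in> M. mat_trace (\<rho> m)) \<noteq> 0" and m: "m \<in> M"
  shows "\<rho> m = 1\<^sub>m n"
proof -
  have rep: "representation G n \<rho>" using irr by (simp add: irreducible_representation_def)
  note r = representationD[OF rep] and Mc = subgroup.mem_carrier[OF M(1)]
  define W where "W = {w \<in> carrier_vec n. \<forall>m \<in> M. \<rho> m *\<^sub>v w = w}"
  have "W = {0\<^sub>v n} \<or> W = carrier_vec n"
  proof (rule irreducible_representationD[OF irr])
    show "W \<subseteq> carrier_vec n" by (auto simp: W_def)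
    show "0\<^sub>v n \<in> W" using mult_mat_zero_vec[OF r(1)[OF Mc]] by (simp add: W_def)
    show "v + w \<in> W" if "v \<in> W" "w \<in> W" for v w
      using that r(1)[OF Mc] by (simp add: W_def mult_add_distrib_mat_vec[of _ n n])
    show "c \<cdot>\<^sub>v v \<in> W" if "v \<in> W" for c v
      using that r(1)[OF Mc] by (simp add: W_def mult_mat_vec[of _ n n])
    show "\<rho> g *\<^sub>v w \<in> W" if g: "g \<in> carrier G" and w: "w \<in> W" for g w
    proof -
      have wc: "w \<in> carrier_vec n" using w by (simp add: W_def)
      have "\<rho> m *\<^sub>v (\<rho> g *\<^sub>v w) = \<rho> g *\<^sub>v w" if m: "m \<in> M" for m
      proof -
        have m': "inv g \<otimes> m \<otimes> g \<in> M" using M(2)[OF inv_closed[OF g] m] g by simp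
        have "\<rho> m * \<rho> g = \<rho> g * \<rho> (inv g \<otimes> m \<otimes> g)"
          using r(2)[OF Mc[OF m] g] r(2)[OF g Mc[OF m']] g Mc[OF m] by (simp add: m_assoc[symmetric])
        then have "\<rho> m *\<^sub>v (\<rho> g *\<^sub>v w) = \<rho> g *\<^sub>v (\<rho> (inv g \<otimes> m \<otimes> g) *\<^sub>v w)"
          using assoc_mult_mat_vec[OF r(1)[OF Mc[OF m]] r(1)[OF g] wc]
            assoc_mult_mat_vec[OF r(1)[OF g] r(1)[OF Mc[OF m']] wc] by simp
        then show ?thesis using w m' by (simp add: W_def)
      qed
      then show ?thesis using r(1)[OF g] wc by (simp add: W_def mult_mat_vec_carrier[of _ n n])
    qed
  qed
  moreover have "W \<noteq> {0\<^sub>v n}"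
  proof
    assume W0: "W = {0\<^sub>v n}"
    have "(\<Sum>m \<in> M. \<rho> m $$ (i, i)) = 0" if i: "i < n" for i
    proof -
      \<comment> \<open>The i-th column of the sum of all matrices over M. It is fixed by M, hence
        zero, so the diagonal entries of that sum vanish.\<close>
      define y where "y = vec n (\<lambda>k. \<Sum>m \<in> M. \<rho> m $$ (k, i))"
      have "\<rho> m' *\<^sub>v y = y" if m': "m' \<in> M" for m'
      proof (rule eq_vecI)
        show "dim_vec (\<rho> m' *\<^sub>v y) = dim_vec y" using r(1)[OF Mc[OF m']] by (simp add: y_def)
        fix k assume "k < dim_vec y" then have k: "k < n" by (simp add: y_def)
        have "(\<rho> m' *\<^sub>v y) $ k = (\<Sum>l<n. \<rho> m' $$ (k, l) * (\<Sum>m \<in> M. \<rho> m $$ (l, i)))"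
          using r(1)[OF Mc[OF m']] k by (simp add: y_def scalar_prod_def atLeast0LessThan)
        also have "\<dots> = (\<Sum>m \<in> M. \<Sum>l<n. \<rho> m' $$ (k, l) * \<rho> m $$ (l, i))"
          unfolding sum_distrib_left by (rule sum.swap)
        also have "\<dots> = (\<Sum>m \<in> M. \<rho> (m' \<otimes> m) $$ (k, i))"
        proof (rule sum.cong[OF refl])
          fix m assume m: "m \<in> M"
          show "(\<Sum>l<n. \<rho> m' $$ (k, l) * \<rho> m $$ (l, i)) = \<rho> (m' \<otimes> m) $$ (k, i)"
            unfolding r(2)[OF Mc[OF m'] Mc[OF m]]
            using r(1)[OF Mc[OF m']] r(1)[OF Mc[OF m]] i k by (simp add: scalar_prod_def atLeast0LessThan)
        qed
        also have "\<dots> = (\<Sum>m \<in> M. \<rho> m $$ (k, i))"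
        proof (rule sum.reindex_bij_witness[of _ "\<lambda>m. inv m' \<otimes> m" "\<lambda>m. m' \<otimes> m"])
          fix m assume m: "m \<in> M"
          show "inv m' \<otimes> (m' \<otimes> m) = m" "m' \<otimes> (inv m' \<otimes> m) = m"
            using Mc[OF m] Mc[OF m'] by (simp_all add: m_assoc[symmetric])
          show "m' \<otimes> m \<in> M" "inv m' \<otimes> m \<in> M"
            using m m' M(1) by (auto intro: subgroup.m_closed subgroup.m_inv_closed)
        qed simp
        finally show "(\<rho> m' *\<^sub>v y) $ k = y $ k" using k by (simp add: y_def)
      qed
      then have "y \<in> W" by (simp add: W_def y_def)
      then have "y $ i = 0" using W0 i by simp
      then show ?thesis using i by (simp add: y_def)
    qed
    then have "(\<Sum>i<n. \<Sum>m \<in> M. \<rho> m $$ (i, i)) = 0" by simp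
    then have "(\<Sum>m \<in> M. \<Sum>i<n. \<rho> m $$ (i, i)) = 0" by (subst sum.swap)
    moreover have "mat_trace (\<rho> m) = (\<Sum>i<n. \<rho> m $$ (i, i))" if "m \<in> M" for m
      using r(1)[OF Mc[OF that]] by (simp add: mat_trace_sum)
    ultimately show False using sum by simp
  qed
  ultimately have W: "W = carrier_vec n" by blast
  show ?thesis
  proof (rule eq_matI)
    show "dim_row (\<rho> m) = dim_row (1\<^sub>m n)" "dim_col (\<rho> m) = dim_col (1\<^sub>m n)" using r(1)[OF Mc[OF m]] by auto
    fix i j assume "i < dim_row (1\<^sub>m n)" "j < dim_col (1\<^sub>m n)"
    then have ij: "i < n" "j < n" by auto
    have "unit_vec n j \<in> W" using W by simp
    then have "\<rho> m *\<^sub>v unit_vec n j = unit_vec n j" using m by (simp add: W_def)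
    then have "(\<rho> m *\<^sub>v unit_vec n j) $ i = unit_vec n j $ i" by simp
    then show "\<rho> m $$ (i, j) = 1\<^sub>m n $$ (i, j)"
      using ij mult_mat_unit_vec[OF r(1)[OF Mc[OF m]] ij] by simp
  qed
qed

text \<open>An eigenvalue exists over the complex numbers, and its eigenspace is invariant because A
  commutes with the representation.\<close>

lemma schur_scalar:
  assumes irr: "irreducible_representation G n \<rho>" and A: "A \<in> carrier_mat n n"
    and comm: "\<And>g. g \<in> carrier G \<Longrightarrow> \<rho> g * A = A * \<rho> g"
  obtains c where "\<And>w. w \<in> carrier_vec n \<Longrightarrow> A *\<^sub>v w = c \<cdot>\<^sub>v w"
proof -
  have rep: "representation G n \<rho>" and n: "n > 0" using irr by (auto simp: irreducible_representation_def)
  note r = representationD[OF rep]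
  obtain c where "c \<in> spectrum A" using spectrum_non_empty[OF A n] by blast
  then obtain v where v: "v \<in> carrier_vec n" "v \<noteq> 0\<^sub>v n" "A *\<^sub>v v = c \<cdot>\<^sub>v v"
    using A by (auto simp: spectrum_def eigenvalue_def eigenvector_def)
  define W where "W = {w \<in> carrier_vec n. A *\<^sub>v w = c \<cdot>\<^sub>v w}"
  have "W = {0\<^sub>v n} \<or> W = carrier_vec n"
  proof (rule irreducible_representationD[OF irr])
    show "W \<subseteq> carrier_vec n" by (auto simp: W_def)
    show "0\<^sub>v n \<in> W" using A by (auto simp: W_def intro!: eq_vecI)
    show "v + w \<in> W" if "v \<in> W" "w \<in> W" for v w
      using that A by (simp add: W_def mult_add_distrib_mat_vec[of _ n n] smult_add_distrib_vec[of _ n])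
    show "d \<cdot>\<^sub>v v \<in> W" if "v \<in> W" for d v
      using that A by (simp add: W_def mult_mat_vec[of _ n n] smult_smult_assoc mult.commute)
    show "\<rho> g *\<^sub>v w \<in> W" if g: "g \<in> carrier G" and w: "w \<in> W" for g w
    proof -
      have wc: "w \<in> carrier_vec n" "A *\<^sub>v w = c \<cdot>\<^sub>v w" using w by (auto simp: W_def)
      have "A *\<^sub>v (\<rho> g *\<^sub>v w) = \<rho> g *\<^sub>v (A *\<^sub>v w)"
        using assoc_mult_mat_vec[OF A r(1)[OF g] wc(1)] assoc_mult_mat_vec[OF r(1)[OF g] A wc(1)] comm[OF g] by simp
      also have "\<dots> = c \<cdot>\<^sub>v (\<rho> g *\<^sub>v w)" using wc r(1)[OF g] by (simp add: mult_mat_vec[of _ n n])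
      finally show ?thesis using wc(1) r(1)[OF g] by (simp add: W_def mult_mat_vec_carrier[of _ n n])
    qed
  qed
  moreover have "v \<in> W" using v by (simp add: W_def)
  ultimately have "W = carrier_vec n" using v(2) by blast
  then show thesis using that by (auto simp: W_def)
qed

text \<open>M acts trivially by \<open>normal_trivial_of_trace_sum\<close>. For x outside M, the
  elements whose matrices commute with that of x form a subgroup containing both M and x, hence
  everything. Applying maximality again, now to the commutant of an arbitrary element, makes all
  matrices commute, and Schur's lemma makes them scalar.\<close>

lemma degree_one_of_normal_maximal:
  assumes irr: "irreducible_representation G n \<rho>" and fin: "finite (carrier G)"
    and max: "maximal_subgroup M G" and nM: "\<And>g m. g \<in> carrier G \<Longrightarrow> m \<in> M \<Longrightarrow> g \<otimes> m \<otimes> inv g \<in> M"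
    and sum: "(\<Sum>m \<in> M. mat_trace (\<rho> m)) \<noteq> 0"
  shows "n = 1"
proof -
  have rep: "representation G n \<rho>" and n: "n > 0" using irr by (auto simp: irreducible_representation_def)
  note r = representationD[OF rep]
  have M: "subgroup M G" "M \<noteq> carrier G" and maxM: "\<And>H. subgroup H G \<Longrightarrow> M \<subseteq> H \<Longrightarrow> H = M \<or> H = carrier G"
    using max by (auto simp: maximal_subgroup_def)
  note triv = normal_trivial_of_trace_sum[OF irr fin M(1) nM sum]
  note Mc = subgroup.mem_carrier[OF M(1)]
  obtain x where x: "x \<in> carrier G" "x \<notin> M" using M subgroup.subset by blast
  have central: "\<rho> g * \<rho> h = \<rho> h * \<rho> g" if g: "g \<in> carrier G" and h: "h \<in> carrier G" for g h
  proof -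
    define C where "C = (\<lambda>h. {g \<in> carrier G. \<rho> g * \<rho> h = \<rho> h * \<rho> g})"
    have C: "subgroup (C h) G" if h: "h \<in> carrier G" for h
    proof (rule subgroupI)
      show "C h \<subseteq> carrier G" by (auto simp: C_def)
      show "C h \<noteq> {}" using h by (auto simp: C_def)
      fix g assume g: "g \<in> C h"
      then have gc: "g \<in> carrier G" "\<rho> (g \<otimes> h) = \<rho> (h \<otimes> g)" using h r(2) by (auto simp: C_def)
      have "\<rho> (inv g \<otimes> h) = \<rho> (inv g \<otimes> (h \<otimes> g) \<otimes> inv g)" using gc(1) h by (simp add: m_assoc)
      also have "\<dots> = \<rho> (inv g) * \<rho> (h \<otimes> g) * \<rho> (inv g)" using gc(1) h r(2) by simp
      also have "\<dots> = \<rho> (inv g) * \<rho> (g \<otimes> h) * \<rho> (inv g)" using gc(2) by simp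
      also have "\<dots> = \<rho> (inv g \<otimes> (g \<otimes> h) \<otimes> inv g)" using gc(1) h r(2) by simp
      also have "inv g \<otimes> (g \<otimes> h) \<otimes> inv g = h \<otimes> inv g" using gc(1) h by (simp add: m_assoc[symmetric])
      finally show "inv g \<in> C h" using gc(1) h r(2) by (simp add: C_def)
      fix k assume k: "k \<in> C h"
      then have kc: "k \<in> carrier G" "\<rho> (k \<otimes> h) = \<rho> (h \<otimes> k)" using h r(2) by (auto simp: C_def)
      have "\<rho> (g \<otimes> k \<otimes> h) = \<rho> g * \<rho> (k \<otimes> h)" using gc(1) kc(1) h r(2) by (simp add: m_assoc)
      also have "\<dots> = \<rho> (g \<otimes> h \<otimes> k)" using gc(1) kc h r(2)[of g "h \<otimes> k"] by (simp add: m_assoc)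
      also have "\<dots> = \<rho> (g \<otimes> h) * \<rho> k" using gc(1) kc(1) h by (intro r(2)) auto
      also have "\<dots> = \<rho> (h \<otimes> g \<otimes> k)" using gc kc(1) h r(2)[of "h \<otimes> g" k] by simp
      finally have "\<rho> (g \<otimes> k \<otimes> h) = \<rho> (h \<otimes> (g \<otimes> k))" using gc(1) kc(1) h by (simp add: m_assoc)
      then show "g \<otimes> k \<in> C h" using gc(1) kc(1) h r(2)[of "g \<otimes> k" h] r(2)[of h "g \<otimes> k"] by (simp add: C_def)
    qed
    have MC: "M \<subseteq> C h" if h: "h \<in> carrier G" for h
      using triv Mc r(1)[OF h] by (auto simp: C_def)
    have "x \<in> C x" using x by (simp add: C_def)
    then have "C x = carrier G" using maxM[OF C[OF x(1)] MC[OF x(1)]] x(2) by blast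
    then have "x \<in> C h" if h: "h \<in> carrier G" for h
    proof -
      have "h \<in> C x" using h \<open>C x = carrier G\<close> by simp
      then show ?thesis using x(1) by (simp add: C_def)
    qed
    then have "C h = carrier G" if h: "h \<in> carrier G" for h using maxM[OF C[OF h] MC[OF h]] x(2) h by blast
    then show ?thesis using g h by (auto simp: C_def)
  qed
  \<comment> \<open>Scalar matrices preserve every line, so irreducibility forces this one to be the
    whole space.\<close>
  define W where "W = {c \<cdot>\<^sub>v unit_vec n 0 | c. c \<in> (UNIV :: complex set)}"
  have u: "unit_vec n 0 \<in> carrier_vec n" "unit_vec n 0 $ 0 = (1::complex)" using n by auto
  have "W = {0\<^sub>v n} \<or> W = carrier_vec n"
  proof (rule irreducible_representationD[OF irr])
    show "W \<subseteq> carrier_vec n" by (auto simp: W_def)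
    have "0\<^sub>v n = (0::complex) \<cdot>\<^sub>v unit_vec n 0" by auto
    then show "0\<^sub>v n \<in> W" unfolding W_def by blast
    show "v + w \<in> W" if vw: "v \<in> W" "w \<in> W" for v w
    proof -
      obtain a b where "v = a \<cdot>\<^sub>v unit_vec n 0" "w = b \<cdot>\<^sub>v unit_vec n 0" using vw by (auto simp: W_def)
      then have "v + w = (a + b) \<cdot>\<^sub>v unit_vec n 0" by (simp add: add_smult_distrib_vec)
      then show ?thesis by (auto simp: W_def)
    qed
    show sm: "c \<cdot>\<^sub>v v \<in> W" if v: "v \<in> W" for c v
    proof -
      obtain a where "v = a \<cdot>\<^sub>v unit_vec n 0" using v by (auto simp: W_def)
      then have "c \<cdot>\<^sub>v v = (c * a) \<cdot>\<^sub>v unit_vec n 0" by (simp add: smult_smult_assoc)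
      then show ?thesis by (auto simp: W_def)
    qed
    show "\<rho> g *\<^sub>v w \<in> W" if g: "g \<in> carrier G" and w: "w \<in> W" for g w
    proof -
      obtain c where c: "\<And>w. w \<in> carrier_vec n \<Longrightarrow> \<rho> g *\<^sub>v w = c \<cdot>\<^sub>v w"
        using schur_scalar[OF irr r(1)[OF g] central[OF _ g]] by blast
      have "w \<in> carrier_vec n" using w by (auto simp: W_def)
      then show ?thesis using c sm[OF w] by simp
    qed
  qed
  moreover have "W \<noteq> {0\<^sub>v n}"
  proof
    assume "W = {0\<^sub>v n}"
    moreover have "(1::complex) \<cdot>\<^sub>v unit_vec n 0 \<in> W" unfolding W_def by blast
    ultimately have "unit_vec n 0 = (0\<^sub>v n :: complex vec)" by simp
    then show False using u n by (metis index_zero_vec(1) zero_neq_one)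
  qed
  ultimately have W: "W = carrier_vec n" by blast
  show ?thesis
  proof (rule ccontr)
    assume "n \<noteq> 1"
    then have n1: "1 < n" using n by simp
    have "unit_vec n 1 \<in> W" using W by simp
    then obtain c :: complex where "unit_vec n 1 = c \<cdot>\<^sub>v unit_vec n 0" by (auto simp: W_def)
    then have "unit_vec n 1 $ 1 = (c \<cdot>\<^sub>v unit_vec n 0) $ 1" by simp
    then show False using n1 by simp
  qed
qed

end

section \<open>Monomial representations\<close>

text \<open>\<open>G\<close> permutes the coordinates through \<open>t\<close>, and the cocycle \<open>c\<close> gives the nonzero matrix entries. The
  subset \<open>V\<close> acts by diagonal matrices that separate the coordinates.\<close>

locale monomial_data = group G for G (structure) +
  fixes t :: "'a \<Rightarrow> 'x \<Rightarrow> 'x" and X :: "'x set" and c :: "'a \<Rightarrow> 'x \<Rightarrow> complex" and V :: "'a set"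
    and e :: "nat \<Rightarrow> 'x" and n :: nat
  assumes enum: "bij_betw e {..<n} X" and n: "n > 0"
    and acts: "acts G (carrier G) t X"
    and transitive: "\<And>x y. x \<in> X \<Longrightarrow> y \<in> X \<Longrightarrow> \<exists>g \<in> carrier G. t g x = y"
    and cocycle: "\<And>g h x. g \<in> carrier G \<Longrightarrow> h \<in> carrier G \<Longrightarrow> x \<in> X \<Longrightarrow>
        c (g \<otimes> h) (t (g \<otimes> h) x) = c g (t (g \<otimes> h) x) * c h (t h x)"
    and c_one: "\<And>x. x \<in> X \<Longrightarrow> c \<one> x = 1"
    and c_norm: "\<And>g x. g \<in> carrier G \<Longrightarrow> x \<in> X \<Longrightarrow> cmod (c g x) = 1"
    and V: "\<And>v. v \<in> V \<Longrightarrow> v \<in> carrier G" "\<And>v x. v \<in> V \<Longrightarrow> x \<in> X \<Longrightarrow> t v x = x"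
    and separate: "\<And>x y. x \<in> X \<Longrightarrow> y \<in> X \<Longrightarrow> x \<noteq> y \<Longrightarrow> \<exists>v \<in> V. c v x \<noteq> c v y"
begin

text \<open>The coefficient belongs to the row, that is, to the image point of the column. This
  determines the arguments in the assumption \<open>cocycle\<close>.\<close>

definition monomial_rep :: "'a \<Rightarrow> complex mat" where
  "monomial_rep g = mat n n (\<lambda>(i, j). if e i = t g (e j) then c g (e i) else 0)"

lemmas t_D = actsD[OF acts]

lemma e_in: "i < n \<Longrightarrow> e i \<in> X"
  using enum by (auto simp: bij_betw_def)

lemma e_inj: "i < n \<Longrightarrow> j < n \<Longrightarrow> e i = e j \<longleftrightarrow> i = j"
  using enum by (auto simp: bij_betw_def inj_on_def)

lemma e_surj: assumes "x \<in> X" obtains i where "i < n" "e i = x"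
  using enum assms by (auto simp: bij_betw_def)

lemma monomial_carrier: "monomial_rep g \<in> carrier_mat n n"
  by (simp add: monomial_rep_def)

lemma monomial_mult:
  assumes g: "g \<in> carrier G" and h: "h \<in> carrier G"
  shows "monomial_rep (g \<otimes> h) = monomial_rep g * monomial_rep h"
proof (rule eq_matI)
  fix i k assume "i < dim_row (monomial_rep g * monomial_rep h)" "k < dim_col (monomial_rep g * monomial_rep h)"
  then have ik: "i < n" "k < n" by (auto simp: monomial_rep_def)
  obtain j where j: "j < n" "e j = t h (e k)" by (rule e_surj[OF t_D(3)[OF h e_in[OF ik(2)]]])
  have "(monomial_rep g * monomial_rep h) $$ (i, k) =
      (\<Sum>l<n. (if e i = t g (e l) then c g (e i) else 0) * (if e l = t h (e k) then c h (e l) else 0))"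
    using ik by (simp add: monomial_rep_def scalar_prod_def atLeast0LessThan)
  also have "\<dots> = (\<Sum>l<n. if l = j then (if e i = t g (e j) then c g (e i) else 0) * c h (e j) else 0)"
  proof (rule sum.cong[OF refl])
    fix l assume "l \<in> {..<n}"
    then have "e l = t h (e k) \<longleftrightarrow> l = j" using e_inj[of l j] j by simp
    then show "(if e i = t g (e l) then c g (e i) else 0) * (if e l = t h (e k) then c h (e l) else 0)
      = (if l = j then (if e i = t g (e j) then c g (e i) else 0) * c h (e j) else 0)" by simp
  qed
  also have "\<dots> = (if e i = t g (e j) then c g (e i) else 0) * c h (e j)"
    using j(1) by simp
  also have "\<dots> = (if e i = t (g \<otimes> h) (e k) then c (g \<otimes> h) (e i) else 0)"
  proof -
    have "t (g \<otimes> h) (e k) = t g (e j)" using t_D(4)[OF g h e_in[OF ik(2)]] j(2) by simp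
    then show ?thesis using cocycle[OF g h e_in[OF ik(2)]] j(2) by simp
  qed
  also have "\<dots> = monomial_rep (g \<otimes> h) $$ (i, k)" using ik by (simp add: monomial_rep_def)
  finally show "monomial_rep (g \<otimes> h) $$ (i, k) = (monomial_rep g * monomial_rep h) $$ (i, k)" ..
qed (simp_all add: monomial_rep_def)

lemma monomial_one: "monomial_rep \<one> = 1\<^sub>m n"
proof (rule eq_matI)
  fix i j assume "i < dim_row (1\<^sub>m n)" "j < dim_col (1\<^sub>m n)"
  then show "monomial_rep \<one> $$ (i, j) = 1\<^sub>m n $$ (i, j)"
    using e_in e_inj t_D(2) c_one by (simp add: monomial_rep_def)
qed (simp_all add: monomial_rep_def)

lemma monomial_representation: "representation G n monomial_rep"
  by (intro representationI monomial_carrier monomial_mult monomial_one)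

lemma monomial_trace:
  "mat_trace (monomial_rep g) = (\<Sum>i<n. if e i = t g (e i) then c g (e i) else 0)"
  by (simp add: mat_trace_sum monomial_rep_def)

lemma monomial_trace_nat:
  assumes "\<And>x. x \<in> X \<Longrightarrow> c g x = 1"
  shows "\<exists>k::nat. mat_trace (monomial_rep g) = of_nat k"
proof -
  have "mat_trace (monomial_rep g) = (\<Sum>i<n. of_nat (if e i = t g (e i) then 1 else 0))"
    unfolding monomial_trace using assms e_in by (intro sum.cong) auto
  then show ?thesis by (metis of_nat_sum)
qed

text \<open>The trace is a sum of n numbers of modulus at most 1. If it equals n, each of them is 1,
  so no coordinate is moved or scaled.\<close>

lemma monomial_kernel:
  assumes g: "g \<in> carrier G" and tr: "mat_trace (monomial_rep g) = of_nat n"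
  shows "monomial_rep g = 1\<^sub>m n"
proof -
  define d where "d = (\<lambda>i. if e i = t g (e i) then c g (e i) else 0)"
  have le: "Re (d i) \<le> 1" if "i < n" for i
  proof (cases "e i = t g (e i)")
    case True
    then show ?thesis using c_norm[OF g e_in[OF that]] complex_Re_le_cmod[of "d i"] by (simp add: d_def)
  qed (simp add: d_def)
  have "(\<Sum>i<n. 1 - Re (d i)) = real n - Re (\<Sum>i<n. d i)" by (simp add: sum_subtractf)
  also have "(\<Sum>i<n. d i) = of_nat n" using tr by (simp add: monomial_trace d_def)
  finally have "(\<Sum>i<n. 1 - Re (d i)) = 0" by simp
  then have "1 - Re (d i) = 0" if "i < n" for i
    using sum_nonneg_eq_0_iff[of "{..<n}" "\<lambda>i. 1 - Re (d i)"] le that by simp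
  then have Re1: "Re (d i) = 1" if "i < n" for i using that by simp
  have diag1: "e i = t g (e i) \<and> c g (e i) = 1" if i: "i < n" for i
  proof -
    have ei: "e i = t g (e i)" using Re1[OF i] by (auto simp: d_def split: if_splits)
    then have r: "Re (c g (e i)) = 1" using Re1[OF i] by (simp add: d_def)
    have "(cmod (c g (e i)))\<^sup>2 = 1" using c_norm[OF g e_in[OF i]] by simp
    then have "Im (c g (e i)) = 0" using r by (simp add: cmod_power2)
    then show ?thesis using ei r by (simp add: complex_eq_iff)
  qed
  show ?thesis
  proof (rule eq_matI)
    fix i j assume "i < dim_row (1\<^sub>m n)" "j < dim_col (1\<^sub>m n)"
    then have ij: "i < n" "j < n" by auto
    have tj: "t g (e j) = e j" and ci: "c g (e i) = 1" "c g (e j) = 1" using diag1[OF ij(2)] diag1[OF ij(1)] by auto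
    show "monomial_rep g $$ (i, j) = 1\<^sub>m n $$ (i, j)"
      using ij e_inj[OF ij] by (simp add: monomial_rep_def tj ci)
  qed (simp_all add: monomial_rep_def)
qed

lemma monomial_diag:
  assumes v: "v \<in> V" and w: "w \<in> carrier_vec n" and i: "i < n"
  shows "(monomial_rep v *\<^sub>v w) $ i = c v (e i) * w $ i"
proof -
  have "(monomial_rep v *\<^sub>v w) $ i = (\<Sum>j<n. (if e i = t v (e j) then c v (e i) else 0) * w $ j)"
    using w i by (simp add: monomial_rep_def scalar_prod_def atLeast0LessThan)
  also have "\<dots> = (\<Sum>j<n. if j = i then c v (e i) * w $ i else 0)"
    using e_inj[OF i] V(2)[OF v] e_in by (intro sum.cong) auto
  finally show ?thesis using i by simp
qed

text \<open>A nonzero vector of least support in an invariant subspace is a multiple of a basis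
  vector, since the diagonal action of V could otherwise shorten its support. Transitivity then
  yields all basis vectors.\<close>

lemma monomial_irreducible: "irreducible_representation G n monomial_rep"
  unfolding irreducible_representation_def
proof (intro conjI allI impI)
  show "representation G n monomial_rep" by (rule monomial_representation)
  show "n \<noteq> 0" using n by simp
  fix W assume sub: "VectorSpace.subspace class_ring W (module_vec TYPE(complex) n)"
    and inv: "\<forall>g \<in> carrier G. \<forall>w \<in> W. monomial_rep g *\<^sub>v w \<in> W"
  have Wc: "\<And>w. w \<in> W \<Longrightarrow> w \<in> carrier_vec n" and W0: "0\<^sub>v n \<in> W"
    and Wadd: "\<And>v w. v \<in> W \<Longrightarrow> w \<in> W \<Longrightarrow> v + w \<in> W" and Wsm: "\<And>a w. w \<in> W \<Longrightarrow> a \<cdot>\<^sub>v w \<in> W"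
    using sub unfolding subspace_vec_iff by auto
  define supp where "supp = (\<lambda>w :: complex vec. {i. i < n \<and> w $ i \<noteq> 0})"
  have finsupp: "finite (supp w)" for w by (simp add: supp_def)
  show "W = {0\<^sub>v n} \<or> W = carrier_vec n"
  proof (cases "W = {0\<^sub>v n}")
    case False
    then have "\<exists>w. w \<in> W \<and> w \<noteq> 0\<^sub>v n" using W0 by blast
    then obtain w where w: "w \<in> W" "w \<noteq> 0\<^sub>v n"
      and least: "\<And>w'. w' \<in> W \<Longrightarrow> w' \<noteq> 0\<^sub>v n \<Longrightarrow> card (supp w) \<le> card (supp w')"
      using ex_has_least_nat[of "\<lambda>w. w \<in> W \<and> w \<noteq> 0\<^sub>v n" _ "\<lambda>w. card (supp w)"] by blast
    have wc: "w \<in> carrier_vec n" using Wc w by blast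
    have "\<exists>i. i < n \<and> w $ i \<noteq> 0"
    proof (rule ccontr)
      assume "\<not> ?thesis"
      then have "w = 0\<^sub>v n" using wc by (intro eq_vecI) auto
      then show False using w(2) by simp
    qed
    then obtain i where i: "i < n" "w $ i \<noteq> 0" by blast
    have only: "w $ j = 0" if j: "j < n" "j \<noteq> i" for j
    proof (rule ccontr)
      assume wj: "w $ j \<noteq> 0"
      obtain v where v: "v \<in> V" "c v (e i) \<noteq> c v (e j)"
        using separate[OF e_in[OF i(1)] e_in[OF j(1)]] e_inj[OF i(1) j(1)] j(2) by blast
      \<comment> \<open>This combination kills coordinate j and keeps coordinate i, where
        \<open>v\<close> has a different eigenvalue.\<close>
      define w' where "w' = monomial_rep v *\<^sub>v w + (- c v (e j)) \<cdot>\<^sub>v w"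
      have "w' \<in> W" unfolding w'_def using inv V(1)[OF v(1)] w(1) by (intro Wadd Wsm) auto
      have w'k: "w' $ k = (c v (e k) - c v (e j)) * w $ k" if "k < n" for k
        using that monomial_diag[OF v(1) wc that] wc monomial_carrier[of v]
        by (simp add: w'_def algebra_simps)
      have "w' $ i \<noteq> 0" using w'k[OF i(1)] v(2) i(2) by simp
      then have "w' \<noteq> 0\<^sub>v n" using i(1) by auto
      have "supp w' \<subset> supp w"
      proof
        show "supp w' \<subseteq> supp w" using w'k by (auto simp: supp_def)
        have "j \<in> supp w" "j \<notin> supp w'" using wj j w'k[OF j(1)] by (auto simp: supp_def)
        then show "supp w' \<noteq> supp w" by blast
      qed
      then have "card (supp w') < card (supp w)" by (intro psubset_card_mono finsupp)
      then show False using least[OF \<open>w' \<in> W\<close> \<open>w' \<noteq> 0\<^sub>v n\<close>] by simp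
    qed
    have ui: "unit_vec n i \<in> W"
    proof -
      have "unit_vec n i = (1 / w $ i) \<cdot>\<^sub>v w"
        using wc only i by (intro eq_vecI) (auto simp: unit_vec_def)
      then show ?thesis using Wsm[OF w(1)] by simp
    qed
    have uj: "unit_vec n j \<in> W" if j: "j < n" for j
    proof -
      obtain g where g: "g \<in> carrier G" "t g (e i) = e j" using transitive[OF e_in[OF i(1)] e_in[OF j]] by blast
      have c0: "c g (e j) \<noteq> 0" using c_norm[OF g(1) e_in[OF j]] by auto
      have "unit_vec n j = (1 / c g (e j)) \<cdot>\<^sub>v (monomial_rep g *\<^sub>v unit_vec n i)"
      proof (rule eq_vecI)
        show "dim_vec (unit_vec n j) = dim_vec ((1 / c g (e j)) \<cdot>\<^sub>v (monomial_rep g *\<^sub>v unit_vec n i))"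
          by (simp add: monomial_rep_def)
        fix k assume "k < dim_vec ((1 / c g (e j)) \<cdot>\<^sub>v (monomial_rep g *\<^sub>v unit_vec n i))"
        then have k: "k < n" by (simp add: monomial_rep_def)
        have "(monomial_rep g *\<^sub>v unit_vec n i) $ k = (if k = j then c g (e j) else 0)"
          using mult_mat_unit_vec[OF monomial_carrier k i(1)] g(2) e_inj[OF k j] k i(1)
          by (simp add: monomial_rep_def)
        then show "unit_vec n j $ k = ((1 / c g (e j)) \<cdot>\<^sub>v (monomial_rep g *\<^sub>v unit_vec n i)) $ k"
          using k j c0 by (simp add: monomial_rep_def)
      qed
      then show ?thesis using inv g(1) ui Wsm by simp
    qed
    \<comment> \<open>Removing one coordinate at a time writes x in terms of the basis vectors
      already known to lie in W.\<close>
    have all: "x \<in> W" if "x \<in> carrier_vec n" "card (supp x) = m" for x m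
      using that
    proof (induction m arbitrary: x)
      case 0
      then have "supp x = {}" using finsupp by simp
      then have "x = 0\<^sub>v n" using 0(1) by (intro eq_vecI) (auto simp: supp_def)
      then show ?case using W0 by simp
    next
      case (Suc m)
      then have "supp x \<noteq> {}" by auto
      then obtain j where j: "j \<in> supp x" by blast
      then have jn: "j < n" by (simp add: supp_def)
      define y where "y = x + (- x $ j) \<cdot>\<^sub>v unit_vec n j"
      have yc: "y \<in> carrier_vec n" using Suc.prems(1) by (simp add: y_def)
      have yk: "y $ k = (if k = j then 0 else x $ k)" if "k < n" for k
        using that jn Suc.prems(1) by (simp add: y_def unit_vec_def)
      have "supp y = supp x - {j}" using yk by (auto simp: supp_def split: if_splits)
      then have "card (supp y) = m" using j Suc.prems(2) finsupp by simp
      then have "y \<in> W" by (rule Suc.IH[OF yc])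
      moreover have "x = y + x $ j \<cdot>\<^sub>v unit_vec n j"
        using Suc.prems(1) yc yk jn by (intro eq_vecI) (auto simp: unit_vec_def)
      ultimately show ?case using Wadd[OF _ Wsm[OF uj[OF jn]]] by metis
    qed
    then have "W = carrier_vec n" using Wc by blast
    then show ?thesis ..
  qed simp
qed

end

section \<open>Minimal non-nilpotent groups\<close>

context group
begin

lemma normalD:
  assumes "L \<lhd> G"
  shows "subgroup L G" "\<And>g x. g \<in> carrier G \<Longrightarrow> x \<in> L \<Longrightarrow> g \<otimes> x \<otimes> inv g \<in> L"
    "\<And>g x. g \<in> carrier G \<Longrightarrow> x \<in> L \<Longrightarrow> inv g \<otimes> x \<otimes> g \<in> L"
  using assms by (auto simp: normal_imp_subgroup normal.inv_op_closed1 normal.inv_op_closed2)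

section \<open>Lower central series, normalizers and minimal normal subgroups\<close>

lemma commutator_subgroup_in:
  assumes "h \<in> H" "k \<in> K" shows "h \<otimes> k \<otimes> inv h \<otimes> inv k \<in> commutator_subgroup G H K"
  unfolding commutator_subgroup_def by (rule generate.incl) (use assms in blast)

lemma commutator_subgroup_le:
  assumes "subgroup L G" "\<And>h k. h \<in> H \<Longrightarrow> k \<in> K \<Longrightarrow> h \<otimes> k \<otimes> inv h \<otimes> inv k \<in> L"
  shows "commutator_subgroup G H K \<subseteq> L"
  unfolding commutator_subgroup_def using assms by (intro generate_subgroup_incl) auto

lemma lower_central_normal: "lower_central G i \<lhd> G"
proof (induction i)
  case 0
  then show ?case using normal_self by simp
next
  case (Suc i)
  note L = normalD[OF Suc]
  note Lc = subgroup.mem_carrier[OF L(1)]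
  show ?case
    unfolding lower_central.simps commutator_subgroup_def
  proof (rule normal_generateI)
    show "(\<Union>h\<in>lower_central G i. \<Union>k\<in>carrier G. {h \<otimes> k \<otimes> inv h \<otimes> inv k}) \<subseteq> carrier G"
      using Lc by auto
    fix x g assume "x \<in> (\<Union>h\<in>lower_central G i. \<Union>k\<in>carrier G. {h \<otimes> k \<otimes> inv h \<otimes> inv k})" and g: "g \<in> carrier G"
    then obtain h k where hk: "h \<in> lower_central G i" "k \<in> carrier G" "x = h \<otimes> k \<otimes> inv h \<otimes> inv k" by auto
    have hc: "h \<in> carrier G" using Lc hk by auto
    let ?h = "g \<otimes> h \<otimes> inv g" and ?k = "g \<otimes> k \<otimes> inv g"
    have "inv ?h = g \<otimes> inv h \<otimes> inv g" "inv ?k = g \<otimes> inv k \<otimes> inv g"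
      using g hc hk(2) by (simp_all add: inv_mult_group m_assoc)
    then have "?h \<otimes> ?k \<otimes> inv ?h \<otimes> inv ?k = g \<otimes> x \<otimes> inv g"
      using g hc hk(2) conj_mult[OF g] by (simp add: hk(3))
    moreover have "?h \<in> lower_central G i" "?k \<in> carrier G" using L(2)[OF g hk(1)] g hk(2) by auto
    ultimately show "g \<otimes> x \<otimes> inv g \<in> (\<Union>h\<in>lower_central G i. \<Union>k\<in>carrier G. {h \<otimes> k \<otimes> inv h \<otimes> inv k})"
      by (intro UN_I[of ?h] UN_I[of ?k]) auto
  qed
qed

lemma lower_central_Suc_le: "lower_central G (Suc i) \<subseteq> lower_central G i"
  unfolding lower_central.simps
proof (rule commutator_subgroup_le)
  note L = normalD[OF lower_central_normal]
  show "subgroup (lower_central G i) G" by (rule L)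
  fix h k assume h: "h \<in> lower_central G i" and k: "k \<in> carrier G"
  have hc: "h \<in> carrier G" using subgroup.mem_carrier[OF L(1) h] .
  have "h \<otimes> (k \<otimes> inv h \<otimes> inv k) \<in> lower_central G i"
    using h k by (intro subgroup.m_closed[OF L(1)] L(2) subgroup.m_inv_closed[OF L(1)])
  then show "h \<otimes> k \<otimes> inv h \<otimes> inv k \<in> lower_central G i" using hc k by (simp add: m_assoc)
qed

lemma lower_central_antimono: "i \<le> j \<Longrightarrow> lower_central G j \<subseteq> lower_central G i"
  by (induction rule: dec_induct) (use lower_central_Suc_le in blast)+

text \<open>The last term of the lower central series not contained in N normalizes N, as its
  commutators with G lie in the next term. Assuming only that some term lies in N covers nilpotent G
  and also nilpotent quotients by subgroups of N.\<close>

lemma normalizer_grows: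
  assumes "lower_central G c \<subseteq> N" "subgroup N G" "N \<noteq> carrier G"
  obtains x where "x \<in> carrier G - N" "\<And>n. n \<in> N \<Longrightarrow> x \<otimes> n \<otimes> inv x \<in> N"
proof -
  define i where "i = (LEAST i. lower_central G i \<subseteq> N)"
  have i: "lower_central G i \<subseteq> N" unfolding i_def using assms(1) by (rule LeastI)
  have "i \<noteq> 0"
  proof
    assume "i = 0"
    then show False using i assms(3) subgroup.subset[OF assms(2)] by auto
  qed
  then obtain j where j: "i = Suc j" by (cases i) auto
  have "\<not> lower_central G j \<subseteq> N" using not_less_Least[of j "\<lambda>i. lower_central G i \<subseteq> N"] j by (simp add: i_def)
  then obtain x where x: "x \<in> lower_central G j" "x \<notin> N" by blast
  have xc: "x \<in> carrier G" using subgroup.mem_carrier[OF normalD(1)[OF lower_central_normal] x(1)] .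
  show thesis
  proof
    show "x \<in> carrier G - N" using x xc by simp
    fix n assume n: "n \<in> N"
    have nc: "n \<in> carrier G" using subgroup.mem_carrier[OF assms(2) n] .
    have "x \<otimes> n \<otimes> inv x \<otimes> inv n \<in> N"
      using commutator_subgroup_in[OF x(1) nc] i j by auto
    then have "x \<otimes> n \<otimes> inv x \<otimes> inv n \<otimes> n \<in> N" using n by (rule subgroup.m_closed[OF assms(2)])
    then show "x \<otimes> n \<otimes> inv x \<in> N" using xc nc by (simp add: m_assoc)
  qed
qed

definition norm_set :: "'a set \<Rightarrow> 'a set" where
  "norm_set H = {g \<in> carrier G. \<forall>h \<in> H. g \<otimes> h \<otimes> inv g \<in> H}"

text \<open>Conjugation by g maps the finite set H injectively into itself, hence onto itself. This
  is why \<open>norm_set\<close> can ask for inclusion in one direction only.\<close>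

lemma norm_set_inverse:
  assumes "finite H" "H \<subseteq> carrier G" "g \<in> norm_set H" "h \<in> H" shows "inv g \<otimes> h \<otimes> g \<in> H"
proof -
  have g: "g \<in> carrier G" "\<And>h. h \<in> H \<Longrightarrow> g \<otimes> h \<otimes> inv g \<in> H" using assms(3) by (auto simp: norm_set_def)
  have inv: "inv g \<otimes> (g \<otimes> h \<otimes> inv g) \<otimes> g = h" if "h \<in> H" for h
    using that g(1) assms(2) by (auto simp: m_assoc subset_iff) (auto simp: m_assoc[symmetric])
  have "inj_on (\<lambda>h. g \<otimes> h \<otimes> inv g) H"
    by (rule inj_on_inverseI[of _ "\<lambda>k. inv g \<otimes> k \<otimes> g"]) (rule inv)
  then have "(\<lambda>h. g \<otimes> h \<otimes> inv g) ` H = H"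
    using assms(1) g(2) by (intro endo_inj_surj) auto
  then obtain k where "k \<in> H" "h = g \<otimes> k \<otimes> inv g" using assms(4) by blast
  then show ?thesis using inv by simp
qed

lemma norm_set_subgroup:
  assumes "finite H" "subgroup H G"
  shows "subgroup (norm_set H) G" "H \<subseteq> norm_set H"
proof -
  note Hc = subgroup.mem_carrier[OF assms(2)]
  show "subgroup (norm_set H) G"
  proof (rule subgroupI)
    show "norm_set H \<subseteq> carrier G" by (auto simp: norm_set_def)
    have "\<one> \<in> norm_set H" using Hc by (auto simp: norm_set_def)
    then show "norm_set H \<noteq> {}" by blast
    fix g assume g: "g \<in> norm_set H"
    then have gc: "g \<in> carrier G" by (simp add: norm_set_def)
    show "inv g \<in> norm_set H"
      using norm_set_inverse[OF assms(1) subgroup.subset[OF assms(2)] g] gc by (simp add: norm_set_def)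
    fix h assume h: "h \<in> norm_set H"
    then have hc: "h \<in> carrier G" by (simp add: norm_set_def)
    have "(g \<otimes> h) \<otimes> x \<otimes> inv (g \<otimes> h) \<in> H" if x: "x \<in> H" for x
      using g h x conj_conj[OF gc hc Hc[OF x]] by (simp add: norm_set_def)
    then show "g \<otimes> h \<in> norm_set H" using gc hc by (simp add: norm_set_def)
  qed
  show "H \<subseteq> norm_set H"
    using Hc assms(2) by (auto simp: norm_set_def intro: subgroup.m_closed subgroup.m_inv_closed)
qed

lemma nilpotent_maximal_normal:
  assumes "finite (carrier G)" "nilpotent G" "maximal_subgroup M G" "g \<in> carrier G" "m \<in> M"
  shows "g \<otimes> m \<otimes> inv g \<in> M"
proof -
  have M: "subgroup M G" "M \<noteq> carrier G" and max: "\<And>H. subgroup H G \<Longrightarrow> M \<subseteq> H \<Longrightarrow> H = M \<or> H = carrier G"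
    using assms(3) by (auto simp: maximal_subgroup_def)
  obtain c where "lower_central G c = {\<one>}" using assms(2) by (auto simp: nilpotent_def)
  then have "lower_central G c \<subseteq> M" using subgroup.one_closed[OF M(1)] by simp
  then obtain x where x: "x \<in> carrier G - M" "\<And>n. n \<in> M \<Longrightarrow> x \<otimes> n \<otimes> inv x \<in> M"
    using normalizer_grows[OF _ M] by blast
  then have "x \<in> norm_set M" by (simp add: norm_set_def)
  moreover have "norm_set M = M \<or> norm_set M = carrier G"
    using norm_set_subgroup[OF subgroup_finite[OF assms(1) M(1)] M(1)] by (intro max)
  ultimately have "norm_set M = carrier G" using x(1) by auto
  then have "g \<in> norm_set M" using assms(4) by simp
  then show ?thesis using assms(5) by (simp add: norm_set_def)
qed

text \<open>The last nontrivial term \<open>D\<close> of the derived series is abelian and normal.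
  For a prime p dividing the order of one of its elements, the solutions of x^p = 1 in
  \<open>D\<close> form a nontrivial normal subgroup; a normal subgroup of least order inside it
  will do.\<close>

lemma exists_minimal_normal:
  assumes "finite (carrier G)" "solvable G" "carrier G \<noteq> {\<one>}"
  obtains V p where "V \<lhd> G" "V \<noteq> {\<one>}" "\<forall>x \<in> V. \<forall>y \<in> V. x \<otimes> y = y \<otimes> x"
    "prime (p::nat)" "\<forall>x \<in> V. x [^] p = \<one>" "\<forall>L. L \<lhd> G \<longrightarrow> L \<subseteq> V \<longrightarrow> L = {\<one>} \<or> L = V"
proof -
  define P where "P = (\<lambda>n. (derived G ^^ n) (carrier G) = {\<one>})"
  have "\<exists>n. P n" using assms(2) solvable_iff_trivial_derived_seq by (simp add: P_def)
  then have PL: "P (LEAST n. P n)" by (rule LeastI_ex)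
  moreover have "\<not> P 0" using assms(3) by (simp add: P_def)
  ultimately obtain n where n: "(LEAST n. P n) = Suc n" by (cases "LEAST n. P n") auto
  have nP: "\<not> P n" using n not_less_Least[of n P] by simp
  define D where "D = (derived G ^^ n) (carrier G)"
  have D: "D \<lhd> G"
    unfolding D_def by (induction n) (auto intro: derived_is_normal normal_self)
  note Dc = subgroup.mem_carrier[OF normalD(1)[OF D]]
  have D1: "D \<noteq> {\<one>}" using nP by (simp add: D_def P_def)
  have dD: "derived G D = {\<one>}" using PL n by (simp add: D_def P_def)
  have comm: "x \<otimes> y = y \<otimes> x" if "x \<in> D" "y \<in> D" for x y
  proof -
    have "x \<otimes> y \<otimes> inv x \<otimes> inv y \<in> derived G D"
      unfolding derived_def by (rule generate.incl) (use that in blast)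
    then have "x \<otimes> y \<otimes> inv x \<otimes> inv y = \<one>" using dD by blast
    then have "x \<otimes> y \<otimes> inv x = y"
      using Dc that inv_solve_right[of \<one> "x \<otimes> y \<otimes> inv x" y] by simp
    then show ?thesis using conj_fix_iff Dc that by blast
  qed
  obtain d where d: "d \<in> D" "d \<noteq> \<one>" using D1 subgroup.one_closed[OF normalD(1)[OF D]] by blast
  have "ord d \<noteq> 1" using ord_eq_1[OF Dc[OF d(1)]] d(2) by blast
  then obtain p where p: "prime p" "p dvd ord d" using prime_factor_nat by blast
  then obtain r where r: "ord d = p * r" by (elim dvdE)
  have od: "ord d \<ge> 1" by (rule ord_ge_1[OF assms(1) Dc[OF d(1)]])
  define E where "E = {x \<in> D. x [^] p = \<one>}"
  have "E \<lhd> G"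
  proof (rule normal_invI[OF subgroupI])
    show "E \<subseteq> carrier G" using Dc by (auto simp: E_def)
    have "\<one> \<in> E" using subgroup.one_closed[OF normalD(1)[OF D]] by (simp add: E_def)
    then show "E \<noteq> {}" by blast
    fix x assume x: "x \<in> E"
    then have xD: "x \<in> D" "x [^] p = \<one>" by (auto simp: E_def)
    show "inv x \<in> E" using xD subgroup.m_inv_closed[OF normalD(1)[OF D]] Dc by (simp add: E_def nat_pow_inv)
    fix y assume y: "y \<in> E"
    then have yD: "y \<in> D" "y [^] p = \<one>" by (auto simp: E_def)
    show "x \<otimes> y \<in> E"
      using xD yD subgroup.m_closed[OF normalD(1)[OF D]] pow_mult_distrib[OF comm[OF xD(1) yD(1)] Dc Dc]
      by (simp add: E_def)
  next
    fix g x assume "g \<in> carrier G" "x \<in> E"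
    then show "g \<otimes> x \<otimes> inv g \<in> E"
      using normalD(2)[OF D] conj_pow[of g x p] Dc by (simp add: E_def)
  qed
  moreover have "E \<noteq> {\<one>}"
  proof -
    have "d [^] r \<in> E"
      using powers_in_subgroup[OF normalD(1)[OF D] d(1)] Dc[OF d(1)] pow_ord_eq_1[OF Dc[OF d(1)]] r
      by (simp add: E_def nat_pow_pow mult.commute)
    moreover have "d [^] r \<noteq> \<one>"
    proof
      assume "d [^] r = \<one>"
      then have "p * r dvd r" using pow_eq_id[OF Dc[OF d(1)]] r by simp
      then have "p * r \<le> r" using od r by (intro dvd_imp_le) auto
      then show False using prime_gt_1_nat[OF p(1)] od r by auto
    qed
    ultimately show ?thesis by blast
  qed
  ultimately have "E \<lhd> G \<and> E \<noteq> {\<one>} \<and> E \<subseteq> E" by simp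
  then obtain V where V: "V \<lhd> G" "V \<noteq> {\<one>}" "V \<subseteq> E"
    and least: "\<And>L. L \<lhd> G \<Longrightarrow> L \<noteq> {\<one>} \<Longrightarrow> L \<subseteq> E \<Longrightarrow> card V \<le> card L"
    using ex_has_least_nat[of "\<lambda>L. L \<lhd> G \<and> L \<noteq> {\<one>} \<and> L \<subseteq> E" E card] by blast
  show thesis
  proof (rule that[OF V(1,2) _ p(1)])
    show "\<forall>x \<in> V. \<forall>y \<in> V. x \<otimes> y = y \<otimes> x" using V(3) comm unfolding E_def by blast
    show "\<forall>x \<in> V. x [^] p = \<one>" using V(3) unfolding E_def by blast
    have "L = {\<one>} \<or> L = V" if L: "L \<lhd> G" "L \<subseteq> V" for L
    proof (cases "L = {\<one>}")
      case False
      have "card V \<le> card L" using least[OF L(1) False] L(2) V(3) by blast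
      then have "L = V"
        using L(2) subgroup_finite[OF assms(1) normalD(1)[OF V(1)]] by (metis card_seteq)
      then show ?thesis ..
    qed simp
    then show "\<forall>L. L \<lhd> G \<longrightarrow> L \<subseteq> V \<longrightarrow> L = {\<one>} \<or> L = V" by blast
  qed
qed

end

text \<open>Assumption \<open>quot\<close> says that all proper quotients of \<open>G\<close> are nilpotent. It will follow that \<open>G\<close> is a
  semidirect product of \<open>V\<close> and a maximal subgroup.\<close>

locale minimal_nonnilpotent = group G for G (structure) +
  fixes V :: "'a set" and p :: nat
  assumes fin: "finite (carrier G)"
    and nonnil: "\<And>c. \<not> lower_central G c \<subseteq> {\<one>}"
    and quot: "\<And>L. L \<lhd> G \<Longrightarrow> L \<noteq> {\<one>} \<Longrightarrow> \<exists>c. lower_central G c \<subseteq> L"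
    and V: "V \<lhd> G" "V \<noteq> {\<one>}" and V_comm: "\<And>x y. x \<in> V \<Longrightarrow> y \<in> V \<Longrightarrow> x \<otimes> y = y \<otimes> x"
    and p: "prime p" and V_exp: "\<And>x. x \<in> V \<Longrightarrow> x [^] p = \<one>"
    and V_min: "\<And>L. L \<lhd> G \<Longrightarrow> L \<subseteq> V \<Longrightarrow> L = {\<one>} \<or> L = V"
begin

section \<open>The Sylow subgroup that moves V, and the complement of V\<close>

lemmas VD = normalD[OF V(1)]
lemmas V_carrier = subgroup.mem_carrier[OF VD(1)]

lemma finite_V: "finite V" using subgroup_finite[OF fin VD(1)] .

text \<open>If L were nontrivial, the lower central series would reach L as well as V, hence their
  trivial intersection.\<close>

lemma trivial_of_Int:
  assumes "L \<lhd> G" "L \<inter> V = {\<one>}" shows "L = {\<one>}"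
proof (rule ccontr)
  assume "L \<noteq> {\<one>}"
  then obtain c where c: "lower_central G c \<subseteq> L" using quot assms(1) by blast
  obtain d where d: "lower_central G d \<subseteq> V" using quot V by blast
  have "lower_central G (max c d) \<subseteq> L \<inter> V"
    using c d lower_central_antimono[of c "max c d"] lower_central_antimono[of d "max c d"] by auto
  then show False using nonnil assms(2) by simp
qed

text \<open>The central elements in V form a normal subgroup, trivial or equal to V by minimality.
  If it were V, the lower central series would vanish one step after reaching V.\<close>

lemma no_central:
  assumes "v \<in> V" "\<And>g. g \<in> carrier G \<Longrightarrow> g \<otimes> v \<otimes> inv g = v" shows "v = \<one>"
proof -
  define Z where "Z = {v \<in> V. \<forall>g \<in> carrier G. g \<otimes> v \<otimes> inv g = v}"
  have "Z \<lhd> G"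
  proof (rule normal_invI[OF subgroupI])
    show "Z \<subseteq> carrier G" using V_carrier by (auto simp: Z_def)
    have "\<one> \<in> Z" using subgroup.one_closed[OF VD(1)] by (simp add: Z_def)
    then show "Z \<noteq> {}" by blast
    fix x assume "x \<in> Z"
    then have x: "x \<in> V" "\<And>g. g \<in> carrier G \<Longrightarrow> g \<otimes> x \<otimes> inv g = x" by (auto simp: Z_def)
    have "g \<otimes> inv x \<otimes> inv g = inv x" if g: "g \<in> carrier G" for g
    proof -
      have "inv (g \<otimes> x \<otimes> inv g) = inv x" using x(2)[OF g] by simp
      then show ?thesis using g V_carrier[OF x(1)] by (simp add: inv_mult_group m_assoc)
    qed
    then show "inv x \<in> Z" using subgroup.m_inv_closed[OF VD(1) x(1)] by (simp add: Z_def)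
    fix y assume "y \<in> Z"
    then have y: "y \<in> V" "\<And>g. g \<in> carrier G \<Longrightarrow> g \<otimes> y \<otimes> inv g = y" by (auto simp: Z_def)
    show "x \<otimes> y \<in> Z"
      using subgroup.m_closed[OF VD(1) x(1) y(1)] conj_mult[OF _ V_carrier[OF x(1)] V_carrier[OF y(1)]] x(2) y(2)
      by (simp add: Z_def)
  next
    fix g x assume "g \<in> carrier G" "x \<in> Z"
    then show "g \<otimes> x \<otimes> inv g \<in> Z" by (simp add: Z_def)
  qed
  moreover have "Z \<subseteq> V" by (auto simp: Z_def)
  moreover have "Z \<noteq> V"
  proof
    assume Z: "Z = V"
    obtain d where d: "lower_central G d \<subseteq> V" using quot V by blast
    have "lower_central G (Suc d) \<subseteq> {\<one>}"
      unfolding lower_central.simps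
    proof (rule commutator_subgroup_le[OF triv_subgroup])
      fix h k assume h: "h \<in> lower_central G d" and k: "k \<in> carrier G"
      then have hV: "h \<in> V" "h \<in> Z" using d Z by auto
      have "k \<otimes> h = h \<otimes> k" using hV(2) k V_carrier[OF hV(1)] conj_fix_iff by (simp add: Z_def)
      then have "h \<otimes> k \<otimes> inv h \<otimes> inv k = k \<otimes> h \<otimes> inv h \<otimes> inv k" by simp
      then show "h \<otimes> k \<otimes> inv h \<otimes> inv k \<in> {\<one>}" using k V_carrier[OF hV(1)] by (simp add: m_assoc)
    qed
    then show False using nonnil by blast
  qed
  ultimately have "Z = {\<one>}" using V_min by blast
  then show ?thesis using assms by (auto simp: Z_def)
qed

lemma conj_acts_V: "acts G (carrier G) (\<lambda>g v. g \<otimes> v \<otimes> inv g) V"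
  using subgroup_self VD(2) conj_conj V_carrier by (auto simp: acts_def)

text \<open>If all Sylow subgroups for primes other than p centralized V, then every conjugation
  orbit in V with more than one element would have length divisible by p. The number of fixed points
  would then be 0 modulo p, while \<open>no_central\<close> leaves exactly one.\<close>

lemma exists_sylow:
  obtains q Q a m where "prime q" "q \<noteq> p" "subgroup Q G" "card Q = q ^ a" "card (carrier G) = q ^ a * m"
    "\<not> q dvd m" "\<exists>x\<in>Q. \<exists>v\<in>V. x \<otimes> v \<otimes> inv x \<noteq> v"
proof (rule ccontr)
  assume contra: "\<not> thesis"
  note thesisI = that
  have H: "x \<otimes> v \<otimes> inv x = v" if Q: "prime q" "q \<noteq> p" "subgroup Q G" "card Q = q ^ a"
      "card (carrier G) = q ^ a * m" "\<not> q dvd m" and xv: "x \<in> Q" "v \<in> V" for q Q a m x v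
  proof (rule ccontr)
    assume "x \<otimes> v \<otimes> inv x \<noteq> v"
    then have "\<exists>x\<in>Q. \<exists>v\<in>V. x \<otimes> v \<otimes> inv x \<noteq> v" using xv by blast
    then have thesis by (rule thesisI[OF Q])
    then show False using contra by simp
  qed
  let ?\<phi> = "\<lambda>g v. g \<otimes> v \<otimes> inv g"
  have G0: "card (carrier G) \<noteq> 0" using fin one_closed by auto
  have orb: "(\<forall>g\<in>carrier G. ?\<phi> g v = v) \<or> p dvd card ((\<lambda>g. ?\<phi> g v) ` carrier G)" if v: "v \<in> V" for v
  proof -
    let ?O = "(\<lambda>g. ?\<phi> g v) ` carrier G" and ?S = "stab (carrier G) ?\<phi> v"
    have os: "card (carrier G) = card ?O * card ?S" by (rule orbit_stab[OF conj_acts_V v fin])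
    show ?thesis
    proof (cases "card ?O = 1")
      case True
      then obtain y where y: "?O = {y}" by (auto simp: card_1_singleton_iff)
      have "v = ?\<phi> \<one> v" using V_carrier[OF v] by simp
      then have "v \<in> ?O" using one_closed by (rule image_eqI)
      then have vy: "v = y" unfolding y by simp
      have "?\<phi> g v = v" if "g \<in> carrier G" for g
      proof -
        have "?\<phi> g v \<in> {y}" unfolding y[symmetric] using that by (rule imageI)
        then show ?thesis by (simp add: vy)
      qed
      then show ?thesis by blast
    next
      case False
      then obtain r where r: "prime r" "r dvd card ?O" using prime_factor_nat by blast
      show ?thesis
      proof (cases "r = p")
        case True
        then show ?thesis using r by simp
      next
        case rp: False
        obtain m where m: "card (carrier G) = r ^ multiplicity r (card (carrier G)) * m" "\<not> r dvd m"
          using multiplicity_decompose'[of "card (carrier G)" r] G0 r(1) by (metis mult.commute not_prime_unit)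
        let ?a = "multiplicity r (card (carrier G))"
        obtain Q where Q: "subgroup Q G" "card Q = r ^ ?a"
          using sylow_thm[OF r(1) is_group _ fin, of ?a m] m(1) by (auto simp: Coset.order_def)
        \<comment> \<open>The stabilizer contains a Sylow subgroup for \<open>r\<close>, so the
          orbit length is prime to \<open>r\<close>, against the choice of \<open>r\<close>.\<close>
        have "Q \<subseteq> ?S" using H[OF r(1) rp Q m _ v] subgroup.subset[OF Q(1)] by (auto simp: stab_def)
        then have "r ^ ?a dvd card ?S"
          using card_subgroup_dvd[OF fin Q(1) subgroup_stab[OF conj_acts_V v]] Q(2) by simp
        then have "r * r ^ ?a dvd card ?O * card ?S" using r(2) by (rule mult_dvd_mono[rotated])
        then have "r ^ ?a * r dvd r ^ ?a * m" using os m(1) by (simp add: mult.commute)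
        then have "r dvd m" using r(1) by (simp add: prime_gt_0_nat)
        then show ?thesis using m(2) by simp
      qed
    qed
  qed
  have "card (fixed_points (carrier G) ?\<phi> V) mod p = card V mod p"
    by (rule card_fixed_points_mod[OF conj_acts_V finite_V orb])
  moreover have "fixed_points (carrier G) ?\<phi> V = {\<one>}"
  proof (intro equalityI subsetI)
    fix v assume "v \<in> fixed_points (carrier G) ?\<phi> V"
    then show "v \<in> {\<one>}" using no_central[of v] by (simp add: fixed_points_def)
  next
    fix v assume "v \<in> {\<one>}"
    then show "v \<in> fixed_points (carrier G) ?\<phi> V"
      using subgroup.one_closed[OF VD(1)] by (simp add: fixed_points_def)
  qed
  moreover have "p dvd card V"
  proof -
    obtain v where v: "v \<in> V" "v \<noteq> \<one>" using V(2) subgroup.one_closed[OF VD(1)] by blast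
    have "ord v = p" by (rule ord_eq_prime[OF V_carrier[OF v(1)] v(2) p V_exp[OF v(1)]])
    moreover note pw = powers_subgroup[OF fin V_carrier[OF v(1)]]
    have "generate G {v} \<subseteq> V" using v(1) by (intro generate_subgroup_incl VD(1)) auto
    then have "card (generate G {v}) dvd card V" by (rule card_subgroup_dvd[OF fin pw(2) VD(1)])
    ultimately show ?thesis using pw(3) by simp
  qed
  ultimately have "1 mod p = (0::nat)" by simp
  then show False using prime_gt_1_nat[OF p] by simp
qed

text \<open>A Frattini argument. Since G/V is nilpotent, the subgroup T = V Q is normal, so G = V M
  for the normalizer M of Q. Minimality of V turns M into a maximal complement.\<close>

lemma exists_complement:
  obtains q Q a m M where "prime q" "q \<noteq> p" "subgroup Q G" "card Q = q ^ a" "card (carrier G) = q ^ a * m"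
    "\<not> q dvd m" "\<forall>x \<in> Q. (\<forall>v \<in> V. x \<otimes> v \<otimes> inv x = v) \<longrightarrow> x = \<one>" "Q \<noteq> {\<one>}"
    "maximal_subgroup M G" "Q \<subseteq> M" "\<forall>g \<in> M. \<forall>x \<in> Q. g \<otimes> x \<otimes> inv g \<in> Q"
    "V \<inter> M = {\<one>}" "\<forall>g \<in> carrier G. \<exists>v \<in> V. \<exists>m \<in> M. g = v \<otimes> m"
proof -
  obtain q Q a m where q: "prime q" "q \<noteq> p" and Q: "subgroup Q G" "card Q = q ^ a"
    and G: "card (carrier G) = q ^ a * m" "\<not> q dvd m" and ncent: "\<exists>x\<in>Q. \<exists>v\<in>V. x \<otimes> v \<otimes> inv x \<noteq> v"
    by (rule exists_sylow)
  note Qc = subgroup.mem_carrier[OF Q(1)]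
  have finQ: "finite Q" by (rule subgroup_finite[OF fin Q(1)])
  \<comment> \<open>The order of such an element divides both p and a power of q.\<close>
  have QV: "x = \<one>" if x: "x \<in> Q" "x \<in> V" for x
  proof -
    have "generate G {x} \<subseteq> Q" using x(1) by (intro generate_subgroup_incl Q(1)) auto
    then have "ord x dvd q ^ a"
      using card_subgroup_dvd[OF fin powers_subgroup(2)[OF fin Qc[OF x(1)]] Q(1)]
        powers_subgroup(3)[OF fin Qc[OF x(1)]] Q(2) by simp
    moreover have "ord x dvd p" using pow_eq_id[OF Qc[OF x(1)]] V_exp[OF x(2)] by simp
    moreover have "coprime (q ^ a) p" using primes_coprime[OF q(1) p q(2)] by simp
    ultimately have "is_unit (ord x)" by (meson coprime_common_divisor)
    then show ?thesis using ord_eq_1[OF Qc[OF x(1)]] by simp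
  qed
  define T where "T = {v \<otimes> x | v x. v \<in> V \<and> x \<in> Q}"
  have VT: "V \<subseteq> T"
  proof
    fix v assume "v \<in> V"
    then have "v = v \<otimes> \<one>" "v \<in> V" using V_carrier by auto
    then show "v \<in> T" unfolding T_def using subgroup.one_closed[OF Q(1)] by blast
  qed
  have QT: "Q \<subseteq> T"
  proof
    fix x assume "x \<in> Q"
    then have "x = \<one> \<otimes> x" "x \<in> Q" using Qc by auto
    then show "x \<in> T" unfolding T_def using subgroup.one_closed[OF VD(1)] by blast
  qed
  have T: "subgroup T G"
  proof (rule subgroupI)
    show "T \<subseteq> carrier G" using V_carrier Qc by (auto simp: T_def)
    show "T \<noteq> {}" using QT subgroup.one_closed[OF Q(1)] by blast
    fix s assume "s \<in> T"
    then obtain v x where s: "s = v \<otimes> x" "v \<in> V" "x \<in> Q" by (auto simp: T_def)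
    have c: "v \<in> carrier G" "x \<in> carrier G" using s V_carrier Qc by auto
    have "inv s = (inv x \<otimes> inv v \<otimes> inv (inv x)) \<otimes> inv x"
      using c by (simp add: s(1) inv_mult_group m_assoc)
    moreover have "inv x \<otimes> inv v \<otimes> inv (inv x) \<in> V"
      using c s(2) by (intro VD(2) subgroup.m_inv_closed[OF VD(1)]) auto
    ultimately show "inv s \<in> T" unfolding T_def using subgroup.m_inv_closed[OF Q(1) s(3)] by blast
    fix r assume "r \<in> T"
    then obtain w y where r: "r = w \<otimes> y" "w \<in> V" "y \<in> Q" by (auto simp: T_def)
    have d: "w \<in> carrier G" "y \<in> carrier G" using r V_carrier Qc by auto
    have "x \<otimes> w \<otimes> inv x \<otimes> (x \<otimes> y) = x \<otimes> w \<otimes> y" using c d by (simp add: m_assoc[symmetric]) (simp add: m_assoc)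
    then have "s \<otimes> r = (v \<otimes> (x \<otimes> w \<otimes> inv x)) \<otimes> (x \<otimes> y)"
      using c d by (simp add: s(1) r(1) m_assoc)
    moreover have "v \<otimes> (x \<otimes> w \<otimes> inv x) \<in> V"
      using c s(2) r(2) by (intro subgroup.m_closed[OF VD(1)] VD(2)) auto
    ultimately show "s \<otimes> r \<in> T" unfolding T_def using subgroup.m_closed[OF Q(1) s(3) r(3)] by blast
  qed
  note Tc = subgroup.mem_carrier[OF T]
  have finT: "finite T" by (rule subgroup_finite[OF fin T])
  \<comment> \<open>A subgroup containing Q has index prime to q in any larger subgroup; this is the
    hypothesis of \<open>prime_power_subgroup_conj\<close>.\<close>
  have sylow: "\<not> q * card S dvd card H" if S: "subgroup S G" "Q \<subseteq> S" and H: "subgroup H G" for S H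
  proof
    assume "q * card S dvd card H"
    moreover have "card H dvd card (carrier G)"
      using card_subgroup_dvd[OF fin H subgroup_self] subgroup.subset[OF H] by blast
    moreover have "q ^ a dvd card S" using card_subgroup_dvd[OF fin Q(1) S] Q(2) by simp
    ultimately have "q * q ^ a dvd q ^ a * m" by (metis G(1) dvd_trans mult_dvd_mono dvd_refl)
    then have "q dvd m" using q(1) by (simp add: mult.commute prime_gt_0_nat)
    then show False using G(2) by simp
  qed
  have conjQ: "subgroup ((\<lambda>x. g \<otimes> x \<otimes> inv g) ` Q) G" "card ((\<lambda>x. g \<otimes> x \<otimes> inv g) ` Q) = q ^ a"
    if g: "g \<in> carrier G" for g
  proof -
    show "subgroup ((\<lambda>x. g \<otimes> x \<otimes> inv g) ` Q) G"
    proof (rule subgroupI)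
      show "(\<lambda>x. g \<otimes> x \<otimes> inv g) ` Q \<subseteq> carrier G" using g Qc by auto
      show "(\<lambda>x. g \<otimes> x \<otimes> inv g) ` Q \<noteq> {}" using subgroup.one_closed[OF Q(1)] by blast
      fix s assume "s \<in> (\<lambda>x. g \<otimes> x \<otimes> inv g) ` Q"
      then obtain x where x: "x \<in> Q" "s = g \<otimes> x \<otimes> inv g" by blast
      have "inv s = g \<otimes> inv x \<otimes> inv g" using g Qc[OF x(1)] by (simp add: x(2) inv_mult_group m_assoc)
      then show "inv s \<in> (\<lambda>x. g \<otimes> x \<otimes> inv g) ` Q" using subgroup.m_inv_closed[OF Q(1) x(1)] by blast
      fix r assume "r \<in> (\<lambda>x. g \<otimes> x \<otimes> inv g) ` Q"
      then obtain y where y: "y \<in> Q" "r = g \<otimes> y \<otimes> inv g" by blast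
      have "s \<otimes> r = g \<otimes> (x \<otimes> y) \<otimes> inv g" using conj_mult[OF g Qc[OF x(1)] Qc[OF y(1)]] x(2) y(2) by simp
      then show "s \<otimes> r \<in> (\<lambda>x. g \<otimes> x \<otimes> inv g) ` Q" using subgroup.m_closed[OF Q(1) x(1) y(1)] by blast
    qed
    have "inj_on (\<lambda>x. g \<otimes> x \<otimes> inv g) Q"
      by (rule inj_onI) (use g Qc in simp)
    then show "card ((\<lambda>x. g \<otimes> x \<otimes> inv g) ` Q) = q ^ a" using Q(2) by (simp add: card_image)
  qed
  let ?N = "norm_set T"
  note N = norm_set_subgroup[OF finT T]
  \<comment> \<open>Otherwise some x outside the normalizer \<open>?N\<close> of T normalizes
    \<open>?N\<close>. Then the conjugate of Q by x lies in \<open>?N\<close> and, by Sylow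
    conjugacy there, in T. As V is normal, x would normalize T after all.\<close>
  have NG: "?N = carrier G"
  proof (rule ccontr)
    assume ne: "?N \<noteq> carrier G"
    obtain c where "lower_central G c \<subseteq> V" using quot V by blast
    then have "lower_central G c \<subseteq> ?N" using VT N(2) by blast
    then obtain x where x: "x \<in> carrier G - ?N" "\<And>n. n \<in> ?N \<Longrightarrow> x \<otimes> n \<otimes> inv x \<in> ?N"
      using normalizer_grows[OF _ N(1) ne] by blast
    have xc: "x \<in> carrier G" using x by simp
    let ?R = "(\<lambda>y. x \<otimes> y \<otimes> inv x) ` Q"
    have RN: "?R \<subseteq> ?N" using x(2) QT N(2) by blast
    have "\<exists>g\<in>?N. \<forall>r\<in>?R. inv g \<otimes> r \<otimes> g \<in> T"
      by (rule prime_power_subgroup_conj[OF subgroup_finite[OF fin N(1)] conjQ(1)[OF xc] T N(1) RN N(2) q(1)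
            conjQ(2)[OF xc] sylow[OF T QT N(1)]])
    then obtain g where g: "g \<in> ?N" "\<And>r. r \<in> ?R \<Longrightarrow> inv g \<otimes> r \<otimes> g \<in> T" by blast
    have gc: "g \<in> carrier G" "\<And>t. t \<in> T \<Longrightarrow> g \<otimes> t \<otimes> inv g \<in> T" using g(1) by (auto simp: norm_set_def)
    have RT: "r \<in> T" if r: "r \<in> ?R" for r
    proof -
      have rc: "r \<in> carrier G" using r xc Qc by auto
      have "g \<otimes> (inv g \<otimes> r \<otimes> g) \<otimes> inv g = r"
        by (rule conj_conj_inv(1)[OF gc(1) rc])
      then show ?thesis using gc(2)[OF g(2)[OF r]] by simp
    qed
    have "x \<otimes> s \<otimes> inv x \<in> T" if s: "s \<in> T" for s
    proof -
      obtain v y where vy: "s = v \<otimes> y" "v \<in> V" "y \<in> Q" using s by (auto simp: T_def)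
      have "x \<otimes> v \<otimes> inv x \<in> T" using VD(2)[OF xc vy(2)] VT by blast
      moreover have "x \<otimes> y \<otimes> inv x \<in> T" using RT vy(3) by blast
      ultimately show ?thesis
        unfolding vy(1) conj_mult[OF xc V_carrier[OF vy(2)] Qc[OF vy(3)]] by (rule subgroup.m_closed[OF T])
    qed
    then have "x \<in> ?N" using xc by (simp add: norm_set_def)
    then show False using x(1) by simp
  qed
  have Tn: "g \<otimes> s \<otimes> inv g \<in> T" if "g \<in> carrier G" "s \<in> T" for g s
  proof -
    have "g \<in> ?N" using that NG by simp
    then show ?thesis using that(2) by (simp add: norm_set_def)
  qed
  define M where "M = norm_set Q"
  note M = norm_set_subgroup[OF finQ Q(1), folded M_def]
  note Mc = subgroup.mem_carrier[OF M(1)]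
  have MQ: "g \<otimes> x \<otimes> inv g \<in> Q" if "g \<in> M" "x \<in> Q" for g x using that by (simp add: M_def norm_set_def)
  \<comment> \<open>The Frattini step: the conjugate of Q by g lies in T, so it is carried back to Q
    by some s = v x in T. Splitting off v leaves an element of M.\<close>
  have VM: "\<exists>v \<in> V. \<exists>m \<in> M. g = v \<otimes> m" if g: "g \<in> carrier G" for g
  proof -
    let ?R = "(\<lambda>y. g \<otimes> y \<otimes> inv g) ` Q"
    have RT: "?R \<subseteq> T" using Tn[OF g] QT by blast
    have "\<exists>t\<in>T. \<forall>r\<in>?R. inv t \<otimes> r \<otimes> t \<in> Q"
      by (rule prime_power_subgroup_conj[OF finT conjQ(1)[OF g] Q(1) T RT QT q(1)
            conjQ(2)[OF g] sylow[OF Q(1) subset_refl T]])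
    then obtain s where s: "s \<in> T" "\<And>r. r \<in> ?R \<Longrightarrow> inv s \<otimes> r \<otimes> s \<in> Q" by blast
    obtain v x where vx: "s = v \<otimes> x" "v \<in> V" "x \<in> Q" using s(1) by (auto simp: T_def)
    have c: "s \<in> carrier G" "v \<in> carrier G" "x \<in> carrier G" using Tc[OF s(1)] V_carrier[OF vx(2)] Qc[OF vx(3)] by auto
    have "(inv s \<otimes> g) \<otimes> y \<otimes> inv (inv s \<otimes> g) \<in> Q" if y: "y \<in> Q" for y
    proof -
      have "inv s \<otimes> (g \<otimes> y \<otimes> inv g) \<otimes> s \<in> Q" using s(2) y by blast
      moreover have "inv s \<otimes> (g \<otimes> y \<otimes> inv g) \<otimes> s = (inv s \<otimes> g) \<otimes> y \<otimes> inv (inv s \<otimes> g)"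
        using c(1) g Qc[OF y] by (simp add: inv_mult_group m_assoc)
      ultimately show ?thesis by simp
    qed
    then have "inv s \<otimes> g \<in> M" using c(1) g by (simp add: M_def norm_set_def)
    moreover have "x \<in> M" using M(2) vx(3) by blast
    ultimately have m: "x \<otimes> (inv s \<otimes> g) \<in> M" by (rule subgroup.m_closed[OF M(1), rotated])
    have "v \<otimes> (x \<otimes> (inv s \<otimes> g)) = s \<otimes> (inv s \<otimes> g)" using c g by (simp add: vx(1) m_assoc)
    also have "\<dots> = g" using c g by (simp add: m_assoc[symmetric])
    finally show ?thesis using vx(2) m by metis
  qed
  \<comment> \<open>The intersection is normalized by M and by the abelian group V, hence by G. With
    H = M this gives the complement, and for general H the maximality of M.\<close>
  have int_normal: "H \<inter> V = {\<one>} \<or> V \<subseteq> H" if H: "subgroup H G" "M \<subseteq> H" for H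
  proof -
    have "H \<inter> V \<lhd> G"
    proof (rule normal_invI)
      show "subgroup (H \<inter> V) G" by (rule subgroups_Inter_pair[OF H(1) VD(1)])
      fix g x assume g: "g \<in> carrier G" and x: "x \<in> H \<inter> V"
      obtain v m where vm: "v \<in> V" "m \<in> M" "g = v \<otimes> m" using VM[OF g] by blast
      have c: "v \<in> carrier G" "m \<in> carrier G" "x \<in> carrier G" "m \<in> H"
        using V_carrier[OF vm(1)] Mc[OF vm(2)] x V_carrier vm(2) H(2) by auto
      have y: "m \<otimes> x \<otimes> inv m \<in> H \<inter> V"
        using x c VD(2)[OF c(2)] H(1) by (auto intro: subgroup.m_closed subgroup.m_inv_closed)
      have "g \<otimes> x \<otimes> inv g = v \<otimes> (m \<otimes> x \<otimes> inv m) \<otimes> inv v" using conj_conj[OF c(1-3)] vm(3) by simp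
      also have "\<dots> = m \<otimes> x \<otimes> inv m"
        using V_comm[OF vm(1), of "m \<otimes> x \<otimes> inv m"] y conj_fix_iff[OF c(1), of "m \<otimes> x \<otimes> inv m"] c by simp
      finally show "g \<otimes> x \<otimes> inv g \<in> H \<inter> V" using y by simp
    qed
    then have "H \<inter> V = {\<one>} \<or> H \<inter> V = V" by (rule V_min) simp
    then show ?thesis by blast
  qed
  \<comment> \<open>If V normalized Q, commutators of Q with V would lie in both groups and vanish,
    contrary to \<open>ncent\<close>.\<close>
  have nVM: "\<not> V \<subseteq> M"
  proof
    assume VM': "V \<subseteq> M"
    obtain x v where xv: "x \<in> Q" "v \<in> V" "x \<otimes> v \<otimes> inv x \<noteq> v" using ncent by blast
    have c: "x \<in> carrier G" "v \<in> carrier G" using Qc V_carrier xv by auto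
    have "(x \<otimes> v \<otimes> inv x) \<otimes> inv v \<in> V"
      using VD(2)[OF c(1) xv(2)] subgroup.m_inv_closed[OF VD(1) xv(2)] by (rule subgroup.m_closed[OF VD(1)])
    moreover have "v \<otimes> inv x \<otimes> inv v \<in> Q"
      using VM' xv(2) subgroup.m_inv_closed[OF Q(1) xv(1)] by (intro MQ) auto
    then have "x \<otimes> (v \<otimes> inv x \<otimes> inv v) \<in> Q" by (rule subgroup.m_closed[OF Q(1) xv(1)])
    moreover have "x \<otimes> (v \<otimes> inv x \<otimes> inv v) = (x \<otimes> v \<otimes> inv x) \<otimes> inv v" using c by (simp add: m_assoc)
    ultimately have "(x \<otimes> v \<otimes> inv x) \<otimes> inv v = \<one>" using QV by simp
    then have "x \<otimes> v \<otimes> inv x = v" using c inv_solve_right[of \<one> "x \<otimes> v \<otimes> inv x" v] by simp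
    then show False using xv(3) by simp
  qed
  have MV: "V \<inter> M = {\<one>}" using int_normal[OF M(1) subset_refl] nVM by blast
  have max: "maximal_subgroup M G"
    unfolding maximal_subgroup_def
  proof (intro conjI allI impI)
    show "subgroup M G" by (rule M)
    show "M \<noteq> carrier G" using nVM V_carrier by blast
    fix H assume H: "subgroup H G" "M \<subseteq> H"
    note Hc = subgroup.mem_carrier[OF H(1)]
    show "H = M \<or> H = carrier G"
    proof (cases "V \<subseteq> H")
      case True
      have "g \<in> H" if g: "g \<in> carrier G" for g
        using VM[OF g] True H by (auto intro: subgroup.m_closed)
      then show ?thesis using Hc by blast
    next
      case False
      then have HV: "H \<inter> V = {\<one>}" using int_normal[OF H] by blast
      have "h \<in> M" if h: "h \<in> H" for h
      proof -
        obtain v m where vm: "v \<in> V" "m \<in> M" "h = v \<otimes> m" using VM[OF Hc[OF h]] by blast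
        have c: "v \<in> carrier G" "m \<in> carrier G" using V_carrier[OF vm(1)] Mc[OF vm(2)] by auto
        have "v = h \<otimes> inv m" using c by (simp add: vm(3) m_assoc)
        also have "\<dots> \<in> H" using h vm(2) H by (auto intro: subgroup.m_closed subgroup.m_inv_closed)
        finally have "v = \<one>" using HV vm(1) by blast
        then show ?thesis using vm(2,3) c by simp
      qed
      then show ?thesis using H(2) by blast
    qed
  qed
  have faithful: "x = \<one>" if x: "x \<in> Q" "\<And>v. v \<in> V \<Longrightarrow> x \<otimes> v \<otimes> inv x = v" for x
  proof -
    \<comment> \<open>The kernel of Q on V is normalized by M and centralized by V, so it is normal
      in G. It meets V trivially, hence \<open>trivial_of_Int\<close> applies.\<close>
    define L where "L = {x \<in> Q. \<forall>v \<in> V. x \<otimes> v \<otimes> inv x = v}"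
    have Lsub: "subgroup L G"
    proof -
      have "acts G Q (\<lambda>g v. g \<otimes> v \<otimes> inv g) V"
        using acts_subgroup[OF conj_acts_V Q(1)] Qc by blast
      then have "subgroup (\<Inter>v\<in>V. stab Q (\<lambda>g v. g \<otimes> v \<otimes> inv g) v) G"
        using subgroup.one_closed[OF VD(1)] by (intro subgroups_Inter) (auto intro: subgroup_stab)
      moreover have "L = (\<Inter>v\<in>V. stab Q (\<lambda>g v. g \<otimes> v \<otimes> inv g) v)"
        using subgroup.one_closed[OF VD(1)] by (auto simp: L_def stab_def)
      ultimately show ?thesis by simp
    qed
    have "L \<lhd> G"
    proof (rule normal_invI[OF Lsub])
      fix g x assume g: "g \<in> carrier G" and x: "x \<in> L"
      have xQ: "x \<in> Q" "\<And>v. v \<in> V \<Longrightarrow> x \<otimes> v \<otimes> inv x = v" using x by (auto simp: L_def)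
      obtain w m where wm: "w \<in> V" "m \<in> M" "g = w \<otimes> m" using VM[OF g] by blast
      have c: "w \<in> carrier G" "m \<in> carrier G" "x \<in> carrier G"
        using V_carrier[OF wm(1)] Mc[OF wm(2)] Qc[OF xQ(1)] by auto
      let ?y = "m \<otimes> x \<otimes> inv m"
      have yc: "?y \<in> carrier G" using c by simp
      have yQ: "?y \<in> Q" by (rule MQ[OF wm(2) xQ(1)])
      have yv: "?y \<otimes> v \<otimes> inv ?y = v" if v: "v \<in> V" for v
      proof -
        have vc: "v \<in> carrier G" by (rule V_carrier[OF v])
        have u: "inv m \<otimes> v \<otimes> m \<in> V" by (rule VD(3)[OF c(2) v])
        have "?y \<otimes> v \<otimes> inv ?y = m \<otimes> (x \<otimes> (inv m \<otimes> v \<otimes> m) \<otimes> inv x) \<otimes> inv m"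
          using c vc by (simp add: inv_mult_group m_assoc)
        also have "\<dots> = m \<otimes> (inv m \<otimes> v \<otimes> m) \<otimes> inv m" using xQ(2)[OF u] by simp
        also have "\<dots> = v" by (rule conj_conj_inv(1)[OF c(2) vc])
        finally show ?thesis .
      qed
      have "?y \<otimes> w = w \<otimes> ?y" using yv[OF wm(1)] conj_fix_iff[OF yc c(1)] by simp
      then have "w \<otimes> ?y \<otimes> inv w = ?y" using conj_fix_iff[OF c(1) yc] by simp
      then have "g \<otimes> x \<otimes> inv g = ?y" using conj_conj[OF c] wm(3) by simp
      then show "g \<otimes> x \<otimes> inv g \<in> L" using yQ yv by (simp add: L_def)
    qed
    moreover have "L \<inter> V = {\<one>}"
    proof -
      have "L \<inter> V \<subseteq> {\<one>}" using QV by (auto simp: L_def)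
      then show ?thesis using subgroup.one_closed[OF Lsub] subgroup.one_closed[OF VD(1)] by blast
    qed
    ultimately have "L = {\<one>}" by (rule trivial_of_Int)
    moreover have "x \<in> L" using x by (simp add: L_def)
    ultimately show ?thesis by blast
  qed
  have Q1: "Q \<noteq> {\<one>}"
  proof
    assume Q1: "Q = {\<one>}"
    obtain x v where xv: "x \<in> Q" "v \<in> V" "x \<otimes> v \<otimes> inv x \<noteq> v" using ncent by blast
    then have "x = \<one>" using Q1 by simp
    then show False using xv V_carrier by simp
  qed
  show thesis
    by (rule that[OF q Q G _ Q1 max M(2) _ MV]) (use faithful MQ VM in blast)+
qed

end

section \<open>A character of large degree\<close>

lemma power_fun_apply: "(f ^ n) x = (f x ^ n :: 'b::comm_monoid_mult)"
  by (induction n) (simp_all add: times_fun_def one_fun_def)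

context minimal_nonnilpotent
begin

text \<open>The linear characters of V. The value off V is 1 so that pointwise multiplication with
  the constant function 1 as unit makes this set an \<open>exp_group\<close>.\<close>

definition dual :: "('a \<Rightarrow> complex) set" where
  "dual = {\<mu>. (\<forall>x \<in> V. \<forall>y \<in> V. \<mu> (x \<otimes> y) = \<mu> x * \<mu> y) \<and> \<mu> \<one> = 1 \<and> (\<forall>x. x \<notin> V \<longrightarrow> \<mu> x = 1)}"

lemma dualD:
  assumes "\<mu> \<in> dual"
  shows "\<And>x y. x \<in> V \<Longrightarrow> y \<in> V \<Longrightarrow> \<mu> (x \<otimes> y) = \<mu> x * \<mu> y" "\<mu> \<one> = 1" "\<And>x. x \<notin> V \<Longrightarrow> \<mu> x = 1"
  using assms by (auto simp: dual_def)

lemma dual_pow: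
  fixes n :: nat
  assumes "\<mu> \<in> dual" "x \<in> V" shows "\<mu> (x [^] n) = \<mu> x ^ n"
proof (induction n)
  case (Suc n)
  have "x [^] n \<in> V" by (rule powers_in_subgroup[OF VD(1) assms(2)])
  then show ?case using Suc dualD(1)[OF assms(1) _ assms(2)] by (simp add: mult.commute)
qed (simp add: dualD(2)[OF assms(1)])

lemma dual_exp: assumes "\<mu> \<in> dual" shows "\<mu> x ^ p = 1"
proof (cases "x \<in> V")
  case True
  then show ?thesis using dual_pow[OF assms True, of p] V_exp[OF True] dualD(2)[OF assms] by simp
qed (simp add: dualD(3)[OF assms])

lemma dual_norm: assumes "\<mu> \<in> dual" shows "cmod (\<mu> x) = 1"
proof -
  have "cmod (\<mu> x) ^ p = 1 ^ p" using dual_exp[OF assms, of x] by (simp flip: norm_power)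
  then show ?thesis using prime_gt_0_nat[OF p] by (intro power_eq_imp_eq_base[of "cmod (\<mu> x)" p 1]) auto
qed

lemma dual_exp_group: "exp_group p dual"
  unfolding exp_group_def
proof (intro conjI ballI)
  have "finite {z::complex. z ^ p = 1}" using prime_gt_0_nat[OF p] by (intro finite_nth_roots)
  then have "finite {f::'a \<Rightarrow> complex. \<forall>x. (x \<in> V \<longrightarrow> f x \<in> {z. z ^ p = 1}) \<and> (x \<notin> V \<longrightarrow> f x = 1)}"
    by (intro finite_set_of_finite_funs finite_V)
  then show "finite dual" by (rule rev_finite_subset) (use dual_exp dualD(3) in auto)
  show "1 \<in> dual" by (simp add: dual_def one_fun_def)
  fix \<mu> assume \<mu>: "\<mu> \<in> dual"
  show "\<mu> ^ p = 1" using dual_exp[OF \<mu>] by (simp add: fun_eq_iff power_fun_apply one_fun_def)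
  fix \<nu> assume \<nu>: "\<nu> \<in> dual"
  show "\<mu> * \<nu> \<in> dual" using \<mu> \<nu> by (simp add: dual_def times_fun_def)
qed

definition dual_act :: "'a \<Rightarrow> ('a \<Rightarrow> complex) \<Rightarrow> 'a \<Rightarrow> complex" where
  "dual_act g \<mu> = (\<lambda>v. if v \<in> V then \<mu> (inv g \<otimes> v \<otimes> g) else 1)"

lemma dual_act_closed: assumes g: "g \<in> carrier G" and \<mu>: "\<mu> \<in> dual" shows "dual_act g \<mu> \<in> dual"
  unfolding dual_def mem_Collect_eq
proof (intro conjI ballI allI impI)
  fix x y assume xy: "x \<in> V" "y \<in> V"
  have "inv g \<otimes> (x \<otimes> y) \<otimes> g = (inv g \<otimes> x \<otimes> g) \<otimes> (inv g \<otimes> y \<otimes> g)"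
    using conj_mult[OF inv_closed[OF g] V_carrier[OF xy(1)] V_carrier[OF xy(2)]] g by simp
  then show "dual_act g \<mu> (x \<otimes> y) = dual_act g \<mu> x * dual_act g \<mu> y"
    using xy VD(3)[OF g] subgroup.m_closed[OF VD(1) xy] dualD(1)[OF \<mu>] by (simp add: dual_act_def)
next
  show "dual_act g \<mu> \<one> = 1" using g dualD(2)[OF \<mu>] by (simp add: dual_act_def)
next
  fix x assume "x \<notin> V" then show "dual_act g \<mu> x = 1" by (simp add: dual_act_def)
qed

lemma dual_acts: "acts G (carrier G) dual_act dual"
  unfolding acts_def
proof (intro conjI ballI)
  show "subgroup (carrier G) G" by (rule subgroup_self)
  fix \<mu> assume \<mu>: "\<mu> \<in> dual"
  show "dual_act \<one> \<mu> = \<mu>" using V_carrier dualD(3)[OF \<mu>] by (auto simp: dual_act_def fun_eq_iff)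
  fix g assume g: "g \<in> carrier G"
  show "dual_act g \<mu> \<in> dual" by (rule dual_act_closed[OF g \<mu>])
  fix h assume h: "h \<in> carrier G"
  show "dual_act (g \<otimes> h) \<mu> = dual_act g (dual_act h \<mu>)"
  proof
    fix x
    show "dual_act (g \<otimes> h) \<mu> x = dual_act g (dual_act h \<mu>) x"
      using VD(3)[OF g, of x] V_carrier[of x] g h by (simp add: dual_act_def inv_mult_group m_assoc)
  qed
qed

lemma dual_aut_action: "aut_action G dual_act dual p"
proof
  show "dual_act g (\<mu> * \<nu>) = dual_act g \<mu> * dual_act g \<nu>" for g \<mu> \<nu>
    by (simp add: dual_act_def times_fun_def fun_eq_iff)
qed (rule fin dual_acts dual_exp_group p)+

lemma dual_act_V: assumes "v \<in> V" "\<mu> \<in> dual" shows "dual_act v \<mu> = \<mu>"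
proof
  fix x
  show "dual_act v \<mu> x = \<mu> x"
  proof (cases "x \<in> V")
    case True
    have "inv v \<otimes> x \<otimes> v = inv v \<otimes> (v \<otimes> x)"
      using V_comm[OF True assms(1)] V_carrier[OF True] V_carrier[OF assms(1)] by (simp add: m_assoc)
    then have "inv v \<otimes> x \<otimes> v = x"
      using V_carrier[OF True] V_carrier[OF assms(1)] by (simp add: m_assoc[symmetric])
    then show ?thesis using True by (simp add: dual_act_def)
  qed (simp add: dual_act_def dualD(3)[OF assms(2)])
qed

text \<open>If \<open>U\<close> is a subgroup of \<open>V\<close> maximal subject to \<open>v \<notin> U\<close>, then \<open>V = U \<times> \<langle>v\<rangle>\<close>, and a
  character with kernel \<open>U\<close> is not trivial at \<open>v\<close>.\<close>

lemma dual_separates: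
  assumes v: "v \<in> V" "v \<noteq> \<one>" shows "\<exists>\<mu> \<in> dual. \<mu> v \<noteq> 1"
proof -
  have vc: "v \<in> carrier G" using V_carrier v by blast
  have ordv: "ord v = p" by (rule ord_eq_prime[OF vc v(2) p V_exp[OF v(1)]])
  define P where "P = (\<lambda>U. subgroup U G \<and> U \<subseteq> V \<and> v \<notin> U)"
  have "P {\<one>}" using v triv_subgroup subgroup.one_closed[OF VD(1)] by (simp add: P_def)
  moreover have "card U < Suc (card V)" if "P U" for U
    using that card_mono[OF finite_V, of U] by (simp add: P_def)
  ultimately obtain U where U: "P U" and max: "\<And>W. P W \<Longrightarrow> card W \<le> card U"
    using ex_has_greatest_nat[of P "{\<one>}" card "Suc (card V)"] by blast
  have Us: "subgroup U G" "U \<subseteq> V" "v \<notin> U" using U by (auto simp: P_def)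
  note Uc = subgroup.mem_carrier[OF Us(1)]
  have pw: "x [^] (i::nat) \<in> V" if "x \<in> V" for x i by (rule powers_in_subgroup[OF VD(1) that])
  have comm: "(u \<otimes> x) \<otimes> (u' \<otimes> x') = (u \<otimes> u') \<otimes> (x \<otimes> x')"
    if "u \<in> V" "x \<in> V" "u' \<in> V" "x' \<in> V" for u x u' x'
  proof -
    have c: "u \<in> carrier G" "x \<in> carrier G" "u' \<in> carrier G" "x' \<in> carrier G" using that V_carrier by auto
    have "(u \<otimes> x) \<otimes> (u' \<otimes> x') = u \<otimes> (x \<otimes> u') \<otimes> x'" using c by (simp add: m_assoc)
    also have "\<dots> = (u \<otimes> u') \<otimes> (x \<otimes> x')" unfolding V_comm[OF that(2,3)] using c by (simp add: m_assoc)
    finally show ?thesis .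
  qed
  have span: "subgroup {u \<otimes> x [^] (i::nat) | u i. u \<in> U} G" if x: "x \<in> V" for x
  proof -
    have xc: "x \<in> carrier G" using V_carrier x by blast
    have xg: "generate G {x} \<subseteq> V" using x by (intro generate_subgroup_incl VD(1)) auto
    note px = powers_subgroup[OF fin xc]
    have eq: "{u \<otimes> x [^] (i::nat) | u i. u \<in> U} = {u \<otimes> y | u y. u \<in> U \<and> y \<in> generate G {x}}"
      unfolding px(1) by blast
    show ?thesis
      unfolding eq
    proof (rule subgroupI)
      show "{u \<otimes> y | u y. u \<in> U \<and> y \<in> generate G {x}} \<subseteq> carrier G"
        using Uc xg V_carrier by blast
      show "{u \<otimes> y | u y. u \<in> U \<and> y \<in> generate G {x}} \<noteq> {}"
        using subgroup.one_closed[OF Us(1)] subgroup.one_closed[OF px(2)] by blast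
      fix s assume "s \<in> {u \<otimes> y | u y. u \<in> U \<and> y \<in> generate G {x}}"
      then obtain u y where s: "s = u \<otimes> y" "u \<in> U" "y \<in> generate G {x}" by blast
      have sV: "u \<in> V" "y \<in> V" using s Us(2) xg by auto
      have "inv s = inv y \<otimes> inv u" using V_carrier[OF sV(1)] V_carrier[OF sV(2)] by (simp add: s(1) inv_mult_group)
      also have "\<dots> = inv u \<otimes> inv y"
        using sV by (intro V_comm subgroup.m_inv_closed[OF VD(1)])
      finally show "inv s \<in> {u \<otimes> y | u y. u \<in> U \<and> y \<in> generate G {x}}"
        using subgroup.m_inv_closed[OF Us(1) s(2)] subgroup.m_inv_closed[OF px(2) s(3)] by blast
      fix r assume "r \<in> {u \<otimes> y | u y. u \<in> U \<and> y \<in> generate G {x}}"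
      then obtain u' y' where r: "r = u' \<otimes> y'" "u' \<in> U" "y' \<in> generate G {x}" by blast
      have "s \<otimes> r = (u \<otimes> u') \<otimes> (y \<otimes> y')"
        unfolding s(1) r(1) using sV r Us(2) xg by (intro comm) auto
      then show "s \<otimes> r \<in> {u \<otimes> y | u y. u \<in> U \<and> y \<in> generate G {x}}"
        using subgroup.m_closed[OF Us(1) s(2) r(2)] subgroup.m_closed[OF px(2) s(3) r(3)] by blast
    qed
  qed
  \<comment> \<open>For x outside U, adjoining x to U must capture v, by maximality. The exponent of
    x in the resulting expression for v is prime to p, so it can be inverted to express x.\<close>
  have decomp: "\<exists>u i. u \<in> U \<and> x = u \<otimes> v [^] (i::nat)" if x: "x \<in> V" for x
  proof (cases "x \<in> U")
    case True
    then have "x = x \<otimes> v [^] (0::nat)" using V_carrier[OF x] by simp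
    then show ?thesis using True by blast
  next
    case xU: False
    have xc: "x \<in> carrier G" using V_carrier x by blast
    let ?W = "{u \<otimes> x [^] (i::nat) | u i. u \<in> U}"
    have WV: "?W \<subseteq> V" using Us(2) pw[OF x] subgroup.m_closed[OF VD(1)] by blast
    have UW: "U \<subseteq> ?W"
    proof
      fix u assume "u \<in> U"
      then have "u = u \<otimes> x [^] (0::nat)" "u \<in> U" using Uc by auto
      then show "u \<in> ?W" by blast
    qed
    have "x = \<one> \<otimes> x [^] (1::nat)" using xc by simp
    then have "x \<in> ?W" using subgroup.one_closed[OF Us(1)] by blast
    then have "U \<subset> ?W" using UW xU by blast
    then have "card U < card ?W" using finite_subset[OF WV finite_V] by (rule psubset_card_mono[rotated])
    then have "\<not> P ?W" using max[of ?W] by auto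
    then have "v \<in> ?W" using span[OF x] WV by (simp add: P_def)
    then obtain w i where wi: "w \<in> U" "v = w \<otimes> x [^] (i::nat)" by blast
    have "\<not> p dvd i"
    proof
      assume "p dvd i"
      then obtain j where "i = p * j" by (elim dvdE)
      then have "x [^] i = (x [^] p) [^] j" using xc by (simp add: nat_pow_pow)
      then have "v = w" using wi V_exp[OF x] Uc[OF wi(1)] by simp
      then show False using wi Us by simp
    qed
    moreover have ordx: "ord x = p"
    proof -
      have "x \<noteq> \<one>" using xU subgroup.one_closed[OF Us(1)] by blast
      then show ?thesis by (rule ord_eq_prime[OF xc _ p V_exp[OF x]])
    qed
    ultimately have "coprime i (ord x)" using prime_imp_coprime[OF p, of i] by (simp add: coprime_commute)
    then obtain l :: nat where l: "x = (x [^] i) [^] l" using pow_coprime_surj[OF fin xc] by blast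
    have wc: "w \<in> carrier G" "w \<in> V" using Uc[OF wi(1)] Us(2) wi(1) by auto
    have "x [^] i = inv w \<otimes> v" using wc xc by (simp add: wi(2) m_assoc[symmetric])
    then have "(x [^] i) [^] l = (inv w) [^] l \<otimes> v [^] l"
      using pow_mult_distrib[OF V_comm[OF subgroup.m_inv_closed[OF VD(1) wc(2)] v(1)]] wc vc by simp
    then have "x = (inv w) [^] l \<otimes> v [^] l" by (simp only: l[symmetric])
    moreover have "(inv w) [^] l \<in> U"
      by (intro powers_in_subgroup[OF Us(1)] subgroup.m_inv_closed[OF Us(1)] wi(1))
    ultimately show ?thesis by blast
  qed
  \<comment> \<open>If the two powers differed, their quotient would be a nontrivial element of U
    generated by v. Its powers include v, so v would lie in U.\<close>
  have uniq: "v [^] i = v [^] j" if h: "u \<otimes> v [^] i = u' \<otimes> v [^] j" "u \<in> U" "u' \<in> U" for u u' and i j :: nat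
  proof (rule ccontr)
    assume ne: "v [^] i \<noteq> v [^] j"
    define y where "y = v [^] i \<otimes> inv (v [^] j)"
    have c: "u \<in> carrier G" "u' \<in> carrier G" "v [^] i \<in> carrier G" "v [^] j \<in> carrier G"
      using Uc h vc by auto
    have "inv u \<otimes> (u \<otimes> v [^] i) \<otimes> inv (v [^] j) = inv u \<otimes> (u' \<otimes> v [^] j) \<otimes> inv (v [^] j)" using h by simp
    moreover have "inv u \<otimes> (u \<otimes> v [^] i) \<otimes> inv (v [^] j) = y"
      using c(1,3,4) by (simp add: y_def m_assoc[symmetric])
    moreover have "inv u \<otimes> (u' \<otimes> v [^] j) \<otimes> inv (v [^] j) = inv u \<otimes> u'"
      using c by (simp add: m_assoc)
    ultimately have "y = inv u \<otimes> u'" by simp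
    then have yU: "y \<in> U" using h by (simp add: subgroup.m_closed[OF Us(1)] subgroup.m_inv_closed[OF Us(1)])
    have y1: "y \<noteq> \<one>"
    proof
      assume "y = \<one>"
      then have "v [^] i = v [^] j" using inv_solve_right[of \<one> "v [^] i" "v [^] j"] c by (simp add: y_def)
      then show False using ne by simp
    qed
    have vg: "v [^] (k::nat) \<in> generate G {v}" for k
      by (intro powers_in_subgroup powers_subgroup(2) fin vc) (simp add: generate.incl)
    have "y \<in> generate G {v}"
      unfolding y_def by (intro subgroup.m_closed subgroup.m_inv_closed powers_subgroup(2) fin vc vg)
    then have "\<exists>l::nat. v = y [^] l"
      using cyclic_prime_power_socle[OF fin vc p, of 1 y v] ordv y1 V_exp[OF v(1)] by (simp add: generate.incl)
    then obtain l :: nat where "v = y [^] l" by blast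
    then have "v \<in> U" using powers_in_subgroup[OF Us(1) yU, of l] by simp
    then show False using Us by simp
  qed
  obtain w :: complex where w: "w ^ p = 1" "w \<noteq> 1"
  proof -
    have p1: "p > 1" using prime_gt_1_nat[OF p] .
    have "card {z::complex. z ^ p = 1} = p" using p1 by (intro card_roots_unity_eq) auto
    then have "{z::complex. z ^ p = 1} \<noteq> {1}" using p1 by auto
    moreover have "1 \<in> {z::complex. z ^ p = 1}" by simp
    ultimately show thesis using that by blast
  qed
  have wpow_le: "w ^ i = w ^ j" if "v [^] i = v [^] j" "i \<le> j" for i j :: nat
  proof -
    have "v [^] i \<otimes> v [^] (j - i) = v [^] (i + (j - i))" by (rule nat_pow_mult[OF vc])
    also have "i + (j - i) = j" using that(2) by simp
    also have "v [^] j = v [^] i \<otimes> \<one>" using that(1) vc by simp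
    finally have "v [^] i \<otimes> v [^] (j - i) = v [^] i \<otimes> \<one>" .
    then have "v [^] (j - i) = \<one>" using vc by simp
    then have "p dvd j - i" using pow_eq_id[OF vc] ordv by simp
    then obtain k where "j - i = p * k" by (elim dvdE)
    then have "j = i + p * k" using that(2) by simp
    then show ?thesis using w(1) by (simp add: power_add power_mult)
  qed
  have wpow: "w ^ i = w ^ j" if "v [^] i = v [^] j" for i j :: nat
  proof (cases "i \<le> j")
    case True
    then show ?thesis by (rule wpow_le[OF that])
  next
    case False
    then have "j \<le> i" by simp
    then show ?thesis by (rule wpow_le[OF that[symmetric], symmetric])
  qed
  \<comment> \<open>The exponent is only determined modulo p. Its choice does not affect the power
    of the p-th root of unity \<open>w\<close>, as \<open>idx_eq\<close> shows.\<close>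
  define idx where "idx = (\<lambda>x. SOME i. \<exists>u. u \<in> U \<and> x = u \<otimes> v [^] (i::nat))"
  have idx: "\<exists>u. u \<in> U \<and> x = u \<otimes> v [^] idx x" if "x \<in> V" for x
    unfolding idx_def by (rule someI_ex) (use decomp[OF that] in blast)
  have idx_eq: "w ^ idx x = w ^ i" if "x = u \<otimes> v [^] i" "u \<in> U" for x u and i :: nat
  proof -
    have "x \<in> V" using that Us(2) pw[OF v(1)] subgroup.m_closed[OF VD(1)] by blast
    then obtain u' where u': "u' \<in> U" "x = u' \<otimes> v [^] idx x" using idx by blast
    have "u' \<otimes> v [^] idx x = u \<otimes> v [^] i" using u'(2) that(1) by simp
    then have "v [^] idx x = v [^] i" using u'(1) that(2) by (rule uniq)
    then show ?thesis by (rule wpow)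
  qed
  define \<mu> where "\<mu> = (\<lambda>x. if x \<in> V then w ^ idx x else 1)"
  have "\<mu> \<in> dual"
    unfolding dual_def mem_Collect_eq
  proof (intro conjI ballI allI impI)
    fix x y assume xy: "x \<in> V" "y \<in> V"
    obtain u where u: "u \<in> U" "x = u \<otimes> v [^] idx x" using idx[OF xy(1)] by blast
    obtain u' where u': "u' \<in> U" "y = u' \<otimes> v [^] idx y" using idx[OF xy(2)] by blast
    have "(u \<otimes> v [^] idx x) \<otimes> (u' \<otimes> v [^] idx y) = (u \<otimes> u') \<otimes> (v [^] idx x \<otimes> v [^] idx y)"
      using u(1) u'(1) Us(2) pw[OF v(1)] by (intro comm) auto
    then have "x \<otimes> y = (u \<otimes> u') \<otimes> v [^] (idx x + idx y)"
      using u(2) u'(2) vc by (simp add: nat_pow_mult)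
    then have "w ^ idx (x \<otimes> y) = w ^ (idx x + idx y)"
      by (rule idx_eq) (rule subgroup.m_closed[OF Us(1) u(1) u'(1)])
    then show "\<mu> (x \<otimes> y) = \<mu> x * \<mu> y"
      using xy subgroup.m_closed[OF VD(1) xy] by (simp add: \<mu>_def power_add)
  next
    have "w ^ idx \<one> = w ^ (0::nat)" by (rule idx_eq[of _ \<one>]) (use subgroup.one_closed[OF Us(1)] in auto)
    then show "\<mu> \<one> = 1" by (simp add: \<mu>_def)
  next
    fix x assume "x \<notin> V" then show "\<mu> x = 1" by (simp add: \<mu>_def)
  qed
  moreover have "w ^ idx v = w ^ (1::nat)"
    by (rule idx_eq[of _ \<one>]) (use subgroup.one_closed[OF Us(1)] vc in auto)
  then have "\<mu> v \<noteq> 1" using v(1) w(2) by (simp add: \<mu>_def)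
  ultimately show ?thesis by blast
qed

text \<open>The representation is induced from the linear character of V M_\<mu> that extends \<mu>
  and is trivial on the stabilizer M_\<mu>. Natural-number traces on M will put its character among
  the constituents of (1_M)^G, and the condition on full traces identifies the kernel of the
  character with that of the representation.\<close>

lemma bad_representation:
  obtains M n \<rho> where "maximal_subgroup M G" "irreducible_representation G n \<rho>"
    "\<forall>m \<in> M. \<exists>k::nat. mat_trace (\<rho> m) = of_nat k"
    "\<forall>g \<in> carrier G. mat_trace (\<rho> g) = of_nat n \<longrightarrow> \<rho> g = 1\<^sub>m n"
    "\<not> n\<^sup>2 dvd card (carrier G)"
proof -
  obtain q Q a m M where q: "prime q" "q \<noteq> p" and Q: "subgroup Q G" "card Q = q ^ a"
    and G: "card (carrier G) = q ^ a * m" "\<not> q dvd m"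
    and faithful: "\<forall>x \<in> Q. (\<forall>v \<in> V. x \<otimes> v \<otimes> inv x = v) \<longrightarrow> x = \<one>" and Q1: "Q \<noteq> {\<one>}"
    and max: "maximal_subgroup M G" and QM: "Q \<subseteq> M" and MQ': "\<forall>g \<in> M. \<forall>x \<in> Q. g \<otimes> x \<otimes> inv g \<in> Q"
    and VM': "V \<inter> M = {\<one>}" "\<forall>g \<in> carrier G. \<exists>v \<in> V. \<exists>m \<in> M. g = v \<otimes> m"
    by (rule exists_complement)
  have MQ: "\<And>g x. g \<in> M \<Longrightarrow> x \<in> Q \<Longrightarrow> g \<otimes> x \<otimes> inv g \<in> Q" using MQ' by blast
  have VM: "V \<inter> M = {\<one>}" "\<And>g. g \<in> carrier G \<Longrightarrow> \<exists>v \<in> V. \<exists>m \<in> M. g = v \<otimes> m" using VM' by blast+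
  note Qc = subgroup.mem_carrier[OF Q(1)]
  have M: "subgroup M G" using max by (simp add: maximal_subgroup_def)
  note Mc = subgroup.mem_carrier[OF M]
  have finM: "finite M" by (rule subgroup_finite[OF fin M])
  interpret D: aut_action G dual_act dual p by (rule dual_aut_action)
  have actQ: "acts G Q dual_act dual" using acts_subgroup[OF dual_acts Q(1)] Qc by blast
  have actM: "acts G M dual_act dual" using acts_subgroup[OF dual_acts M] Mc by blast
  interpret DQ: aut_action "G\<lparr>carrier := Q\<rparr>" dual_act dual p
    using D.aut_action_restrict[OF Q(1) dual_exp_group actQ] by simp
  have "large_orbit q Q dual_act dual"
    using DQ.large_orbit[OF q, of a] Q(2) by simp
  \<comment> \<open>An element trivial on the dual is trivial on V, because characters separate the
    points of V; and Q is faithful on V.\<close>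
  moreover have kern: "kern Q dual_act dual = {\<one>}"
  proof (intro equalityI subsetI)
    fix x assume "x \<in> kern Q dual_act dual"
    then have x: "x \<in> Q" "\<And>\<mu>. \<mu> \<in> dual \<Longrightarrow> dual_act x \<mu> = \<mu>" by (auto simp: kern_def)
    have xc: "x \<in> carrier G" by (rule Qc[OF x(1)])
    have "x \<otimes> v \<otimes> inv x = v" if v: "v \<in> V" for v
    proof -
      have vc: "v \<in> carrier G" by (rule V_carrier[OF v])
      have u: "inv x \<otimes> v \<otimes> x \<in> V" by (rule VD(3)[OF xc v])
      have "(inv x \<otimes> v \<otimes> x) \<otimes> inv v = \<one>"
      proof (rule ccontr)
        assume ne: "(inv x \<otimes> v \<otimes> x) \<otimes> inv v \<noteq> \<one>"
        have wV: "(inv x \<otimes> v \<otimes> x) \<otimes> inv v \<in> V"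
          by (intro subgroup.m_closed[OF VD(1)] u subgroup.m_inv_closed[OF VD(1)] v)
        obtain \<mu> where \<mu>: "\<mu> \<in> dual" "\<mu> ((inv x \<otimes> v \<otimes> x) \<otimes> inv v) \<noteq> 1" using dual_separates[OF wV ne] by blast
        have "dual_act x \<mu> v = \<mu> v" using x(2)[OF \<mu>(1)] by simp
        then have "\<mu> (inv x \<otimes> v \<otimes> x) = \<mu> v" using v by (simp add: dual_act_def)
        then have "\<mu> ((inv x \<otimes> v \<otimes> x) \<otimes> inv v) = \<mu> (v \<otimes> inv v)"
          using dualD(1)[OF \<mu>(1) u] dualD(1)[OF \<mu>(1) v] subgroup.m_inv_closed[OF VD(1) v] by simp
        then show False using \<mu> vc dualD(2)[OF \<mu>(1)] by simp
      qed
      then have "inv x \<otimes> v \<otimes> x = v"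
        using inv_solve_right[of \<one> "inv x \<otimes> v \<otimes> x" v] xc vc by simp
      then have "x \<otimes> (inv x \<otimes> v \<otimes> x) \<otimes> inv x = x \<otimes> v \<otimes> inv x" by simp
      moreover have "x \<otimes> (inv x \<otimes> v \<otimes> x) \<otimes> inv x = v"
        by (rule conj_conj_inv(1)[OF xc vc])
      ultimately show ?thesis by simp
    qed
    then show "x \<in> {\<one>}" using faithful x(1) by blast
  next
    fix x assume "x \<in> {\<one>}"
    then show "x \<in> kern Q dual_act dual"
      using subgroup.one_closed[OF Q(1)] actsD(2)[OF dual_acts] by (simp add: kern_def)
  qed
  ultimately obtain \<mu>0 where \<mu>0: "\<mu>0 \<in> dual" "q * (card (stab Q dual_act \<mu>0))\<^sup>2 \<le> card Q"
    using Q1 by (auto simp: large_orbit_def)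
  define X where "X = (\<lambda>g. dual_act g \<mu>0) ` carrier G"
  \<comment> \<open>V acts trivially on its own dual, so the G-orbit is an M-orbit and its length is
    an index in M.\<close>
  have XM: "X = (\<lambda>g. dual_act g \<mu>0) ` M"
  proof (intro equalityI subsetI)
    fix \<mu> assume "\<mu> \<in> X"
    then obtain g where g: "g \<in> carrier G" "\<mu> = dual_act g \<mu>0" by (auto simp: X_def)
    obtain v h where vh: "v \<in> V" "h \<in> M" "g = v \<otimes> h" using VM(2)[OF g(1)] by blast
    have "\<mu> = dual_act v (dual_act h \<mu>0)"
      using actsD(4)[OF dual_acts V_carrier[OF vh(1)] Mc[OF vh(2)] \<mu>0(1)] g(2) vh(3) by simp
    also have "\<dots> = dual_act h \<mu>0" by (intro dual_act_V vh(1) dual_act_closed Mc vh(2) \<mu>0(1))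
    finally show "\<mu> \<in> (\<lambda>g. dual_act g \<mu>0) ` M" using vh(2) by blast
  qed (use Mc in \<open>auto simp: X_def\<close>)
  have Xd: "X \<subseteq> dual" using dual_act_closed \<mu>0(1) by (auto simp: X_def)
  have finX: "finite X" using fin by (simp add: X_def)
  define n where "n = card X"
  have n0: "n > 0" using finX one_closed by (auto simp: n_def X_def card_gt_0_iff)
  have ndvd: "\<not> n\<^sup>2 dvd card (carrier G)"
  proof
    assume dv: "n\<^sup>2 dvd card (carrier G)"
    let ?S = "stab M dual_act \<mu>0"
    have S: "subgroup ?S G" by (rule subgroup_stab[OF actM \<mu>0(1)])
    have SM: "?S \<subseteq> M" by (auto simp: stab_def)
    have finS: "finite ?S" by (rule finite_subset[OF SM finM])
    have S0: "card ?S \<noteq> 0" using finS subgroup.one_closed[OF S] by auto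
    have os: "card M = n * card ?S" unfolding n_def XM by (rule orbit_stab[OF actM \<mu>0(1) finM])
    have "\<not> is_unit q" using q(1) by (simp add: prime_nat_iff)
    then obtain m' where m': "card ?S = q ^ multiplicity q (card ?S) * m'" "\<not> q dvd m'"
      using multiplicity_decompose'[OF S0] by blast
    let ?s = "multiplicity q (card ?S)"
    interpret S: group "G\<lparr>carrier := ?S\<rparr>" by (rule subgroup_imp_group[OF S])
    \<comment> \<open>A Sylow q-subgroup of the stabilizer in M. It will turn out to lie in Q, which
      bounds the q-part of the stabilizer order by the order of the stabilizer in Q.\<close>
    obtain R where R: "subgroup R (G\<lparr>carrier := ?S\<rparr>)" "card R = q ^ ?s"
      using sylow_thm[OF q(1) S.is_group, of ?s m'] m'(1) finS by (auto simp: Coset.order_def)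
    have RG: "subgroup R G" by (rule incl_subgroup[OF S R(1)])
    have RS: "R \<subseteq> ?S" using subgroup.subset[OF R(1)] by simp
    have "\<not> q * card Q dvd card M"
    proof
      assume "q * card Q dvd card M"
      also have "card M dvd card (carrier G)" using card_subgroup_dvd[OF fin M subgroup_self] Mc by blast
      finally have "q ^ a * q dvd q ^ a * m" using G(1) Q(2) by (simp add: mult.commute)
      then show False using G(2) q(1) by (simp add: prime_gt_0_nat)
    qed
    \<comment> \<open>R is conjugate in M into Q, and M normalizes Q, so R itself lies in Q.\<close>
    then have "\<exists>g \<in> M. \<forall>r \<in> R. inv g \<otimes> r \<otimes> g \<in> Q"
      using RS SM by (intro prime_power_subgroup_conj[OF finM RG Q(1) M _ QM q(1) R(2)]) auto
    then obtain g where g: "g \<in> M" "\<And>r. r \<in> R \<Longrightarrow> inv g \<otimes> r \<otimes> g \<in> Q" by blast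
    have "r \<in> stab Q dual_act \<mu>0" if r: "r \<in> R" for r
    proof -
      have c: "g \<in> carrier G" "r \<in> carrier G" using Mc[OF g(1)] subgroup.mem_carrier[OF RG r] by auto
      have "g \<otimes> (inv g \<otimes> r \<otimes> g) \<otimes> inv g = r" by (rule conj_conj_inv(1)[OF c])
      then have "r \<in> Q" using MQ[OF g(1) g(2)[OF r]] by simp
      then show ?thesis using r RS by (auto simp: stab_def)
    qed
    then have "R \<subseteq> stab Q dual_act \<mu>0" by blast
    moreover have "finite (stab Q dual_act \<mu>0)" using subgroup_finite[OF fin Q(1)] by (simp add: stab_def)
    ultimately have "q ^ ?s \<le> card (stab Q dual_act \<mu>0)" using R(2) by (metis card_mono)
    then have "q * (q ^ ?s)\<^sup>2 \<le> q * (card (stab Q dual_act \<mu>0))\<^sup>2" by (intro mult_left_mono power_mono) auto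
    also have "\<dots> \<le> q ^ a" using \<mu>0(2) Q(2) by simp
    finally have "q * (q ^ ?s)\<^sup>2 \<le> q ^ a" .
    then have "q ^ Suc (?s * 2) \<le> q ^ a" by (simp add: power_mult)
    then have sa: "Suc (?s * 2) \<le> a" by (rule power_le_imp_le_exp[OF prime_gt_1_nat[OF q(1)]])
    have "q ^ a dvd card M" using card_subgroup_dvd[OF fin Q(1) M QM] Q(2) by simp
    moreover have "card M = q ^ ?s * (n * m')" unfolding os by (subst m'(1)) (rule mult.left_commute)
    ultimately have "q ^ a dvd q ^ ?s * (n * m')" by simp
    moreover have "q ^ a = q ^ ?s * q ^ (a - ?s)" using sa by (simp flip: power_add)
    ultimately have "q ^ (a - ?s) dvd n * m'" using prime_gt_0_nat[OF q(1)] by simp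
    moreover have "coprime (q ^ (a - ?s)) m'" using q(1) m'(2) by (simp add: prime_imp_coprime)
    ultimately have "q ^ (a - ?s) dvd n" by (simp add: coprime_dvd_mult_left_iff)
    then have "(q ^ (a - ?s))\<^sup>2 dvd n\<^sup>2" by (rule dvd_power_same)
    then have "q ^ ((a - ?s) * 2) dvd n\<^sup>2" by (simp only: power_mult)
    also have "n\<^sup>2 dvd q ^ a * m" using dv G(1) by simp
    finally have "q ^ ((a - ?s) * 2) dvd q ^ a * m" .
    \<comment> \<open>Since 2 ?s < a, the exponent 2 (a - ?s) is at least a + 1, one more than the
      group order allows.\<close>
    moreover have "q ^ Suc a dvd q ^ ((a - ?s) * 2)" using sa by (intro le_imp_power_dvd) simp
    ultimately have "q ^ Suc a dvd q ^ a * m" by (rule dvd_trans[rotated])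
    then have "q ^ a * q dvd q ^ a * m" by (simp only: power_Suc mult.commute)
    then show False using G(2) q(1) by (simp add: prime_gt_0_nat)
  qed
  obtain e where e: "bij_betw e {..<n} X"
    using ex_bij_betw_nat_finite[OF finX] by (auto simp: n_def atLeast0LessThan)
  \<comment> \<open>The V-component in the factorization G = V M, unique because V and M meet
    trivially.\<close>
  define vp where "vp = (\<lambda>g. SOME v. v \<in> V \<and> (\<exists>h \<in> M. g = v \<otimes> h))"
  have vp_eq: "vp (v \<otimes> h) = v" if v: "v \<in> V" and h: "h \<in> M" for v h
  proof -
    have "vp (v \<otimes> h) \<in> V \<and> (\<exists>h' \<in> M. v \<otimes> h = vp (v \<otimes> h) \<otimes> h')"
      unfolding vp_def by (rule someI[of _ v]) (use v h in blast)
    then obtain v' h' where v': "v' = vp (v \<otimes> h)" "v' \<in> V" "h' \<in> M" "v \<otimes> h = v' \<otimes> h'" by blast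
    have c: "v \<in> carrier G" "h \<in> carrier G" "v' \<in> carrier G" "h' \<in> carrier G"
      using V_carrier[OF v] Mc[OF h] V_carrier[OF v'(2)] Mc[OF v'(3)] by auto
    have "inv v' \<otimes> (v \<otimes> h) \<otimes> inv h = inv v' \<otimes> (v' \<otimes> h') \<otimes> inv h" using v'(4) by simp
    then have eq: "inv v' \<otimes> v = h' \<otimes> inv h"
      using c by (simp add: m_assoc) (simp add: m_assoc[symmetric])
    have "inv v' \<otimes> v \<in> V" using v v'(2) by (simp add: subgroup.m_closed[OF VD(1)] subgroup.m_inv_closed[OF VD(1)])
    moreover have "h' \<otimes> inv h \<in> M" using h v'(3) by (simp add: subgroup.m_closed[OF M] subgroup.m_inv_closed[OF M])
    ultimately have "inv v' \<otimes> v = \<one>" using VM(1) eq by auto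
    then have "v' \<otimes> (inv v' \<otimes> v) = v'" using c by simp
    then show ?thesis using c v'(1) by (simp add: m_assoc[symmetric])
  qed
  have vp_V: "vp v = v" if "v \<in> V" for v
    using vp_eq[OF that subgroup.one_closed[OF M]] V_carrier[OF that] by simp
  have vp_M: "vp h = \<one>" if "h \<in> M" for h
    using vp_eq[OF subgroup.one_closed[OF VD(1)] that] Mc[OF that] by simp
  \<comment> \<open>For g in V M_\<mu> this is the value at g of the character that extends \<mu>
    and is trivial on M_\<mu>. The same formula for all g supplies the remaining entries of the
    induced representation.\<close>
  define c where "c = (\<lambda>g (\<mu> :: 'a \<Rightarrow> complex). \<mu> (vp g))"
  interpret mono: monomial_data G dual_act X c V e n
  proof
    show "bij_betw e {..<n} X" by (rule e)
    show "n > 0" by (rule n0)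
    show "acts G (carrier G) dual_act X"
      unfolding acts_def
    proof (intro conjI ballI)
      show "subgroup (carrier G) G" by (rule subgroup_self)
      fix \<mu> assume \<mu>: "\<mu> \<in> X"
      then have \<mu>d: "\<mu> \<in> dual" using Xd by blast
      show "dual_act \<one> \<mu> = \<mu>" by (rule actsD(2)[OF dual_acts \<mu>d])
      fix g assume g: "g \<in> carrier G"
      obtain h where h: "h \<in> carrier G" "\<mu> = dual_act h \<mu>0" using \<mu> by (auto simp: X_def)
      have "dual_act g \<mu> = dual_act (g \<otimes> h) \<mu>0" using actsD(4)[OF dual_acts g h(1) \<mu>0(1)] h(2) by simp
      then show "dual_act g \<mu> \<in> X" using g h(1) by (auto simp: X_def)
      fix k assume k: "k \<in> carrier G"
      show "dual_act (g \<otimes> k) \<mu> = dual_act g (dual_act k \<mu>)" by (rule actsD(4)[OF dual_acts g k \<mu>d])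
    qed
    show "\<exists>g\<in>carrier G. dual_act g \<mu> = \<nu>" if \<mu>: "\<mu> \<in> X" and \<nu>: "\<nu> \<in> X" for \<mu> \<nu>
    proof -
      obtain g where g: "g \<in> carrier G" "\<mu> = dual_act g \<mu>0" using \<mu> by (auto simp: X_def)
      obtain h where h: "h \<in> carrier G" "\<nu> = dual_act h \<mu>0" using \<nu> by (auto simp: X_def)
      have "dual_act (h \<otimes> inv g) \<mu> = dual_act h (dual_act (inv g) (dual_act g \<mu>0))"
        using actsD(4)[OF dual_acts h(1) inv_closed[OF g(1)] dual_act_closed[OF g(1) \<mu>0(1)]] g(2) by simp
      also have "\<dots> = \<nu>" using acts_inv(1)[OF dual_acts g(1) \<mu>0(1)] h(2) by simp
      finally show ?thesis using g(1) h(1) by blast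
    qed
    show "c (g \<otimes> h) (dual_act (g \<otimes> h) \<mu>) = c g (dual_act (g \<otimes> h) \<mu>) * c h (dual_act h \<mu>)"
      if g: "g \<in> carrier G" and h: "h \<in> carrier G" and \<mu>: "\<mu> \<in> X" for g h \<mu>
    proof -
      have \<mu>d: "\<mu> \<in> dual" using \<mu> Xd by blast
      obtain v k where vk: "v \<in> V" "k \<in> M" "g = v \<otimes> k" using VM(2)[OF g] by blast
      obtain v' k' where vk': "v' \<in> V" "k' \<in> M" "h = v' \<otimes> k'" using VM(2)[OF h] by blast
      have cc: "v \<in> carrier G" "k \<in> carrier G" "v' \<in> carrier G" "k' \<in> carrier G"
        using V_carrier[OF vk(1)] Mc[OF vk(2)] V_carrier[OF vk'(1)] Mc[OF vk'(2)] by auto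
      let ?y = "k \<otimes> v' \<otimes> inv k" and ?\<nu> = "dual_act h \<mu>"
      have yV: "?y \<in> V" by (rule VD(2)[OF cc(2) vk'(1)])
      have \<nu>d: "?\<nu> \<in> dual" by (rule dual_act_closed[OF h \<mu>d])
      have gh: "dual_act (g \<otimes> h) \<mu> = dual_act g ?\<nu>" by (rule actsD(4)[OF dual_acts g h \<mu>d])
      have gd: "dual_act g ?\<nu> \<in> dual" by (rule dual_act_closed[OF g \<nu>d])
      have "g \<otimes> h = (v \<otimes> ?y) \<otimes> (k \<otimes> k')"
        using cc by (simp add: vk(3) vk'(3) m_assoc) (simp add: m_assoc[symmetric])
      then have vpgh: "vp (g \<otimes> h) = v \<otimes> ?y"
        using vp_eq[of "v \<otimes> ?y" "k \<otimes> k'"] subgroup.m_closed[OF VD(1) vk(1) yV] subgroup.m_closed[OF M vk(2) vk'(2)] by simp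
      have vpg: "vp g = v" "vp h = v'" using vp_eq[OF vk(1,2)] vp_eq[OF vk'(1,2)] vk(3) vk'(3) by auto
      have "inv v \<otimes> ?y \<otimes> v = inv v \<otimes> (v \<otimes> ?y)" using V_comm[OF yV vk(1)] cc by (simp add: m_assoc)
      also have "\<dots> = ?y" using cc by (simp add: m_assoc[symmetric])
      finally have y1: "inv v \<otimes> ?y \<otimes> v = ?y" .
      have "inv g \<otimes> ?y \<otimes> g = inv k \<otimes> (inv v \<otimes> ?y \<otimes> v) \<otimes> k"
        using cc by (simp add: vk(3) inv_mult_group m_assoc)
      also have "\<dots> = v'" unfolding y1 by (rule conj_conj_inv(2)[OF cc(2,3)])
      finally have "dual_act g ?\<nu> ?y = ?\<nu> v'" using yV by (simp add: dual_act_def)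
      then show ?thesis
        using dualD(1)[OF gd vk(1) yV] by (simp add: c_def vpgh vpg gh)
    qed
    show "c \<one> \<mu> = 1" if "\<mu> \<in> X" for \<mu>
      using vp_V[OF subgroup.one_closed[OF VD(1)]] that Xd dualD(2) by (auto simp: c_def)
    show "cmod (c g \<mu>) = 1" if "g \<in> carrier G" "\<mu> \<in> X" for g \<mu>
      using that Xd dual_norm by (auto simp: c_def)
    show "v \<in> carrier G" if "v \<in> V" for v using that V_carrier by blast
    show "dual_act v \<mu> = \<mu>" if "v \<in> V" "\<mu> \<in> X" for v \<mu> using that Xd dual_act_V by blast
    show "\<exists>v\<in>V. c v \<mu> \<noteq> c v \<nu>" if h: "\<mu> \<in> X" "\<nu> \<in> X" "\<mu> \<noteq> \<nu>" for \<mu> \<nu>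
    proof -
      obtain x where x: "\<mu> x \<noteq> \<nu> x" using h(3) by blast
      have "x \<in> V" using x dualD(3)[of \<mu> x] dualD(3)[of \<nu> x] h Xd by (metis subsetD)
      then show ?thesis using x vp_V by (intro bexI[of _ x]) (simp_all add: c_def)
    qed
  qed
  \<comment> \<open>Elements of M have trivial V-component, so their traces count fixed points in
    the orbit.\<close>
  have "\<exists>k::nat. mat_trace (mono.monomial_rep h) = of_nat k" if h: "h \<in> M" for h
    by (rule mono.monomial_trace_nat) (use vp_M[OF h] Xd dualD(2) in \<open>auto simp: c_def\<close>)
  then show thesis
    using mono.monomial_kernel by (intro that[OF max mono.monomial_irreducible _ _ ndvd]) auto
qed

end

section \<open>The theorem\<close>

lemma lower_central_image:
  assumes "group_hom G H \<pi>" "\<pi> ` carrier G = carrier H"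
  shows "lower_central H c = \<pi> ` lower_central G c"
proof (induction c)
  case 0
  then show ?case using assms(2) by simp
next
  case (Suc c)
  interpret group_hom G H \<pi> by (rule assms(1))
  have Lc: "lower_central G c \<subseteq> carrier G"
    using subgroup.subset[OF normal_imp_subgroup[OF G.lower_central_normal]] .
  let ?S = "\<Union>h\<in>lower_central G c. \<Union>k\<in>carrier G. {h \<otimes>\<^bsub>G\<^esub> k \<otimes>\<^bsub>G\<^esub> inv\<^bsub>G\<^esub> h \<otimes>\<^bsub>G\<^esub> inv\<^bsub>G\<^esub> k}"
  let ?T = "\<Union>h\<in>lower_central H c. \<Union>k\<in>carrier H. {h \<otimes>\<^bsub>H\<^esub> k \<otimes>\<^bsub>H\<^esub> inv\<^bsub>H\<^esub> h \<otimes>\<^bsub>H\<^esub> inv\<^bsub>H\<^esub> k}"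
  have img: "\<pi> (h \<otimes>\<^bsub>G\<^esub> k \<otimes>\<^bsub>G\<^esub> inv\<^bsub>G\<^esub> h \<otimes>\<^bsub>G\<^esub> inv\<^bsub>G\<^esub> k)
      = \<pi> h \<otimes>\<^bsub>H\<^esub> \<pi> k \<otimes>\<^bsub>H\<^esub> inv\<^bsub>H\<^esub> \<pi> h \<otimes>\<^bsub>H\<^esub> inv\<^bsub>H\<^esub> \<pi> k"
    if "h \<in> lower_central G c" "k \<in> carrier G" for h k
    using that Lc by (auto simp: subset_iff)
  have "?T = \<pi> ` ?S"
  proof (intro equalityI subsetI)
    fix x assume "x \<in> ?T"
    then obtain h' k' where x: "h' \<in> lower_central H c" "k' \<in> carrier H"
      "x = h' \<otimes>\<^bsub>H\<^esub> k' \<otimes>\<^bsub>H\<^esub> inv\<^bsub>H\<^esub> h' \<otimes>\<^bsub>H\<^esub> inv\<^bsub>H\<^esub> k'" by blast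
    obtain h where h: "h \<in> lower_central G c" "h' = \<pi> h" using x(1) Suc.IH by blast
    obtain k where k: "k \<in> carrier G" "k' = \<pi> k" using x(2) assms(2) by blast
    have "x = \<pi> (h \<otimes>\<^bsub>G\<^esub> k \<otimes>\<^bsub>G\<^esub> inv\<^bsub>G\<^esub> h \<otimes>\<^bsub>G\<^esub> inv\<^bsub>G\<^esub> k)"
      using img[OF h(1) k(1)] x(3) h(2) k(2) by simp
    then show "x \<in> \<pi> ` ?S" using h(1) k(1) by blast
  next
    fix x assume "x \<in> \<pi> ` ?S"
    then obtain h k where hk: "h \<in> lower_central G c" "k \<in> carrier G"
      "x = \<pi> (h \<otimes>\<^bsub>G\<^esub> k \<otimes>\<^bsub>G\<^esub> inv\<^bsub>G\<^esub> h \<otimes>\<^bsub>G\<^esub> inv\<^bsub>G\<^esub> k)" by blast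
    have "\<pi> h \<in> lower_central H c" "\<pi> k \<in> carrier H" using hk(1,2) Suc.IH assms(2) by auto
    then show "x \<in> ?T" unfolding hk(3) img[OF hk(1,2)] by blast
  qed
  moreover have "?S \<subseteq> carrier G" using Lc by auto
  ultimately show ?case
    by (simp only: lower_central.simps commutator_subgroup_def generate_img)
qed

context group
begin

lemma trace_class_function:
  assumes "representation G n \<rho>" "g \<in> carrier G" "x \<in> carrier G"
  shows "character_of G \<rho> (x \<otimes> g \<otimes> inv x) = character_of G \<rho> g"
  using trace_conj[OF assms] assms by (simp add: character_of_def)

lemma inner_induced_trace:
  assumes "finite (carrier G)" "subgroup M G" "representation G n \<rho>"
  shows "char_inner G (character_of G \<rho>) (induced G M (principal_character (G\<lparr>carrier := M\<rparr>)))
    = (\<Sum>m \<in> M. mat_trace (\<rho> m)) / of_nat (card M)"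
proof -
  have "(\<Sum>m \<in> M. character_of G \<rho> m) = (\<Sum>m \<in> M. mat_trace (\<rho> m))"
    using subgroup.mem_carrier[OF assms(2)] by (intro sum.cong) (auto simp: character_of_def)
  then show ?thesis
    using char_inner_induced_principal[OF assms(1,2) trace_class_function[OF assms(3)]] by simp
qed

lemma char_degree_character_of:
  assumes "irreducible_representation G n \<rho>"
  shows "char_degree G (character_of G \<rho>) = n"
proof -
  have "character_of G \<rho> \<in> Irr G" using assms by (auto simp: Irr_def)
  then have "(of_nat (char_degree G (character_of G \<rho>)) :: complex) = of_nat n"
    using of_nat_char_degree[OF is_group] character_of_one[OF is_group] assms
    by (simp add: irreducible_representation_def)
  then show ?thesis by simp
qed

lemma nilpotent_imp_degree_one:
  assumes "finite (carrier G)" "nilpotent G" "\<chi> \<in> Irr_P G"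
  shows "char_degree G \<chi> = 1"
proof -
  obtain M \<rho> n where max: "maximal_subgroup M G" and \<chi>: "\<chi> = character_of G \<rho>"
    and irr: "irreducible_representation G n \<rho>"
    and inner: "char_inner G \<chi> (induced G M (principal_character (G\<lparr>carrier := M\<rparr>))) \<noteq> 0"
    using assms(3) by (auto simp: Irr_P_def Irr_def)
  have rep: "representation G n \<rho>" using irr by (simp add: irreducible_representation_def)
  have M: "subgroup M G" using max by (simp add: maximal_subgroup_def)
  have "(\<Sum>m \<in> M. mat_trace (\<rho> m)) \<noteq> 0"
    using inner inner_induced_trace[OF assms(1) M rep] by (auto simp: \<chi>)
  moreover have "g \<otimes> m \<otimes> inv g \<in> M" if "g \<in> carrier G" "m \<in> M" for g m
    using nilpotent_maximal_normal[OF assms(1,2) max that] .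
  ultimately have "n = 1" by (intro degree_one_of_normal_maximal[OF irr assms(1) max])
  then show ?thesis using char_degree_character_of[OF irr] \<chi> by simp
qed

text \<open>The bad representation of the quotient by K is inflated to G. Preimages of maximal
  subgroups are maximal, and traces on the preimage of M remain natural numbers, so the inflated
  character lies in \<open>Irr_P G\<close>.\<close>

lemma not_nilpotent_imp_bad_character:
  assumes fin: "finite (carrier G)" and solv: "solvable G" and nn: "\<not> nilpotent G"
  shows "\<exists>\<chi> \<in> Irr_P G. \<not> (char_degree G \<chi>)\<^sup>2 dvd card (rcosets (char_ker G \<chi>))"
proof -
  \<comment> \<open>\<open>P K\<close> expresses that the quotient by K is not nilpotent without
    forming it. A choice of K of largest order makes every proper quotient of G/K nilpotent.\<close>
  define P where "P = (\<lambda>K. K \<lhd> G \<and> (\<forall>c. \<not> lower_central G c \<subseteq> K))"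
  have "P {\<one>}"
  proof -
    have "\<not> lower_central G c \<subseteq> {\<one>}" for c
    proof
      assume "lower_central G c \<subseteq> {\<one>}"
      then have "lower_central G c = {\<one>}"
        using subgroup.one_closed[OF normal_imp_subgroup[OF lower_central_normal[of c]]] by blast
      then show False using nn by (auto simp: nilpotent_def)
    qed
    then show ?thesis using one_is_normal by (simp add: P_def)
  qed
  moreover have "card K < Suc (card (carrier G))" if "P K" for K
    using that card_mono[OF fin, of K] subgroup.subset normal_imp_subgroup unfolding P_def by (metis less_Suc_eq_le)
  ultimately obtain K where K: "P K" and maxK: "\<And>L. P L \<Longrightarrow> card L \<le> card K"
    using ex_has_greatest_nat[of P "{\<one>}" card "Suc (card (carrier G))"] by blast
  have KG: "K \<lhd> G" and Kc: "\<And>c. \<not> lower_central G c \<subseteq> K" using K by (auto simp: P_def)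
  have Ks: "subgroup K G" by (rule normal_imp_subgroup[OF KG])
  define H where "H = G Mod K"
  define \<pi> where "\<pi> = (\<lambda>g. r_coset G K g)"
  have gH: "group H" unfolding H_def by (rule normal.factorgroup_is_group[OF KG])
  have hom: "\<pi> \<in> hom G H" unfolding H_def \<pi>_def by (rule normal.r_coset_hom_Mod[OF KG])
  have gh: "group_hom G H \<pi>" using gH hom is_group by (simp add: group_hom_def group_hom_axioms_def)
  have surj: "\<pi> ` carrier G = carrier H" by (auto simp: H_def \<pi>_def carrier_FactGroup)
  have one: "\<one>\<^bsub>H\<^esub> = K" by (simp add: H_def)
  have ker: "\<pi> g = \<one>\<^bsub>H\<^esub> \<longleftrightarrow> g \<in> K" if "g \<in> carrier G" for g
  proof
    assume "\<pi> g = \<one>\<^bsub>H\<^esub>"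
    then show "g \<in> K" using rcos_self[OF that Ks] by (simp add: \<pi>_def one)
  next
    assume "g \<in> K"
    then show "\<pi> g = \<one>\<^bsub>H\<^esub>" using coset_join2[OF that Ks] by (simp add: \<pi>_def one)
  qed
  interpret H: group H by (rule gH)
  interpret \<pi>: group_hom G H \<pi> by (rule gh)
  have finH: "finite (carrier H)" using fin surj by (metis finite_imageI)
  have pre: "subgroup {g \<in> carrier G. \<pi> g \<in> L} G" if L: "subgroup L H" for L
  proof (rule subgroupI)
    show "{g \<in> carrier G. \<pi> g \<in> L} \<subseteq> carrier G" by blast
    have "\<one> \<in> {g \<in> carrier G. \<pi> g \<in> L}" using subgroup.one_closed[OF L] by simp
    then show "{g \<in> carrier G. \<pi> g \<in> L} \<noteq> {}" by blast
    fix a assume a: "a \<in> {g \<in> carrier G. \<pi> g \<in> L}"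
    then show "inv a \<in> {g \<in> carrier G. \<pi> g \<in> L}" using subgroup.m_inv_closed[OF L] by simp
    fix b assume "b \<in> {g \<in> carrier G. \<pi> g \<in> L}"
    then show "a \<otimes> b \<in> {g \<in> carrier G. \<pi> g \<in> L}" using a subgroup.m_closed[OF L] by simp
  qed
  have nonnil: "\<not> lower_central H c \<subseteq> {\<one>\<^bsub>H\<^esub>}" for c
  proof
    assume "lower_central H c \<subseteq> {\<one>\<^bsub>H\<^esub>}"
    then have "\<pi> g = \<one>\<^bsub>H\<^esub>" if "g \<in> lower_central G c" for g
      using that lower_central_image[OF gh surj] by blast
    moreover have "lower_central G c \<subseteq> carrier G"
      using subgroup.subset[OF normal_imp_subgroup[OF lower_central_normal]] .
    ultimately have "lower_central G c \<subseteq> K" using ker by blast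
    then show False using Kc by blast
  qed
  have quot: "\<exists>c. lower_central H c \<subseteq> L" if L: "L \<lhd> H" "L \<noteq> {\<one>\<^bsub>H\<^esub>}" for L
  proof -
    let ?L = "{g \<in> carrier G. \<pi> g \<in> L}"
    note HL = H.normalD[OF L(1)]
    have Ln: "?L \<lhd> G"
    proof (rule normal_invI[OF pre[OF HL(1)]])
      fix g x assume "g \<in> carrier G" "x \<in> ?L"
      then show "g \<otimes> x \<otimes> inv g \<in> ?L" using HL(2)[of "\<pi> g" "\<pi> x"] by simp
    qed
    have KL: "K \<subseteq> ?L"
    proof
      fix x assume x: "x \<in> K"
      have xc: "x \<in> carrier G" by (rule subgroup.mem_carrier[OF Ks x])
      then show "x \<in> ?L" using x ker[OF xc] subgroup.one_closed[OF HL(1)] by simp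
    qed
    obtain l where l: "l \<in> L" "l \<noteq> \<one>\<^bsub>H\<^esub>" using L(2) subgroup.one_closed[OF HL(1)] by blast
    obtain g where g: "g \<in> carrier G" "l = \<pi> g" using l(1) subgroup.mem_carrier[OF HL(1)] surj by blast
    have "g \<in> ?L" "g \<notin> K" using g l ker by auto
    then have "K \<subset> ?L" using KL by blast
    then have "card K < card ?L" using fin by (intro psubset_card_mono) auto
    then have "\<not> P ?L" using maxK[of ?L] by auto
    then obtain c where "lower_central G c \<subseteq> ?L" using Ln by (auto simp: P_def)
    then have "lower_central H c \<subseteq> L" unfolding lower_central_image[OF gh surj] by auto
    then show ?thesis ..
  qed
  have solvH: "solvable H"
    using \<pi>.solvable_imp_solvable_img[of "carrier G"] solv surj by (simp add: solvable_def)
  have "carrier H \<noteq> {\<one>\<^bsub>H\<^esub>}" using nonnil[of 0] by auto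
  then obtain V p where V: "V \<lhd> H" "V \<noteq> {\<one>\<^bsub>H\<^esub>}" "\<forall>x \<in> V. \<forall>y \<in> V. x \<otimes>\<^bsub>H\<^esub> y = y \<otimes>\<^bsub>H\<^esub> x"
    "prime (p::nat)" "\<forall>x \<in> V. x [^]\<^bsub>H\<^esub> p = \<one>\<^bsub>H\<^esub>"
    "\<forall>L. L \<lhd> H \<longrightarrow> L \<subseteq> V \<longrightarrow> L = {\<one>\<^bsub>H\<^esub>} \<or> L = V"
    by (rule H.exists_minimal_normal[OF finH solvH])
  interpret N: minimal_nonnilpotent H V p
  proof (intro minimal_nonnilpotent.intro minimal_nonnilpotent_axioms.intro)
    show "group H" by (rule gH)
    show "finite (carrier H)" by (rule finH)
    show "\<not> lower_central H c \<subseteq> {\<one>\<^bsub>H\<^esub>}" for c by (rule nonnil)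
    show "\<exists>c. lower_central H c \<subseteq> L" if "L \<lhd> H" "L \<noteq> {\<one>\<^bsub>H\<^esub>}" for L using quot[OF that] .
    show "V \<lhd> H" "V \<noteq> {\<one>\<^bsub>H\<^esub>}" "prime p" by (rule V)+
    show "x \<otimes>\<^bsub>H\<^esub> y = y \<otimes>\<^bsub>H\<^esub> x" if "x \<in> V" "y \<in> V" for x y using V(3) that by blast
    show "x [^]\<^bsub>H\<^esub> p = \<one>\<^bsub>H\<^esub>" if "x \<in> V" for x using V(5) that by blast
    show "L = {\<one>\<^bsub>H\<^esub>} \<or> L = V" if "L \<lhd> H" "L \<subseteq> V" for L using V(6) that by blast
  qed
  obtain M n \<rho> where max: "maximal_subgroup M H" and irr: "irreducible_representation H n \<rho>"
    and nat: "\<forall>m \<in> M. \<exists>k::nat. mat_trace (\<rho> m) = of_nat k"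
    and trk: "\<forall>g \<in> carrier H. mat_trace (\<rho> g) = of_nat n \<longrightarrow> \<rho> g = 1\<^sub>m n"
    and ndvd: "\<not> n\<^sup>2 dvd card (carrier H)"
    by (rule N.bad_representation)
  have rep: "representation H n \<rho>" and n0: "n \<noteq> 0" using irr by (auto simp: irreducible_representation_def)
  have MH: "subgroup M H" "M \<noteq> carrier H" and maxM: "\<And>L. subgroup L H \<Longrightarrow> M \<subseteq> L \<Longrightarrow> L = M \<or> L = carrier H"
    using max by (auto simp: maximal_subgroup_def)
  define \<sigma> where "\<sigma> = \<rho> \<circ> \<pi>"
  have rep': "representation G n \<sigma>" 
    using H.representationD[OF rep] unfolding \<sigma>_def by (intro representationI) auto
  have irr': "irreducible_representation G n \<sigma>"
    unfolding irreducible_representation_def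
  proof (intro conjI allI impI)
    show "representation G n \<sigma>" by (rule rep')
    show "n \<noteq> 0" by (rule n0)
    fix W assume W: "VectorSpace.subspace class_ring W (module_vec TYPE(complex) n)"
      and inv: "\<forall>g\<in>carrier G. \<forall>w\<in>W. \<sigma> g *\<^sub>v w \<in> W"
    have "\<forall>h\<in>carrier H. \<forall>w\<in>W. \<rho> h *\<^sub>v w \<in> W"
    proof (intro ballI)
      fix h w assume h: "h \<in> carrier H" and w: "w \<in> W"
      obtain g where "g \<in> carrier G" "h = \<pi> g" using h surj by blast
      then show "\<rho> h *\<^sub>v w \<in> W" using inv w by (simp add: \<sigma>_def)
    qed
    then show "W = {0\<^sub>v n} \<or> W = carrier_vec n"
      using irr W unfolding irreducible_representation_def by blast
  qed
  let ?M = "{g \<in> carrier G. \<pi> g \<in> M}"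
  have M': "subgroup ?M G" by (rule pre[OF MH(1)])
  have max': "maximal_subgroup ?M G"
    unfolding maximal_subgroup_def
  proof (intro conjI allI impI)
    show "subgroup ?M G" by (rule M')
    obtain h where h: "h \<in> carrier H" "h \<notin> M" using MH subgroup.subset by blast
    then obtain g where "g \<in> carrier G" "h = \<pi> g" using surj by blast
    then show "?M \<noteq> carrier G" using h by blast
    fix L assume L: "subgroup L G" "?M \<subseteq> L"
    note Lc = subgroup.mem_carrier[OF L(1)]
    have L1: "g \<in> L" if g: "g \<in> carrier G" "\<pi> g \<in> \<pi> ` L" for g
    proof -
      obtain l where l: "l \<in> L" "\<pi> g = \<pi> l" using g(2) by blast
      have lc: "l \<in> carrier G" by (rule Lc[OF l(1)])
      have "\<pi> (g \<otimes> inv l) = \<one>\<^bsub>H\<^esub>" using g(1) lc l(2) by simp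
      then have "g \<otimes> inv l \<in> ?M" using g(1) lc subgroup.one_closed[OF MH(1)] by simp
      then have "g \<otimes> inv l \<in> L" using L(2) by blast
      then have "g \<otimes> inv l \<otimes> l \<in> L" using l(1) by (rule subgroup.m_closed[OF L(1)])
      then show ?thesis using g(1) lc by (simp add: m_assoc)
    qed
    have "M \<subseteq> \<pi> ` L"
    proof
      fix h assume h: "h \<in> M"
      then obtain g where g: "g \<in> carrier G" "h = \<pi> g" using subgroup.mem_carrier[OF MH(1)] surj by blast
      then have "g \<in> L" using h L(2) by blast
      then show "h \<in> \<pi> ` L" using g(2) by blast
    qed
    moreover have "subgroup (\<pi> ` L) H" by (rule \<pi>.subgroup_img_is_subgroup[OF L(1)])
    ultimately have "\<pi> ` L = M \<or> \<pi> ` L = carrier H" by (intro maxM)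
    then show "L = ?M \<or> L = carrier G"
    proof
      assume "\<pi> ` L = M"
      then have "L \<subseteq> ?M" using Lc by blast
      then show ?thesis using L(2) by blast
    next
      assume "\<pi> ` L = carrier H"
      then have "g \<in> L" if "g \<in> carrier G" for g
        using L1[OF that] \<pi>.hom_closed[OF that] by simp
      then show ?thesis using Lc by blast
    qed
  qed
  define \<chi> where "\<chi> = character_of G \<sigma>"
  have "(\<Sum>m \<in> ?M. mat_trace (\<sigma> m)) \<noteq> 0"
  proof -
    have "\<forall>m \<in> ?M. \<exists>k::nat. mat_trace (\<sigma> m) = of_nat k" using nat by (simp add: \<sigma>_def)
    then obtain f :: "'a \<Rightarrow> nat" where f: "\<forall>m \<in> ?M. mat_trace (\<sigma> m) = of_nat (f m)" by metis
    have oneM: "\<one> \<in> ?M" by (rule subgroup.one_closed[OF M'])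
    have "mat_trace (\<sigma> \<one>) = of_nat n"
      using character_of_one[OF is_group rep'] by (simp add: character_of_def)
    then have f1: "f \<one> = n" using f oneM by simp
    \<comment> \<open>The identity contributes the positive degree and all other terms are natural
      numbers, so nothing can cancel.\<close>
    have "f \<one> \<le> (\<Sum>m \<in> ?M. f m)" using fin oneM by (intro member_le_sum) auto
    then have "(\<Sum>m \<in> ?M. f m) \<noteq> 0" using f1 n0 by simp
    moreover have "(\<Sum>m \<in> ?M. mat_trace (\<sigma> m)) = of_nat (\<Sum>m \<in> ?M. f m)"
      using f by (simp add: of_nat_sum)
    ultimately show ?thesis by (simp only: of_nat_eq_0_iff not_False_eq_True)
  qed
  moreover have "card ?M \<noteq> 0" using fin subgroup.one_closed[OF M'] by auto
  ultimately have inner: "char_inner G \<chi> (induced G ?M (principal_character (G\<lparr>carrier := ?M\<rparr>))) \<noteq> 0"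
    using inner_induced_trace[OF fin M' rep'] by (simp add: \<chi>_def)
  have "\<chi> \<in> Irr G" using irr' by (auto simp: \<chi>_def Irr_def)
  then have "\<chi> \<in> Irr_P G" using max' inner by (auto simp: Irr_P_def)
  moreover have "\<not> (char_degree G \<chi>)\<^sup>2 dvd card (rcosets (char_ker G \<chi>))"
  proof
    assume dv: "(char_degree G \<chi>)\<^sup>2 dvd card (rcosets (char_ker G \<chi>))"
    have chi_one: "\<chi> \<one> = of_nat n" unfolding \<chi>_def by (rule character_of_one[OF is_group rep'])
    have ker_eq: "char_ker G \<chi> = {g \<in> carrier G. \<sigma> g = 1\<^sub>m n}"
    proof (intro equalityI subsetI)
      fix g assume "g \<in> char_ker G \<chi>"
      then have g: "g \<in> carrier G" "mat_trace (\<sigma> g) = of_nat n"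
        using chi_one by (auto simp: char_ker_def \<chi>_def character_of_def)
      then have "\<sigma> g = 1\<^sub>m n" using trk \<pi>.hom_closed[OF g(1)] by (simp add: \<sigma>_def)
      then show "g \<in> {g \<in> carrier G. \<sigma> g = 1\<^sub>m n}" using g by simp
    next
      fix g assume "g \<in> {g \<in> carrier G. \<sigma> g = 1\<^sub>m n}"
      then have g: "g \<in> carrier G" "\<sigma> g = \<sigma> \<one>" using representationD(3)[OF rep'] by auto
      then show "g \<in> char_ker G \<chi>" by (simp add: char_ker_def \<chi>_def character_of_def)
    qed
    let ?N = "char_ker G \<chi>"
    note r = representationD[OF rep']
    have N: "subgroup ?N G"
      unfolding ker_eq
    proof (rule subgroupI)
      show "{g \<in> carrier G. \<sigma> g = 1\<^sub>m n} \<subseteq> carrier G" by blast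
      have "\<one> \<in> {g \<in> carrier G. \<sigma> g = 1\<^sub>m n}" using r(3) by simp
      then show "{g \<in> carrier G. \<sigma> g = 1\<^sub>m n} \<noteq> {}" by blast
      fix a assume a: "a \<in> {g \<in> carrier G. \<sigma> g = 1\<^sub>m n}"
      then have "\<sigma> (inv a) * \<sigma> a = 1\<^sub>m n" using r(2)[of "inv a" a] r(3) by simp
      then show "inv a \<in> {g \<in> carrier G. \<sigma> g = 1\<^sub>m n}" using a r(1)[of "inv a"] by simp
      fix b assume "b \<in> {g \<in> carrier G. \<sigma> g = 1\<^sub>m n}"
      then show "a \<otimes> b \<in> {g \<in> carrier G. \<sigma> g = 1\<^sub>m n}" using a r(2)[of a b] by simp
    qed
    have "K \<subseteq> ?N"
    proof
      fix x assume x: "x \<in> K"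
      have xc: "x \<in> carrier G" by (rule subgroup.mem_carrier[OF Ks x])
      have "\<sigma> x = 1\<^sub>m n" using ker[OF xc] x H.representationD(3)[OF rep] by (simp add: \<sigma>_def)
      then show "x \<in> ?N" using xc by (simp add: ker_eq)
    qed
    then have "card K dvd card ?N" by (rule card_subgroup_dvd[OF fin Ks N])
    then obtain t where t: "card ?N = card K * t" by (elim dvdE)
    have K0: "card K \<noteq> 0" using subgroup.one_closed[OF Ks] subgroup_finite[OF fin Ks] by auto
    \<comment> \<open>As K lies in the kernel of the character, the index of that kernel divides the
      order of the quotient by K; divisibility by the squared degree would pass to that
      order.\<close>
    have "card (rcosets ?N) * card ?N = card (rcosets K) * card K"
      using lagrange[OF N] lagrange[OF Ks] by simp
    then have "card (rcosets K) * card K = (card (rcosets ?N) * t) * card K" unfolding t by (simp only: mult.assoc mult.commute[of t])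
    then have "card (rcosets K) = card (rcosets ?N) * t" using K0 by simp
    moreover have "carrier H = rcosets K" by (simp add: H_def FactGroup_def)
    ultimately have "card (rcosets ?N) dvd card (carrier H)" by simp
    moreover have "char_degree G \<chi> = n" unfolding \<chi>_def by (rule char_degree_character_of[OF irr'])
    ultimately have "n\<^sup>2 dvd card (carrier H)" using dv dvd_trans by metis
    then show False using ndvd by simp
  qed
  ultimately show ?thesis by blast
qed

end

theorem theorem2:
  fixes G :: "('a, 'b) monoid_scheme"
  assumes "group G" and "finite (carrier G)" and "solvable G"
  shows "nilpotent G \<longleftrightarrow>
    (\<forall>\<chi> \<in> Irr_P G. (char_degree G \<chi>)\<^sup>2 dvd card (rcosets\<^bsub>G\<^esub> (char_ker G \<chi>)))"
proof
  interpret group G by (rule assms(1))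
  show "\<forall>\<chi> \<in> Irr_P G. (char_degree G \<chi>)\<^sup>2 dvd card (rcosets\<^bsub>G\<^esub> (char_ker G \<chi>))" if "nilpotent G"
    using nilpotent_imp_degree_one[OF assms(2) that] by simp
  show "nilpotent G" if "\<forall>\<chi> \<in> Irr_P G. (char_degree G \<chi>)\<^sup>2 dvd card (rcosets\<^bsub>G\<^esub> (char_ker G \<chi>))"
    using not_nilpotent_imp_bad_character[OF assms(2,3)] that by blast
qed

end
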